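(* Let $\eta$ be the Dedekind eta function and $q=\exp(2\pi i\tau)$. Define the sequences $\{T_i(n)\}_{n\ge0}$ for $i=1,2,3$ by $$\sum_{n=0}^{\infty}T_i(n)t_i^n=Z_i,$$ where \begin{align*} t_1(\tau)&=\frac{\eta(\tau)^2\eta(11\tau)^2}{\left(\sum_{j,k\in\mathbb{Z}}q^{j^2+jk+3k^2}\right)^2}, & Z_1(\tau)&=\sum_{j,k\in\mathbb{Z}}q^{j^2+jk+3k^2},\\ t_2(\tau)&=\frac{\eta(\tau)\eta(23\tau)}{\sum_{j,k\in\mathbb{Z}}q^{j^2+jk+6k^2}}, & Z_2(\tau)&=\sum_{j,k\in\mathbb{Z}}q^{j^2+jk+6k^2},\\ t_3(\tau)&=\frac{\eta(\tau)\eta(23\tau)}{\sum_{j,k\in\mathbb{Z}}q^{2j^2+jk+3k^2}}, & Z_3(\tau)&=\sum_{j,k\in\mathbb{Z}}q^{2j^2+jk+3k^2}. \end{align*} Then the sequence $\{T_1(n)\}$ satisfies the Lucas congruences modulo $p$ for $p=2,11$ and any prime $p$ such that $\left(\frac{-11}{p}\right)=1$. Similarly, the sequences $\{T_2(n)\}$ and $\{T_3(n)\}$ satisfy the Lucas congruences modulo $p$ for $p=2,23$ and any prime $p$ such that $\left(\frac{-23}{p}\right)=1$.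
   Context: $\eta(\tau)=q^{1/24}\prod_{n\ge1}(1-q^n)$ with $q=\exp(2\pi i\tau)$, $\mathrm{Im}(\tau)>0$. Each $t_i$ has a $q$-expansion in $q+q^2\mathbb{Z}[[q]]$ and each $Z_i$ one in $1+q\mathbb{Z}[[q]]$; the identity $\sum T_i(n)t_i^n=Z_i$ is one of power series in $q$ and determines the integers $T_i(n)$ uniquely. $\left(\frac{\cdot}{p}\right)$ is the Legendre symbol. Lucas congruences: a sequence of integers $\{T(n)\}_{n\ge0}$ satisfies the Lucas congruences modulo a prime $p$ if for every $n\ge0$ with base-$p$ expansion $n=n_0+n_1p+\cdots+n_sp^s$, $0\le n_i\le p-1$, one has $T(n)\equiv T(n_0)T(n_1)\cdots T(n_s)\pmod p$. *)

theory Defs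
  imports
    "HOL-Complex_Analysis.Complex_Analysis"
    "HOL-Number_Theory.Number_Theory"
begin

definition nome :: "complex \<Rightarrow> complex" where
  "nome \<tau> = exp (2 * of_real pi * \<i> * \<tau>)"

text \<open>
  The factor \<open>q\<^sup>1\<^sup>/\<^sup>2\<^sup>4\<close> denotes the branch \<open>exp (2 \<pi> \<i> \<tau> / 24)\<close>.
  The functions below are only meaningful for \<open>Im \<tau> > 0\<close>.
\<close>

definition dedekind_eta :: "complex \<Rightarrow> complex" where
  "dedekind_eta \<tau> = exp (2 * of_real pi * \<i> * \<tau> / 24) * (\<Prod>n. 1 - nome \<tau> ^ Suc n)"

definition Z1 :: "complex \<Rightarrow> complex" where
  "Z1 \<tau> = (\<Sum>\<^sub>\<infinity>(j, k)\<in>(UNIV :: (int \<times> int) set). nome \<tau> powi (j^2 + j * k + 3 * k^2))"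

definition Z2 :: "complex \<Rightarrow> complex" where
  "Z2 \<tau> = (\<Sum>\<^sub>\<infinity>(j, k)\<in>(UNIV :: (int \<times> int) set). nome \<tau> powi (j^2 + j * k + 6 * k^2))"

definition Z3 :: "complex \<Rightarrow> complex" where
  "Z3 \<tau> = (\<Sum>\<^sub>\<infinity>(j, k)\<in>(UNIV :: (int \<times> int) set). nome \<tau> powi (2 * j^2 + j * k + 3 * k^2))"

definition t1 :: "complex \<Rightarrow> complex" where
  "t1 \<tau> = dedekind_eta \<tau> ^ 2 * dedekind_eta (11 * \<tau>) ^ 2 / Z1 \<tau> ^ 2"

definition t2 :: "complex \<Rightarrow> complex" where
  "t2 \<tau> = dedekind_eta \<tau> * dedekind_eta (23 * \<tau>) / Z2 \<tau>"

definition t3 :: "complex \<Rightarrow> complex" where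
  "t3 \<tau> = dedekind_eta \<tau> * dedekind_eta (23 * \<tau>) / Z3 \<tau>"

text \<open>
  The expansion is only required near the cusp \<open>Im \<tau> \<longrightarrow> \<infinity>\<close> (that is, near \<open>q = 0\<close>), because the
  quotients \<open>t1\<close>, \<open>t2\<close>, \<open>t3\<close> may have poles in the upper half-plane. It is unique if it exists.
\<close>

definition has_q_expansion :: "(complex \<Rightarrow> complex) \<Rightarrow> complex fps \<Rightarrow> bool" where
  "has_q_expansion f F \<longleftrightarrow>
     (\<exists>g. g has_fps_expansion F \<and> (\<forall>\<^sub>F \<tau> in filtercomap Im at_top. f \<tau> = g (nome \<tau>)))"

text \<open>
  The identity \<open>\<Sum>n. T n * t\<^sup>n = Z\<close>, read as an identity of formal power series in \<open>q\<close>: here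
  \<open>sums\<close> is convergence in the \<open>q\<close>-adic metric on formal power series.
\<close>

definition expansion_coeffs ::
    "(complex \<Rightarrow> complex) \<Rightarrow> (complex \<Rightarrow> complex) \<Rightarrow> (nat \<Rightarrow> int) \<Rightarrow> bool" where
  "expansion_coeffs t Z T \<longleftrightarrow>
     (\<exists>F G. has_q_expansion t F \<and> has_q_expansion Z G \<and> (\<lambda>n. of_int (T n) * F ^ n) sums G)"

text \<open>
  The digits are \<open>d 0, \<dots>, d s\<close>. Leading zeros are allowed.
\<close>

definition lucas_congruences :: "(nat \<Rightarrow> int) \<Rightarrow> nat \<Rightarrow> bool" where
  "lucas_congruences T p \<longleftrightarrow>
     (\<forall>n s (d :: nat \<Rightarrow> nat). (\<forall>i\<le>s. d i \<le> p - 1) \<and> n = (\<Sum>i\<le>s. d i * p ^ i) \<longrightarrow>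
        [T n = (\<Prod>i\<le>s. T (d i))] (mod int p))"

end

theory Submission
  imports Defs "HOL-Probability.Probability"
begin

text \<open>
  Write \<open>z\<close> for the theta series, \<open>h\<close> for the eta product and \<open>t = h / z\<^sup>w\<close>, where \<open>w\<close> is the weight of \<open>h\<close>
  (\<open>2\<close> at level 11, \<open>1\<close> at level 23). The Lucas congruences modulo \<open>p\<close> follow from a congruence
  \<open>z \<equiv> A(t) z\<^sup>p\<close> with a polynomial \<open>A\<close> of degree less than \<open>p\<close>.
  Since \<open>h\<close> has no zeros apart from a simple one at each of the two cusps, subtracting multiples of
  \<open>h\<^sup>i z\<^sup>k\<^sup>-\<^sup>w\<^sup>i\<close> from a form of weight \<open>k\<close> pushes its order at the cusps beyond what a maximum principle
  allows, so every such form is a combination of these products, with integral coefficients if its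
  expansion is integral.
  If \<open>-N\<close> is a square modulo \<open>p\<close>, the Hecke operator \<open>T\<^sub>p\<close>, which modulo \<open>p\<close> sends \<open>f\<^sup>p\<close> to \<open>f\<close>, turns \<open>h\<^sup>p\<close> (level 23)
  or \<open>z\<^sup>p\<close> (level 11) into a form congruent to \<open>h\<close> or \<open>z\<close>, and writing that form in terms of \<open>z\<close> and \<open>h\<close>
  gives \<open>A\<close>. For \<open>p = N\<close> the same works with \<open>\<Delta>(\<tau>)\<^sup>e + N\<^sup>6\<^sup>e \<Delta>(N \<tau>)\<^sup>e\<close>, which is congruent to \<open>h\<^sup>e\<close>, and for
  \<open>p = 2\<close> one has \<open>z \<equiv> 1\<close>.
  The transformation laws of \<open>z\<close> and \<open>\<Delta>\<close> come from Poisson summation, for \<open>\<Delta>\<close> by way of the pentagonal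
  number theorem.
\<close>

subsection \<open>Poisson summation for Gaussians\<close>

text \<open>Gamma_0(N) itself never appears: a form is replaced by the vector of its translates, one
  for each nonzero row (c, d) modulo the prime N, and only the law of this vector under inversion is
  required. The same power series sits at both cusps, so each form is an eigenfunction of the Fricke
  involution, and vanishing at one cusp is vanishing at both. This halves the number of coefficients
  that determine a form and keeps the degree of A below p. It also produces the condition on odd p:
  the Hecke operator respects the symmetry between the cusps only up to the character value of p,
  which in odd weight has to be 1, and by quadratic reciprocity this says that -N is a square modulo
  p. The two levels are those with w (N + 1) = 24 for w = 2 and w = 1, where (eta(tau) eta(N tau))^w
  begins with q and has weight w. Its exact transformation law is the obstacle: Delta(tau) Delta(N
  tau) determines it only up to a root of unity. It is recovered from a genuine cusp form built from
  theta series.\<close>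

lemma integral_cis_int:
  fixes n :: int
  shows "integral {0..1} (\<lambda>x. cis (2 * pi * n * x)) = (if n = 0 then 1 else 0)"
proof (cases "n = 0")
  case False
  define c where "c = 2 * pi * \<i> * of_int n"
  have c: "c \<noteq> 0" using False by (simp add: c_def)
  have eq: "cis (2 * pi * n * x) = exp (c * of_real x)" for x
    by (simp add: cis_conv_exp c_def mult_ac)
  have "((\<lambda>x. cis (2 * pi * n * x)) has_integral (exp (c * of_real 1) / c - exp (c * of_real 0) / c)) {0..1}"
    unfolding eq using c
    by (intro fundamental_theorem_of_calculus)
       (auto intro!: derivative_eq_intros has_vector_derivative_real_field simp: c_def)
  moreover have "exp c = 1"
    by (simp add: c_def exp_eq_1)
  ultimately show ?thesis using False by (simp add: integral_unique)
qed simp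

text \<open>Bessel's inequality in disguise: removing one frequency at a time lowers the energy by
  \<open>(cmod a)\<^sup>2\<close>.\<close>

lemma constant_Fourier_coeffs_zero:
  fixes h :: "real \<Rightarrow> complex" and s :: int
  assumes h: "continuous_on {0..1} h" and s: "s \<noteq> 0"
    and coeff: "\<And>n::nat. integral {0..1} (\<lambda>x. h x * cis (- 2 * pi * (s * int n) * x)) = a"
  shows "a = 0"
proof -
  define e where "e = (\<lambda>n x. cis (2 * pi * (s * int n) * x))"
  define S where "S = (\<lambda>M x. h x - (\<Sum>n<M. a * e n x))"
  have cont_e: "continuous_on {0..1} (e n)" for n
    unfolding e_def by (intro continuous_intros)
  have cont_S: "continuous_on {0..1} (S M)" for M
    unfolding S_def by (intro continuous_intros h cont_e)
  have ee: "integral {0..1} (\<lambda>x. e m x * cnj (e n x)) = (if m = n then 1 else 0)" for m n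
  proof -
    have "e m x * cnj (e n x) = cis (2 * pi * (s * (int m - int n)) * x)" for x
      by (simp add: e_def cis_cnj cis_mult algebra_simps)
    then show ?thesis using integral_cis_int[of "s * (int m - int n)"] s by simp
  qed
  have Se: "integral {0..1} (\<lambda>x. S M x * cnj (e M x)) = a" for M
  proof -
    have "integral {0..1} (\<lambda>x. S M x * cnj (e M x))
        = integral {0..1} (\<lambda>x. h x * cnj (e M x) - (\<Sum>n<M. a * (e n x * cnj (e M x))))"
      by (simp add: S_def algebra_simps sum_distrib_left sum_distrib_right)
    also have "\<dots> = integral {0..1} (\<lambda>x. h x * cnj (e M x))
        - integral {0..1} (\<lambda>x. (\<Sum>n<M. a * (e n x * cnj (e M x))))"
      by (intro Henstock_Kurzweil_Integration.integral_diff integrable_continuous_real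
            continuous_intros h cont_e)
    also have "integral {0..1} (\<lambda>x. (\<Sum>n<M. a * (e n x * cnj (e M x))))
        = (\<Sum>n<M. integral {0..1} (\<lambda>x. a * (e n x * cnj (e M x))))"
      by (intro Henstock_Kurzweil_Integration.integral_sum integrable_continuous_real
            continuous_intros h cont_e) auto
    also have "(\<Sum>n<M. integral {0..1} (\<lambda>x. a * (e n x * cnj (e M x)))) = 0"
      by (intro sum.neutral) (simp add: ee)
    also have "integral {0..1} (\<lambda>x. h x * cnj (e M x)) = a"
      using coeff[of M] by (simp add: e_def cis_cnj)
    finally show ?thesis by simp
  qed
  have step: "integral {0..1} (\<lambda>x. (cmod (S (Suc M) x))\<^sup>2)
      = integral {0..1} (\<lambda>x. (cmod (S M x))\<^sup>2) - (cmod a)\<^sup>2" for M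
  proof -
    have nm: "cmod (e M x) = 1" for x by (simp add: e_def)
    have "(cmod (S (Suc M) x))\<^sup>2
       = (cmod (S M x))\<^sup>2 - 2 * Re (cnj a * (S M x * cnj (e M x))) + (cmod a)\<^sup>2" for x
    proof -
      have "S (Suc M) x = S M x - a * e M x" by (simp add: S_def)
      moreover have "(cmod (u - a * v))\<^sup>2 = (cmod u)\<^sup>2 - 2 * Re (cnj a * (u * cnj v)) + (cmod (a * v))\<^sup>2"
        for u v unfolding cmod_power2 by (simp add: power2_eq_square algebra_simps)
      ultimately show ?thesis using nm[of x] by (simp add: norm_mult)
    qed
    then have "integral {0..1} (\<lambda>x. (cmod (S (Suc M) x))\<^sup>2)
       = integral {0..1} (\<lambda>x. (cmod (S M x))\<^sup>2 - 2 * Re (cnj a * (S M x * cnj (e M x))) + (cmod a)\<^sup>2)"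
      by simp
    also have "\<dots> = integral {0..1} (\<lambda>x. (cmod (S M x))\<^sup>2 - 2 * Re (cnj a * (S M x * cnj (e M x))))
        + integral {0..1} (\<lambda>x::real. (cmod a)\<^sup>2)"
      by (rule Henstock_Kurzweil_Integration.integral_add;
          intro integrable_continuous_real continuous_intros cont_S cont_e)
    also have "integral {0..1} (\<lambda>x. (cmod (S M x))\<^sup>2 - 2 * Re (cnj a * (S M x * cnj (e M x))))
        = integral {0..1} (\<lambda>x. (cmod (S M x))\<^sup>2)
        - integral {0..1} (\<lambda>x. 2 * Re (cnj a * (S M x * cnj (e M x))))"
      by (intro Henstock_Kurzweil_Integration.integral_diff integrable_continuous_real
          continuous_intros cont_S cont_e)
    also have "integral {0..1} (\<lambda>x. 2 * Re (cnj a * (S M x * cnj (e M x))))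
        = 2 * integral {0..1} (\<lambda>x. Re (cnj a * (S M x * cnj (e M x))))"
      by (rule integral_mult_right)
    also have "integral {0..1} (\<lambda>x. Re (cnj a * (S M x * cnj (e M x))))
        = Re (integral {0..1} (\<lambda>x. cnj a * (S M x * cnj (e M x))))"
      by (intro integral_component_eq_cart[symmetric] integral_linear[unfolded o_def, OF _ bounded_linear_Re]
          integrable_continuous_real continuous_intros cont_S cont_e)
    also have "\<dots> = (cmod a)\<^sup>2"
      by (simp add: Se complex_norm_square[symmetric] mult.commute cmod_power2 power2_eq_square)
    finally show ?thesis by simp
  qed
  have "integral {0..1} (\<lambda>x. (cmod (S M x))\<^sup>2) = integral {0..1} (\<lambda>x. (cmod (h x))\<^sup>2) - M * (cmod a)\<^sup>2" for M
  proof (induction M)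
    case 0
    show ?case by (simp add: S_def)
  next
    case (Suc M)
    then show ?case by (simp add: step algebra_simps)
  qed
  moreover have "integral {0..1} (\<lambda>x. (cmod (S M x))\<^sup>2) \<ge> 0" for M
    by (intro Henstock_Kurzweil_Integration.integral_nonneg integrable_continuous_real continuous_intros cont_S) auto
  ultimately have bd: "real M * (cmod a)\<^sup>2 \<le> integral {0..1} (\<lambda>x. (cmod (h x))\<^sup>2)" for M
    by (metis diff_ge_0_iff_ge)
  show ?thesis
  proof (rule ccontr)
    assume "a \<noteq> 0"
    then obtain M where "integral {0..1} (\<lambda>x. (cmod (h x))\<^sup>2) < real M * (cmod a)\<^sup>2"
      using reals_Archimedean3[of "(cmod a)\<^sup>2"] by auto
    with bd[of M] show False by simp
  qed
qed

lemma has_vector_derivative_imp_LIM: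
  fixes f :: "real \<Rightarrow> 'a::real_normed_vector"
  assumes "(f has_vector_derivative d) (at 0)"
  shows "((\<lambda>x. (f x - f 0) /\<^sub>R x) \<longlongrightarrow> d) (at 0)"
proof -
  have "((\<lambda>x. norm (f x - f 0 - x *\<^sub>R d) / norm x) \<longlongrightarrow> 0) (at 0)"
    using assms by (simp add: has_vector_derivative_def has_derivative_iff_norm)
  moreover have "norm (f x - f 0 - x *\<^sub>R d) / norm x = norm ((f x - f 0) /\<^sub>R x - d)" if "x \<noteq> 0" for x
  proof -
    have "f x - f 0 - x *\<^sub>R d = x *\<^sub>R ((f x - f 0) /\<^sub>R x - d)"
      using that by (simp add: scaleR_diff_right)
    then show ?thesis using that by simp
  qed
  then have "eventually (\<lambda>x. norm (f x - f 0 - x *\<^sub>R d) / norm x = norm ((f x - f 0) /\<^sub>R x - d)) (at 0)"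
    by (simp add: eventually_at_filter)
  ultimately have "((\<lambda>x. norm ((f x - f 0) /\<^sub>R x - d)) \<longlongrightarrow> 0) (at 0)"
    by (rule Lim_transform_eventually)
  then show ?thesis by (subst Lim_null) (simp add: tendsto_norm_zero_iff)
qed

text \<open>Chernoff's argument: dividing \<open>D - D 0\<close> by \<open>cis (2 * pi * x) - 1\<close> turns the Fourier
  coefficients into a telescoping sequence.\<close>

lemma zero_Fourier_coeffs_imp_zero:
  fixes D D' :: "real \<Rightarrow> complex"
  assumes cont: "continuous_on UNIV D"
    and per: "\<And>x. D (x + 1) = D x"
    and diff: "(D has_vector_derivative d) (at 0)"
    and coeff: "\<And>n::int. integral {0..1} (\<lambda>x. D x * cis (- 2 * pi * n * x)) = 0"
  shows "D 0 = 0"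
proof -
  \<comment> \<open>At the integers the quotient gets its limit at \<open>0\<close>, the derivative
    \<open>d\<close> of \<open>D\<close> divided by that of the exponential; this value makes
    \<open>h\<close> continuous there.\<close>
  define h where "h = (\<lambda>x. if x \<in> \<int> then d / (2 * pi * \<i>) else (D x - D 0) / (cis (2 * pi * x) - 1))"
  have cis1: "cis (2 * pi * x) = 1 \<longleftrightarrow> x \<in> \<int>" for x
    by (auto simp: cis_conv_exp exp_eq_1 Ints_def)
  have perint: "D (of_int n) = D 0" for n
  proof (induction n rule: int_induct[of _ 0])
    case (step1 i)
    then show ?case using per[of "of_int i"] by simp
  next
    case (step2 i)
    then show ?case using per[of "of_int (i - 1)"] by simp
  qed simp
  have hmult: "h x * (cis (2 * pi * x) - 1) = D x - D 0" for x
    using cis1[of x] by (auto simp: h_def perint elim!: Ints_cases)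
  have hper: "h (x + 1) = h x" for x
  proof -
    have "x + 1 \<in> \<int> \<longleftrightarrow> x \<in> \<int>"
      by (metis Ints_1 Ints_add Ints_diff add_diff_cancel_right')
    moreover have "cis (2 * pi * (x + 1)) = cis (2 * pi * x)"
      by (simp add: ring_distribs flip: cis_mult)
    ultimately show ?thesis by (simp add: h_def per)
  qed
  have h0: "isCont h 0"
  proof -
    have lim1: "((\<lambda>x. (D x - D 0) /\<^sub>R x) \<longlongrightarrow> d) (at 0)"
      by (rule has_vector_derivative_imp_LIM[OF diff])
    have lim2: "((\<lambda>x. (cis (2 * pi * x) - 1) /\<^sub>R x) \<longlongrightarrow> 2 * pi * \<i>) (at 0)"
    proof -
      have "((\<lambda>x. cis (2 * pi * x)) has_vector_derivative 2 * pi * \<i>) (at 0)"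
        unfolding cis_conv_exp by (auto intro!: derivative_eq_intros has_vector_derivative_real_field)
      from has_vector_derivative_imp_LIM[OF this] show ?thesis by simp
    qed
    have "((\<lambda>x. ((D x - D 0) /\<^sub>R x) / ((cis (2 * pi * x) - 1) /\<^sub>R x)) \<longlongrightarrow> d / (2 * pi * \<i>)) (at 0)"
      by (intro tendsto_divide lim1 lim2) auto
    moreover have "eventually (\<lambda>x. ((D x - D 0) /\<^sub>R x) / ((cis (2 * pi * x) - 1) /\<^sub>R x) = h x) (at (0::real))"
    proof -
      have "eventually (\<lambda>x::real. x \<in> ball 0 1 - {0}) (at 0)"
        by (rule eventually_at_in_open) auto
      then show ?thesis
      proof eventually_elim
        case (elim x)
        then have "x \<notin> \<int>" by (auto elim!: Ints_cases)
        then show ?case using elim by (simp add: h_def scaleR_conv_of_real mult_divide_mult_cancel_left)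
      qed
    qed
    ultimately have "(h \<longlongrightarrow> d / (2 * pi * \<i>)) (at 0)"
      using Lim_transform_eventually by blast
    then show ?thesis by (simp add: isCont_def h_def)
  qed
  have h1: "isCont h 1"
  proof -
    have "isCont (\<lambda>x. h (x - 1)) 1"
      by (rule isCont_o2[where f = "\<lambda>x. x - 1" and g = h]) (use h0 in simp_all)
    moreover have "h (x - 1) = h x" for x using hper[of "x - 1"] by simp
    ultimately show ?thesis by simp
  qed
  have hcont: "continuous_on {0..1} h"
  proof (rule continuous_at_imp_continuous_on, rule ballI)
    fix x :: real assume x: "x \<in> {0..1}"
    show "isCont h x"
    proof (cases "x = 0 \<or> x = 1")
      case False
      with x have x': "x \<in> {0<..<1}" by auto
      have nonint: "y \<notin> \<int>" if "y \<in> {0<..<1}" for y :: real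
        using that by (auto elim!: Ints_cases)
      have "continuous_on {0<..<1} (\<lambda>x. (D x - D 0) / (cis (2 * pi * x) - 1))"
        using nonint cis1 by (intro continuous_intros continuous_on_subset[OF cont]) auto
      then have "continuous_on {0<..<1} h"
        by (rule continuous_on_eq) (use nonint in \<open>auto simp: h_def\<close>)
      then show ?thesis using x' by (simp add: continuous_on_eq_continuous_at)
    qed (use h0 h1 in auto)
  qed
  define H where "H = (\<lambda>n::int. integral {0..1} (\<lambda>x. h x * cis (- 2 * pi * n * x)))"
  have H: "H (n - 1) - H n = (if n = 0 then - D 0 else 0)" for n
  proof -
    have "H (n - 1) - H n = integral {0..1} (\<lambda>x. h x * cis (- 2 * pi * of_int (n - 1) * x)
        - h x * cis (- 2 * pi * n * x))"
      unfolding H_def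
      by (intro Henstock_Kurzweil_Integration.integral_diff[symmetric] integrable_continuous_real
          continuous_intros hcont)
    also have "\<dots> = integral {0..1} (\<lambda>x. D x * cis (- 2 * pi * n * x) - D 0 * cis (2 * pi * of_int (- n) * x))"
    proof (rule arg_cong[where f = "integral _"], rule ext)
      fix x
      define E where "E = cis (- 2 * pi * n * x)"
      have 1: "cis (- 2 * pi * of_int (n - 1) * x) = cis (2 * pi * x) * E"
        by (simp add: E_def cis_mult algebra_simps)
      have 2: "cis (2 * pi * of_int (- n) * x) = E" by (simp add: E_def)
      have "h x * (cis (2 * pi * x) * E) - h x * E = (h x * (cis (2 * pi * x) - 1)) * E"
        by (simp only: algebra_simps mult_1)
      also have "\<dots> = D x * E - D 0 * E" by (subst hmult) (simp only: left_diff_distrib)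
      finally show "h x * cis (- 2 * pi * of_int (n - 1) * x) - h x * cis (- 2 * pi * n * x)
        = D x * cis (- 2 * pi * n * x) - D 0 * cis (2 * pi * of_int (- n) * x)"
        by (simp only: 1 2 E_def[symmetric])
    qed
    also have "\<dots> = integral {0..1} (\<lambda>x. D x * cis (- 2 * pi * n * x))
        - integral {0..1} (\<lambda>x. D 0 * cis (2 * pi * of_int (- n) * x))"
      by (intro Henstock_Kurzweil_Integration.integral_diff integrable_continuous_real
          continuous_intros continuous_on_subset[OF cont]) auto
    finally show ?thesis
      unfolding coeff integral_mult_right integral_cis_int by simp
  qed
  \<comment> \<open>\<open>H\<close> can jump only between \<open>-1\<close> and \<open>0\<close>,
    and there by \<open>D 0\<close>. On either side it is constant, hence zero by the Bessel
    argument, so the jump is zero too.\<close>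
  have "H (int n) = H 0" for n
  proof (induction n)
    case (Suc n)
    then show ?case using H[of "int (Suc n)"] by simp
  qed simp
  then have "H 0 = 0"
    by (intro constant_Fourier_coeffs_zero[OF hcont, of 1]) (simp_all add: H_def)
  moreover have "H (- 1 - int n) = H (-1)" for n
  proof (induction n)
    case (Suc n)
    then show ?case using H[of "- 1 - int n"] by (simp add: algebra_simps)
  qed simp
  then have H': "H (- 1 - int n) = H (-1)" for n .
  have "H (-1) = 0"
  proof (rule constant_Fourier_coeffs_zero[of "\<lambda>x. h x * cis (2 * pi * x)" "-1"])
    show "integral {0..1} (\<lambda>x. h x * cis (2 * pi * x) * cis (- 2 * pi * (- 1 * int n) * x)) = H (-1)" for n
      unfolding H'[of n, symmetric]
      by (simp add: H_def mult.assoc cis_mult algebra_simps)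
  qed (auto intro!: continuous_intros hcont)
  with \<open>H 0 = 0\<close> show ?thesis using H[of 0] by simp
qed

section \<open>Two-sided Gaussian series as functions of the exponential variable\<close>

definition gauss_pser :: "real \<Rightarrow> complex fps" where
  "gauss_pser r = Abs_fps (\<lambda>k. of_real (r ^ (k ^ 2)))"

lemma fps_conv_radius_ge_1I:
  fixes f :: "complex fps"
  assumes "\<And>z. norm z < r \<Longrightarrow> summable (\<lambda>n. fps_nth f n * z ^ n)"
  shows "fps_conv_radius f \<ge> ereal r"
  unfolding fps_conv_radius_def
  using assms by (intro conv_radius_geI_ex') (auto)

lemma gauss_pser_summable:
  assumes "0 < r" "r < 1"
  shows "summable (\<lambda>k. norm (of_real (r ^ (k ^ 2)) * (w::complex) ^ k))"
proof -
  define R where "R = cmod w + 1"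
  obtain m where m: "r ^ m * R < 1 / 2"
  proof -
    have "(\<lambda>m. r ^ m * R) \<longlonglongrightarrow> 0 * R"
      by (rule tendsto_mult[OF LIMSEQ_realpow_zero tendsto_const]) (use assms in auto)
    then have "eventually (\<lambda>m. r ^ m * R < 1 / 2) sequentially"
      by (intro order_tendstoD) auto
    then show ?thesis using that by (auto simp: eventually_sequentially)
  qed
  show ?thesis
  proof (rule summable_comparison_test')
    show "summable (\<lambda>k. (1/2::real) ^ k)" by (simp add: summable_geometric)
    fix k assume k: "k \<ge> m"
    have "norm (of_real (r ^ (k ^ 2)) * w ^ k) = (r ^ k * cmod w) ^ k"
      using assms by (simp add: norm_mult norm_power power_mult_distrib power_mult[symmetric] power2_eq_square)
    also have "\<dots> \<le> (1 / 2) ^ k"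
    proof (rule power_mono)
      have "r ^ k * cmod w \<le> r ^ m * R"
        using assms k by (intro mult_mono power_decreasing) (auto simp: R_def)
      then show "r ^ k * cmod w \<le> 1 / 2" using m by simp
    qed (use assms in auto)
    finally show "norm (norm (of_real (r ^ (k ^ 2)) * w ^ k)) \<le> (1 / 2) ^ k" by simp
  qed
qed

lemma fps_conv_radius_gauss_pser:
  assumes "0 < r" "r < 1"
  shows "fps_conv_radius (gauss_pser r) = \<infinity>"
proof -
  have "fps_conv_radius (gauss_pser r) \<ge> ereal R" for R
    by (rule fps_conv_radius_ge_1I)
       (use gauss_pser_summable[OF assms] in \<open>auto simp: gauss_pser_def intro: summable_norm_cancel\<close>)
  then show ?thesis
    by (intro ereal_top)
qed

text \<open>The Laurent series of Jacobi's theta function, split at \<open>k = 0\<close>; this term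
  occurs in both halves, hence \<open>- 1\<close>. Written through an entire power series, it is
  differentiable in \<open>w\<close> without termwise differentiation.\<close>

definition bigauss :: "real \<Rightarrow> complex \<Rightarrow> complex" where
  "bigauss r w = eval_fps (gauss_pser r) w + eval_fps (gauss_pser r) (inverse w) - 1"

lemma has_sum_bigauss:
  assumes "0 < r" "r < 1" "w \<noteq> 0"
  shows "((\<lambda>k::int. of_real (r ^ nat (k ^ 2)) * w powi k) has_sum bigauss r w) UNIV"
proof -
  let ?f = "\<lambda>k::int. of_real (r ^ nat (k ^ 2)) * w powi k"
  have P: "((\<lambda>k. of_real (r ^ (k ^ 2)) * v ^ k) has_sum eval_fps (gauss_pser r) v) UNIV" for v :: complex
  proof (rule norm_summable_imp_has_sum[OF gauss_pser_summable])
    show "(\<lambda>k. of_real (r ^ (k ^ 2)) * v ^ k) sums eval_fps (gauss_pser r) v"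
      unfolding eval_fps_def gauss_pser_def fps_nth_Abs_fps
      by (rule summable_sums, rule summable_norm_cancel, rule gauss_pser_summable) (use assms in auto)
  qed (use assms in auto)
  have eq: "nat (int k ^ 2) = k ^ 2" for k by (simp add: nat_power_eq)
  have 1: "(?f has_sum eval_fps (gauss_pser r) w) (range int)"
  proof -
    have "(?f \<circ> int) = (\<lambda>k. of_real (r ^ (k ^ 2)) * w ^ k)" by (simp add: fun_eq_iff eq)
    then have "((?f \<circ> int) has_sum eval_fps (gauss_pser r) w) UNIV" using P[of w] by (simp only:)
    then show ?thesis by (subst has_sum_reindex) simp_all
  qed
  have "((\<lambda>k. of_real (r ^ (k ^ 2)) * inverse w ^ k) has_sum eval_fps (gauss_pser r) (inverse w) - 1) (UNIV - {0})"
    using has_sum_Diff[OF P[of "inverse w"] has_sum_finite[of "{0::nat}"]] by simp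
  moreover have "?f \<circ> (\<lambda>k. - int k) = (\<lambda>k. of_real (r ^ (k ^ 2)) * inverse w ^ k)"
    by (simp only: fun_eq_iff o_def power2_minus eq power_int_minus power_int_of_nat power_inverse simp_thms)
  ultimately have "((?f \<circ> (\<lambda>k. - int k)) has_sum eval_fps (gauss_pser r) (inverse w) - 1) (UNIV - {0})"
    by (simp only:)
  then have 2: "(?f has_sum eval_fps (gauss_pser r) (inverse w) - 1) ((\<lambda>k. - int k) ` (UNIV - {0}))"
    by (subst has_sum_reindex) (simp_all add: inj_on_def)
  have "range int \<union> (\<lambda>k. - int k) ` (UNIV - {0}) = UNIV"
  proof (intro equalityI subsetI UNIV_I)
    fix x :: int
    show "x \<in> range int \<union> (\<lambda>k. - int k) ` (UNIV - {0})"
    proof (cases "x \<ge> 0")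
      case True
      then show ?thesis by (intro UnI1 image_eqI[of _ _ "nat x"]) simp_all
    next
      case False
      then show ?thesis by (intro UnI2 image_eqI[of _ _ "nat (- x)"]) simp_all
    qed
  qed
  moreover have "range int \<inter> (\<lambda>k. - int k) ` (UNIV - {0}) = {}" by auto
  ultimately show ?thesis
    using has_sum_Un_disjoint[OF 1 2] by (simp add: bigauss_def add_diff_eq)
qed

text \<open>The shift \<open>z\<close> of the phase is kept apart from the shift \<open>x\<close> of
  the Gaussian because the two sides of Poisson summation need \<open>z = 0\<close> and
  \<open>z = x\<close> respectively.\<close>

lemma gauss_term_bigauss:
  assumes "t > 0"
  shows "of_real (exp (- pi * t * (of_int n + x)\<^sup>2)) * cis (2 * pi * (of_int n + z) * y)
    = of_real (exp (- pi * t * x\<^sup>2)) * cis (2 * pi * z * y) *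
       (of_real (exp (- pi * t) ^ nat (n ^ 2)) * (of_real (exp (- 2 * pi * t * x)) * cis (2 * pi * y)) powi n)"
proof -
  have n2: "real (nat (n\<^sup>2)) = (of_int n)\<^sup>2" by simp
  have "exp (- pi * t) ^ nat (n ^ 2) = exp (- pi * t * (of_int n)\<^sup>2)"
    by (simp add: exp_of_nat_mult[symmetric] n2 mult_ac)
  moreover have "(of_real (exp (- 2 * pi * t * x)) * cis (2 * pi * y)) powi n
     = of_real (exp (- 2 * pi * t * x * of_int n)) * cis (2 * pi * of_int n * y)"
  proof -
    have 1: "of_real (exp (- 2 * pi * t * x)) powi n = complex_of_real (exp (- 2 * pi * t * x * of_int n))"
      by (simp only: of_real_power_int[symmetric] exp_power_int mult.commute)
    have 2: "cis (2 * pi * y) powi n = cis (2 * pi * of_int n * y)"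
      by (simp only: cis_power_int mult_ac)
    show ?thesis by (simp only: power_int_mult_distrib 1 2)
  qed
  moreover have "exp (- pi * t * (of_int n + x)\<^sup>2)
    = exp (- pi * t * x\<^sup>2) * (exp (- pi * t * (of_int n)\<^sup>2) * exp (- 2 * pi * t * x * of_int n))"
    by (simp add: power2_eq_square algebra_simps flip: exp_add)
  moreover have "cis (2 * pi * (of_int n + z) * y) = cis (2 * pi * z * y) * cis (2 * pi * of_int n * y)"
    by (simp add: cis_mult algebra_simps)
  ultimately show ?thesis by simp
qed

lemma has_sum_gauss:
  assumes "t > 0"
  shows "((\<lambda>n::int. of_real (exp (- pi * t * (of_int n + x)\<^sup>2)) * cis (2 * pi * (of_int n + z) * y)) has_sum
     of_real (exp (- pi * t * x\<^sup>2)) * cis (2 * pi * z * y) *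
       bigauss (exp (- pi * t)) (of_real (exp (- 2 * pi * t * x)) * cis (2 * pi * y))) UNIV"
proof -
  have "(\<lambda>n::int. of_real (exp (- pi * t * (of_int n + x)\<^sup>2)) * cis (2 * pi * (of_int n + z) * y)) =
    (\<lambda>n. of_real (exp (- pi * t * x\<^sup>2)) * cis (2 * pi * z * y) *
       (of_real (exp (- pi * t) ^ nat (n ^ 2)) * (of_real (exp (- 2 * pi * t * x)) * cis (2 * pi * y)) powi n))"
    by (rule ext) (rule gauss_term_bigauss[OF assms])
  moreover have "((\<lambda>n. of_real (exp (- pi * t * x\<^sup>2)) * cis (2 * pi * z * y) *
       (of_real (exp (- pi * t) ^ nat (n ^ 2)) * (of_real (exp (- 2 * pi * t * x)) * cis (2 * pi * y)) powi n)) has_sum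
     of_real (exp (- pi * t * x\<^sup>2)) * cis (2 * pi * z * y) *
       bigauss (exp (- pi * t)) (of_real (exp (- 2 * pi * t * x)) * cis (2 * pi * y))) UNIV"
    by (rule has_sum_cmult_right, rule has_sum_bigauss) (use assms in auto)
  ultimately show ?thesis by (simp only:)
qed

text \<open>After scaling by \<open>c\<close> the integral is the characteristic function of the
  standard normal distribution, whose closed form is known.\<close>

lemma Gaussian_Fourier_transform:
  assumes t: "t > 0"
  shows "integrable lborel (\<lambda>u. of_real (exp (- pi * u\<^sup>2 / t)) * cis (2 * pi * u * \<xi>))"
    and "(LINT u|lborel. of_real (exp (- pi * u\<^sup>2 / t)) * cis (2 * pi * u * \<xi>))
      = of_real (sqrt t * exp (- pi * t * \<xi>\<^sup>2))"
proof -
  define c where "c = sqrt (2 * pi / t)"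
  have c: "c > 0" "c\<^sup>2 = 2 * pi / t" using t by (simp_all add: c_def)
  define f where "f = (\<lambda>v. of_real (exp (- v\<^sup>2 / 2)) * cis (2 * pi * (v / c) * \<xi>))"
  have fc: "f (0 + c * u) = of_real (exp (- pi * u\<^sup>2 / t)) * cis (2 * pi * u * \<xi>)" for u
    using c t by (simp add: f_def power_mult_distrib mult_ac)
  have eqc: "std_normal_density v *\<^sub>R iexp (2 * pi * \<xi> / c * v) = of_real (1 / sqrt (2 * pi)) * f v" for v
    by (simp add: std_normal_density_def f_def scaleR_conv_of_real cis_conv_exp mult_ac)
  have int_n: "integrable lborel (\<lambda>v. std_normal_density v *\<^sub>R iexp (2 * pi * \<xi> / c * v))"
  proof (rule Bochner_Integration.integrable_bound)
    show "integrable lborel std_normal_density" by (rule integrable_normal_density) simp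
  qed (auto simp: normal_density_nonneg)
  have "integrable lborel (\<lambda>v. of_real (sqrt (2 * pi)) * (of_real (1 / sqrt (2 * pi)) * f v))"
    using int_n unfolding eqc by (rule integrable_mult_right)
  then have int_f: "integrable lborel f" by (simp add: mult.assoc[symmetric] flip: of_real_mult)
  show "integrable lborel (\<lambda>u. of_real (exp (- pi * u\<^sup>2 / t)) * cis (2 * pi * u * \<xi>))"
    using lborel_integrable_real_affine[OF int_f, of c 0] c unfolding fc by simp
  have "(LINT v|lborel. of_real (1 / sqrt (2 * pi)) * f v) = char std_normal_distribution (2 * pi * \<xi> / c)"
    unfolding char_def eqc[symmetric]
    by (subst integral_density) (auto simp: normal_density_nonneg)
  also have "\<dots> = of_real (exp (- pi * t * \<xi>\<^sup>2))"
    using c t by (simp add: char_std_normal_distribution power_divide power_mult_distrib field_simps power2_eq_square)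
  finally have "of_real (1 / sqrt (2 * pi)) * (LINT v|lborel. f v) = complex_of_real (exp (- pi * t * \<xi>\<^sup>2))"
    by simp
  then have "(LINT v|lborel. f v) = of_real (sqrt (2 * pi) * exp (- pi * t * \<xi>\<^sup>2))"
    by (simp add: field_simps)
  moreover have "(LINT v|lborel. f v) = of_real c * (LINT u|lborel. of_real (exp (- pi * u\<^sup>2 / t)) * cis (2 * pi * u * \<xi>))"
    using lborel_integral_real_affine[of c f 0] c unfolding fc by (simp add: scaleR_conv_of_real)
  moreover have "sqrt (2 * pi) = c * sqrt t" using t by (simp add: c_def real_sqrt_divide)
  ultimately have "of_real c * (LINT u|lborel. of_real (exp (- pi * u\<^sup>2 / t)) * cis (2 * pi * u * \<xi>))
     = of_real c * complex_of_real (sqrt t * exp (- pi * t * \<xi>\<^sup>2))"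
    by (simp only: of_real_mult mult_ac)
  then show "(LINT u|lborel. of_real (exp (- pi * u\<^sup>2 / t)) * cis (2 * pi * u * \<xi>))
      = of_real (sqrt t * exp (- pi * t * \<xi>\<^sup>2))"
    using c(1) by (simp only: mult_cancel_left) simp
qed

text \<open>Dominated convergence. The windows are offset by \<open>y\<close> because they are
  unions of the unit intervals from \<open>k - y\<close> to \<open>k + 1 - y\<close> that arise from
  Fourier coefficients in Poisson summation.\<close>

lemma tendsto_integral_windows:
  fixes f :: "real \<Rightarrow> complex"
  assumes f: "integrable lborel f"
  shows "(\<lambda>M. integral {- real M - y..real M - y} f) \<longlonglongrightarrow> (LINT u|lborel. f u)"
proof -
  let ?S = "\<lambda>M::nat. {- real M - y..real M - y}"
  have si: "set_integrable lborel (?S M) f" for M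
    unfolding set_integrable_def by (rule integrable_mult_indicator[OF _ f]) auto
  have "(\<lambda>M. LINT u|lborel. indicator (?S M) u *\<^sub>R f u) \<longlonglongrightarrow> (LINT u|lborel. f u)"
  proof (rule integral_dominated_convergence[where w = "\<lambda>u. norm (f u)"])
    show "AE u in lborel. (\<lambda>M. indicator (?S M) u *\<^sub>R f u) \<longlonglongrightarrow> f u"
    proof (rule AE_I2)
      fix u
      have "eventually (\<lambda>M. u \<in> ?S M) sequentially"
        using eventually_ge_at_top[of "nat \<lceil>\<bar>u + y\<bar>\<rceil>"]
        by eventually_elim (auto simp: abs_le_iff nat_le_iff ceiling_le_iff)
      then have "eventually (\<lambda>M. indicator (?S M) u *\<^sub>R f u = f u) sequentially"
        by eventually_elim (simp add: indicator_def)
      then show "(\<lambda>M. indicator (?S M) u *\<^sub>R f u) \<longlonglongrightarrow> f u"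
        by (rule tendsto_eventually)
    qed
  qed (use f in \<open>auto simp: indicator_def\<close>)
  then show ?thesis
    using set_borel_integral_eq_integral(2)[OF si] by (simp add: set_lebesgue_integral_def)
qed

lemma has_sum_integral_interval:
  fixes f :: "'i \<Rightarrow> real \<Rightarrow> complex"
  assumes cont: "\<And>k. continuous_on {a..b} (f k)"
    and bound: "\<And>k x. x \<in> {a..b} \<Longrightarrow> norm (f k x) \<le> B k"
    and B: "B summable_on UNIV"
    and F: "\<And>x. x \<in> {a..b} \<Longrightarrow> ((\<lambda>k. f k x) has_sum F x) UNIV"
  shows "((\<lambda>k. integral {a..b} (f k)) has_sum integral {a..b} F) UNIV"
proof -
  have ul: "uniform_limit {a..b} (\<lambda>X x. \<Sum>k\<in>X. f k x) F (finite_subsets_at_top UNIV)"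
    by (rule Weierstrass_m_test_general'[where M = B]) (use bound F B in auto)
  obtain I J where I: "\<And>X. ((\<lambda>x. \<Sum>k\<in>X. f k x) has_integral I X) {a..b}"
    and J: "(F has_integral J) {a..b}" and lim: "(I \<longlongrightarrow> J) (finite_subsets_at_top UNIV)"
    by (rule uniform_limit_integral[OF ul])
       (auto intro!: continuous_on_sum cont)
  have "I X = (\<Sum>k\<in>X. integral {a..b} (f k))" if "finite X" for X
    using I[of X] that
    by (subst Henstock_Kurzweil_Integration.integral_sum[symmetric])
       (auto intro!: integrable_continuous_real cont simp: integral_unique)
  then have "eventually (\<lambda>X. I X = (\<Sum>k\<in>X. integral {a..b} (f k))) (finite_subsets_at_top UNIV)"
    by (intro eventually_finite_subsets_at_top_weakI) auto
  with lim have "((\<lambda>X. \<Sum>k\<in>X. integral {a..b} (f k)) \<longlongrightarrow> J) (finite_subsets_at_top UNIV)"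
    by (rule Lim_transform_eventually)
  with J show ?thesis by (simp add: has_sum_def integral_unique)
qed

lemma has_sum_int_imp_tendsto:
  fixes f :: "int \<Rightarrow> 'a :: {comm_monoid_add, topological_space}"
  assumes f: "(f has_sum S) UNIV"
    and F: "\<And>M::nat. finite (F M)" "\<And>M. {- int M..<int M} \<subseteq> F M"
  shows "(\<lambda>M. \<Sum>k\<in>F M. f k) \<longlonglongrightarrow> S"
proof -
  have "filterlim F (finite_subsets_at_top UNIV) sequentially"
    unfolding filterlim_finite_subsets_at_top
  proof (intro allI impI)
    fix X :: "int set" assume X: "finite X \<and> X \<subseteq> UNIV"
    define m where "m = nat (Max (insert 0 (abs ` X))) + 1"
    have "\<bar>x\<bar> < int m" if "x \<in> X" for x
    proof -
      have "\<bar>x\<bar> \<le> Max (insert 0 (abs ` X))" using X that by (intro Max_ge) auto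
      moreover have "0 \<le> Max (insert 0 (abs ` X))" using X by (intro Max_ge) auto
      ultimately show ?thesis by (simp add: m_def)
    qed
    then have sub: "X \<subseteq> {- int M..<int M}" if "M \<ge> m" for M
      using that by force
    show "\<forall>\<^sub>F M in sequentially. finite (F M) \<and> X \<subseteq> F M \<and> F M \<subseteq> UNIV"
      using eventually_ge_at_top[of m] by eventually_elim (use sub F in blast)
  qed
  then show ?thesis using f unfolding has_sum_def by (rule filterlim_compose[rotated])
qed

lemma summable_on_gauss_real:
  assumes "t > 0"
  shows "(\<lambda>n::int. exp (- pi * t * (of_int n + x)\<^sup>2)) summable_on UNIV"
proof -
  have "(\<lambda>n::int. complex_of_real (exp (- pi * t * (of_int n + x)\<^sup>2)) * cis (2 * pi * (of_int n + 0) * 0)) summable_on UNIV"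
    by (rule has_sum_imp_summable[OF has_sum_gauss[OF assms]])
  then have "(\<lambda>n::int. Re (complex_of_real (exp (- pi * t * (of_int n + x)\<^sup>2)) * cis (2 * pi * (of_int n + 0) * 0))) summable_on UNIV"
    by (rule summable_on_Re)
  then show ?thesis by simp
qed

text \<open>From \<open>(u - s)^2 \<le> 2 u^2 + 2 s^2\<close> with \<open>u = k - y + s\<close>:
  halving the decay rate gives a summable majorant uniform in \<open>s\<close>, as the M-test
  needs.\<close>

lemma gauss_bound:
  assumes t: "t > 0" and s: "s \<in> {0..1}"
  shows "exp (- pi * t * (of_int k - y + s)\<^sup>2)
     \<le> exp (pi * t) * exp (- pi * (t / 2) * (of_int k + (- y))\<^sup>2)"
proof -
  have "(of_int k - y)\<^sup>2 \<le> 2 * (of_int k - y + s)\<^sup>2 + 2 * s\<^sup>2"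
    using sum_squares_bound[of "of_int k - y + s" "- s"]
      zero_le_power2[of "of_int k - y + 2 * s"] by (simp add: power2_eq_square algebra_simps)
  moreover have "s\<^sup>2 \<le> 1" using s by (simp add: power_le_one)
  ultimately have "(of_int k - y)\<^sup>2 / 2 - (of_int k - y + s)\<^sup>2 \<le> 1" by simp
  then have "pi * t * ((of_int k - y)\<^sup>2 / 2 - (of_int k - y + s)\<^sup>2) \<le> pi * t * 1"
    using t by (intro mult_left_mono) auto
  then show ?thesis by (simp add: algebra_simps flip: exp_add)
qed

lemma bigauss_differentiable:
  assumes r: "0 < r" "r < 1" and w: "w \<noteq> 0"
  shows "bigauss r field_differentiable (at w)"
proof -
  have R: "fps_conv_radius (gauss_pser r) = \<infinity>" by (rule fps_conv_radius_gauss_pser[OF r])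
  have P: "eval_fps (gauss_pser r) field_differentiable (at v)" for v
    using has_field_derivative_eval_fps[of v "gauss_pser r" UNIV] by (auto simp: R field_differentiable_def)
  have "(eval_fps (gauss_pser r) \<circ> inverse) field_differentiable (at w)"
    by (intro field_differentiable_compose P field_differentiable_inverse field_differentiable_ident w)
  then show ?thesis unfolding bigauss_def[abs_def]
    by (intro field_differentiable_diff field_differentiable_add P field_differentiable_const) (simp add: o_def)
qed

lemma bigauss_differentiable_real:
  fixes w :: "real \<Rightarrow> complex"
  assumes r: "0 < r" "r < 1" and w: "w s \<noteq> 0" and d: "w differentiable (at s)"
  shows "(\<lambda>s. bigauss r (w s)) differentiable (at s)"
proof -
  obtain b where "(bigauss r has_field_derivative b) (at (w s))"
    using bigauss_differentiable[OF r w] by (auto simp: field_differentiable_def)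
  from field_vector_diff_chain_at[OF d[unfolded vector_derivative_works] this] show ?thesis
    by (auto simp: o_def intro: differentiableI_vector)
qed

lemma cis_differentiable: "(\<lambda>y. cis (a * y)) differentiable (at (y::real))"
proof -
  have "((\<lambda>y. cis (a * y)) has_vector_derivative \<i> * of_real a * exp (\<i> * of_real (a * y))) (at y)"
    unfolding cis_conv_exp by (auto intro!: derivative_eq_intros has_vector_derivative_real_field)
  then show ?thesis by (rule differentiableI_vector)
qed

lemma of_real_differentiable:
  assumes "(f has_real_derivative d) (at y)"
  shows "(\<lambda>y. complex_of_real (f y)) differentiable (at y)"
  using assms has_vector_derivative_of_real[of f d]
  by (auto intro: differentiableI_vector simp: has_real_derivative_iff_has_vector_derivative)

text \<open>Both sides are periodic in \<open>y\<close> with period 1 and have the same Fourier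
  coefficients. Since their difference is continuous and differentiable,
  \<open>zero_Fourier_coeffs_imp_zero\<close> makes it vanish; the substitution \<open>y - s\<close>
  moves the given point to \<open>s = 0\<close>.\<close>

theorem Poisson_Gaussian:
  assumes t: "t > 0"
  shows "(\<Sum>\<^sub>\<infinity>n::int. of_real (exp (- pi * t * (of_int n + x)\<^sup>2)) * cis (2 * pi * of_int n * y))
    = of_real (1 / sqrt t) *
      (\<Sum>\<^sub>\<infinity>k::int. of_real (exp (- pi * (of_int k - y)\<^sup>2 / t)) * cis (2 * pi * (of_int k - y) * x))"
proof -
  define L where "L = (\<lambda>y. of_real (exp (- pi * t * x\<^sup>2)) * cis (2 * pi * 0 * y) *
       bigauss (exp (- pi * t)) (of_real (exp (- 2 * pi * t * x)) * cis (2 * pi * y)))"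
  define G where "G = (\<lambda>y. of_real (exp (- pi * (1 / t) * (- y)\<^sup>2)) * cis (2 * pi * (- y) * x) *
       bigauss (exp (- pi * (1 / t))) (of_real (exp (- 2 * pi * (1 / t) * (- y))) * cis (2 * pi * x)))"
  define D where "D = (\<lambda>s. L (y - s) - of_real (1 / sqrt t) * G (y - s))"
  have hsL: "((\<lambda>n::int. of_real (exp (- pi * t * (of_int n + x)\<^sup>2)) * cis (2 * pi * of_int n * y)) has_sum L y) UNIV" for y
    using has_sum_gauss[OF t, of x 0 y] by (simp add: L_def)
  have hsG: "((\<lambda>k::int. of_real (exp (- pi * (of_int k - y)\<^sup>2 / t)) * cis (2 * pi * (of_int k - y) * x)) has_sum G y) UNIV" for y
    using has_sum_gauss[of "1 / t" "- y" "- y" x] t by (simp add: G_def)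
  have perL: "L (y + 1) = L y" for y
  proof -
    have "cis (2 * pi * (y + 1)) = cis (2 * pi * y)" by (simp add: ring_distribs flip: cis_mult)
    then show ?thesis by (simp add: L_def)
  qed
  have perG: "G (y + 1) = G y" for y
  proof -
    have "bij (\<lambda>k::int. k + 1)" by (rule bij_plus_right)
    then have "((\<lambda>k::int. of_real (exp (- pi * (of_int (k + 1) - (y + 1))\<^sup>2 / t)) * cis (2 * pi * (of_int (k + 1) - (y + 1)) * x)) has_sum G (y + 1)) UNIV"
      using hsG[of "y + 1"] by (subst (asm) has_sum_reindex_bij_betw[symmetric, where g = "\<lambda>k. k + 1" and A = UNIV]) auto
    then have "((\<lambda>k::int. of_real (exp (- pi * (of_int k - y)\<^sup>2 / t)) * cis (2 * pi * (of_int k - y) * x)) has_sum G (y + 1)) UNIV"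
      by simp
    then show ?thesis by (rule has_sum_unique) (rule hsG)
  qed
  have perD: "D (s + 1) = D s" for s
    using perL[of "y - s - 1"] perG[of "y - s - 1"] by (simp add: D_def diff_diff_eq)
  have dL: "L differentiable (at y)" for y
    unfolding L_def
    by (intro differentiable_mult differentiable_const bigauss_differentiable_real cis_differentiable)
       (use t in auto)
  have dG: "G differentiable (at y)" for y
  proof -
    have "(\<lambda>y. complex_of_real (exp (- pi * (1 / t) * (- y)\<^sup>2))) differentiable (at y)"
      by (rule of_real_differentiable) (rule derivative_eq_intros refl)+
    moreover have "(\<lambda>y. cis (2 * pi * (- y) * x)) differentiable (at y)"
      using cis_differentiable[of "- 2 * pi * x" y] by (simp add: mult_ac)
    moreover have "(\<lambda>y. complex_of_real (exp (- 2 * pi * (1 / t) * (- y)))) differentiable (at y)"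
      by (rule of_real_differentiable) (rule derivative_eq_intros refl)+
    ultimately show ?thesis
      unfolding G_def
      by (intro differentiable_mult differentiable_const bigauss_differentiable_real) (use t in auto)
  qed
  have contL: "continuous_on A (\<lambda>s. L (y - s))" and contG: "continuous_on A (\<lambda>s. G (y - s))" for A y
    using dL dG
    by (auto intro!: continuous_on_compose2[of UNIV _ A "\<lambda>s. y - s"] continuous_intros
        simp: continuous_on_eq_continuous_at differentiable_imp_continuous_within)
  have contD: "continuous_on UNIV D"
    unfolding D_def by (intro continuous_intros contL contG)
  have "D differentiable (at 0)"
    unfolding D_def
    by (intro differentiable_diff differentiable_mult differentiable_const
        differentiable_compose[where f = L and g = "\<lambda>s. y - s"]
        differentiable_compose[where f = G and g = "\<lambda>s. y - s"] dL dG differentiable_ident)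
  then obtain d where d: "(D has_vector_derivative d) (at 0)"
    unfolding vector_derivative_works by blast
  have coeff: "integral {0..1} (\<lambda>s. D s * cis (- 2 * pi * m * s)) = 0" for m :: int
  proof -
    define C where "C = of_real (exp (- pi * t * (x - of_int m)\<^sup>2)) * cis (- 2 * pi * of_int m * y)"
    have L: "integral {0..1} (\<lambda>s. L (y - s) * cis (- 2 * pi * m * s)) = C"
    proof -
      let ?f = "\<lambda>(n::int) s. of_real (exp (- pi * t * (of_int n + x)\<^sup>2)) * cis (2 * pi * of_int n * (y - s)) * cis (- 2 * pi * m * s)"
      have "((\<lambda>n. integral {0..1} (?f n)) has_sum integral {0..1} (\<lambda>s. L (y - s) * cis (- 2 * pi * m * s))) UNIV"
        by (rule has_sum_integral_interval[OF _ _ summable_on_gauss_real[OF t, of x]];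
            (intro continuous_intros has_sum_cmult_left hsL)?) (simp add: norm_mult)
      moreover have "integral {0..1} (?f n) = (if n = - m then C else 0)" for n
      proof -
        have "?f n s = of_real (exp (- pi * t * (of_int n + x)\<^sup>2)) * cis (2 * pi * of_int n * y)
            * cis (2 * pi * of_int (- n - m) * s)" for s
          by (simp add: mult.assoc cis_mult) (simp add: algebra_simps)
        then have "integral {0..1} (?f n) = of_real (exp (- pi * t * (of_int n + x)\<^sup>2)) * cis (2 * pi * of_int n * y)
            * (if - n - m = 0 then 1 else 0)"
          by (simp only: integral_mult_right integral_cis_int)
        moreover have "- n - m = 0 \<longleftrightarrow> n = - m" by auto
        ultimately show ?thesis by (auto simp: C_def)
      qed
      ultimately have "((\<lambda>n. if n = - m then C else 0) has_sum integral {0..1} (\<lambda>s. L (y - s) * cis (- 2 * pi * m * s))) UNIV"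
        by (simp only:)
      moreover have "((\<lambda>n. if n = - m then C else 0) has_sum C) UNIV"
        by (rule has_sum_finite_neutralI[where B = "{- m}"]) auto
      ultimately show ?thesis by (rule has_sum_unique)
    qed
    have G: "integral {0..1} (\<lambda>s. G (y - s) * cis (- 2 * pi * m * s)) = of_real (sqrt t) * C"
    proof -
      \<comment> \<open>Summation over \<open>k\<close> glues unit intervals to the whole line, so
        the coefficient becomes one integral of \<open>\<psi>\<close>, the Gaussian Fourier
        transform at \<open>x - m\<close>. The phases agree on all intervals because
        \<open>k m\<close> is an integer.\<close>
      define \<psi> where "\<psi> = (\<lambda>u. of_real (exp (- pi * u\<^sup>2 / t)) * cis (2 * pi * u * (x - of_int m)))"
      have cont: "continuous_on A \<psi>" for A unfolding \<psi>_def using t by (intro continuous_intros) auto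
      let ?f = "\<lambda>(k::int) s. of_real (exp (- pi * (of_int k - (y - s))\<^sup>2 / t)) * cis (2 * pi * (of_int k - (y - s)) * x) * cis (- 2 * pi * m * s)"
      have "((\<lambda>n. integral {0..1} (?f n)) has_sum integral {0..1} (\<lambda>s. G (y - s) * cis (- 2 * pi * m * s))) UNIV"
      proof (rule has_sum_integral_interval)
        show "norm (?f k s) \<le> exp (pi * (1 / t)) * exp (- pi * (1 / t / 2) * (of_int k + (- y))\<^sup>2)"
          if "s \<in> {0..1}" for k s
          using gauss_bound[of "1 / t" s k y] that t by (simp add: norm_mult algebra_simps)
        show "(\<lambda>k::int. exp (pi * (1 / t)) * exp (- pi * (1 / t / 2) * (of_int k + (- y))\<^sup>2)) summable_on UNIV"
          by (intro summable_on_cmult_right summable_on_gauss_real) (use t in auto)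
        show "((\<lambda>k. ?f k s) has_sum G (y - s) * cis (- 2 * pi * m * s)) UNIV" for s
          by (intro has_sum_cmult_left hsG)
        show "continuous_on {0..1} (?f k)" for k
          by (intro continuous_intros) (use t in auto)
      qed
      moreover have "integral {0..1} (?f k) = cis (- 2 * pi * of_int m * y) * integral {of_int k - y..of_int (k + 1) - y} \<psi>" for k
      proof -
        have "?f k = (\<lambda>s. cis (- 2 * pi * of_int m * y) * (\<psi> \<circ> (+) (of_int k - y)) s)"
        proof
          fix s :: real
          define u where "u = of_int k - (y - s)"
          have "cis (2 * pi * u * x) * cis (- 2 * pi * m * s)
            = cis (- 2 * pi * of_int m * y) * cis (2 * pi * u * (x - of_int m)) * cis (2 * pi * of_int (k * m))"
            by (simp add: cis_mult u_def algebra_simps)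
          also have "cis (2 * pi * of_int (k * m)) = 1" by (rule cis_multiple_2pi) simp
          finally have H: "cis (2 * pi * u * x) * cis (- 2 * pi * m * s)
            = cis (- 2 * pi * of_int m * y) * cis (2 * pi * u * (x - of_int m)) * 1" .
          have "?f k s = of_real (exp (- pi * u\<^sup>2 / t)) * (cis (2 * pi * u * x) * cis (- 2 * pi * m * s))"
            by (simp only: u_def mult.assoc)
          also have "\<dots> = cis (- 2 * pi * of_int m * y) * \<psi> u"
            by (simp only: H \<psi>_def mult_1_right mult.left_commute)
          also have "u = of_int k - y + s" by (simp add: u_def)
          finally show "?f k s = cis (- 2 * pi * of_int m * y) * (\<psi> \<circ> (+) (of_int k - y)) s"
            by simp
        qed
        then show ?thesis
          by (simp only: integral_mult_right integral_shift_Icc_real) (simp add: algebra_simps)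
      qed
      ultimately have "((\<lambda>k::int. cis (- 2 * pi * of_int m * y) * integral {of_int k - y..of_int (k + 1) - y} \<psi>)
         has_sum integral {0..1} (\<lambda>s. G (y - s) * cis (- 2 * pi * m * s))) UNIV"
        by (simp only:)
      then have "(\<lambda>M. \<Sum>k\<in>{- int M..<int M}. cis (- 2 * pi * of_int m * y) * integral {of_int k - y..of_int (k + 1) - y} \<psi>)
         \<longlonglongrightarrow> integral {0..1} (\<lambda>s. G (y - s) * cis (- 2 * pi * m * s))"
        by (rule has_sum_int_imp_tendsto) auto
      moreover have "(\<Sum>k\<in>{- int M..<int M}. integral {of_int k - y..of_int (k + 1) - y} \<psi>)
          = integral {- real M - y..real M - y} \<psi>" for M
      proof (induction M)
        case (Suc M)
        have "{- int (Suc M)..<int (Suc M)} = insert (- int M - 1) (insert (int M) {- int M..<int M})"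
          by auto
        moreover have "int M \<noteq> - int M - 1" by linarith
        ultimately have "(\<Sum>k\<in>{- int (Suc M)..<int (Suc M)}. integral {of_int k - y..of_int (k + 1) - y} \<psi>)
          = integral {- real M - 1 - y..- real M - y} \<psi> + (integral {real M - y..real M + 1 - y} \<psi>
             + integral {- real M - y..real M - y} \<psi>)"
          by (simp add: Suc.IH[symmetric])
        also have "integral {real M - y..real M + 1 - y} \<psi> + integral {- real M - y..real M - y} \<psi>
            = integral {- real M - y..real M + 1 - y} \<psi>"
          by (subst add.commute, rule Henstock_Kurzweil_Integration.integral_combine)
             (auto intro: integrable_continuous_real cont)
        also have "integral {- real M - 1 - y..- real M - y} \<psi> + integral {- real M - y..real M + 1 - y} \<psi>
            = integral {- real M - 1 - y..real M + 1 - y} \<psi>"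
          by (rule Henstock_Kurzweil_Integration.integral_combine)
             (auto intro: integrable_continuous_real cont)
        also have "- real M - 1 = - real (Suc M)" by simp
        also have "real M + 1 = real (Suc M)" by simp
        finally show ?case .
      qed simp
      ultimately have "(\<lambda>M. cis (- 2 * pi * of_int m * y) * integral {- real M - y..real M - y} \<psi>)
         \<longlonglongrightarrow> integral {0..1} (\<lambda>s. G (y - s) * cis (- 2 * pi * m * s))"
        by (simp only: sum_distrib_left[symmetric])
      moreover have "(\<lambda>M. cis (- 2 * pi * of_int m * y) * integral {- real M - y..real M - y} \<psi>)
         \<longlonglongrightarrow> cis (- 2 * pi * of_int m * y) * (LINT u|lborel. \<psi> u)"
        unfolding \<psi>_def by (intro tendsto_mult tendsto_const tendsto_integral_windows Gaussian_Fourier_transform t)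
      ultimately have "integral {0..1} (\<lambda>s. G (y - s) * cis (- 2 * pi * m * s)) = cis (- 2 * pi * of_int m * y) * (LINT u|lborel. \<psi> u)"
        by (rule LIMSEQ_unique)
      then show ?thesis unfolding \<psi>_def Gaussian_Fourier_transform(2)[OF t] by (simp add: C_def)
    qed
    have "integral {0..1} (\<lambda>s. D s * cis (- 2 * pi * m * s))
       = integral {0..1} (\<lambda>s. L (y - s) * cis (- 2 * pi * m * s) - of_real (1 / sqrt t) * (G (y - s) * cis (- 2 * pi * m * s)))"
      by (simp only: D_def left_diff_distrib mult.assoc)
    also have "\<dots> = integral {0..1} (\<lambda>s. L (y - s) * cis (- 2 * pi * m * s))
       - integral {0..1} (\<lambda>s. of_real (1 / sqrt t) * (G (y - s) * cis (- 2 * pi * m * s)))"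
      by (rule Henstock_Kurzweil_Integration.integral_diff;
          intro integrable_continuous_real continuous_intros contL contG)
    also have "\<dots> = C - of_real (1 / sqrt t) * (of_real (sqrt t) * C)"
      by (simp only: L G integral_mult_right)
    also have "\<dots> = 0" using t by (simp flip: of_real_mult mult.assoc)
    finally show ?thesis .
  qed
  have "D 0 = 0"
    by (rule zero_Fourier_coeffs_imp_zero[OF contD perD d coeff])
  then have "L y = of_real (1 / sqrt t) * G y" by (simp add: D_def)
  then show ?thesis using infsumI[OF hsL[of y]] infsumI[OF hsG[of y]] by simp
qed

section \<open>Poisson summation for binary quadratic forms\<close>

lemma summable_on_product_real:
  fixes f :: "'a \<Rightarrow> real" and g :: "'b \<Rightarrow> real"
  assumes "f summable_on A" "g summable_on B" "\<And>x. x \<in> A \<Longrightarrow> f x \<ge> 0" "\<And>y. y \<in> B \<Longrightarrow> g y \<ge> 0"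
  shows "(\<lambda>(x, y). f x * g y) summable_on A \<times> B"
proof (rule summable_on_SigmaI[where g = "\<lambda>x. f x * infsum g B"])
  show "((\<lambda>y. case (x, y) of (x, y) \<Rightarrow> f x * g y) has_sum f x * infsum g B) B" for x
    using assms(2) by (auto intro!: has_sum_cmult_right)
  show "(\<lambda>x. f x * infsum g B) summable_on A"
    using assms(1) by (rule summable_on_cmult_left)
qed (use assms in auto)

lemma summable_on_dominated:
  fixes f :: "'a \<Rightarrow> complex"
  assumes "g summable_on A" "\<And>x. x \<in> A \<Longrightarrow> norm (f x) \<le> g x"
  shows "f summable_on A"
  by (rule abs_summable_summable, rule Infinite_Sum.abs_summable_on_comparison_test'[OF assms])

lemma summable_on_gauss_pair:
  assumes "t > 0" "t' > 0"
  shows "(\<lambda>(j::int, k::int). exp (- pi * t * (of_int j + x)\<^sup>2) * exp (- pi * t' * (of_int k + y)\<^sup>2)) summable_on UNIV"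
  using summable_on_product_real[OF summable_on_gauss_real[OF assms(1), of x] summable_on_gauss_real[OF assms(2), of y]]
  by simp

text \<open>One-dimensional Poisson summation twice: in \<open>j\<close> after completing the
  square, then, with the order of summation exchanged, in \<open>k\<close>. The first step leaves a
  phase linear in \<open>k\<close>, which in the second becomes a shift of \<open>n\<close> by
  \<open>m / (2 a)\<close>; the squares recombine to the dual form \<open>Q'\<close>, given by the
  inverse matrix.\<close>

lemma Poisson_binary_form:
  fixes a c N :: int
  assumes a: "a > 0" and c: "c > 0" and N: "N = 4 * a * c - 1" and s: "s > 0"
  defines "Q \<equiv> (\<lambda>x y :: real. of_int a * x\<^sup>2 + x * y + of_int c * y\<^sup>2)"
  defines "Q' \<equiv> (\<lambda>m n :: real. (of_int c * m\<^sup>2 - m * n + of_int a * n\<^sup>2) / of_int N)"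
  shows "(\<Sum>\<^sub>\<infinity>(j::int, k::int). complex_of_real (exp (- 2 * pi * s * Q (of_int j + u) (of_int k + v))))
    = of_real (1 / (s * sqrt (of_int N))) *
      (\<Sum>\<^sub>\<infinity>(m::int, n::int). of_real (exp (- 2 * pi * Q' (of_int m) (of_int n) / s)) *
         cis (2 * pi * (of_int m * u + of_int n * v)))"
proof -
  have ac: "a * c \<ge> 1" using a c by (simp add: int_one_le_iff_zero_less)
  then have N0: "N > 0" using N by linarith
  define A where "A = real_of_int a" define D where "D = real_of_int N"
  have A: "A > 0" "D > 0" "D = 4 * A * of_int c - 1"
    using a N0 by (simp_all only: A_def D_def of_int_0_less_iff) (simp add: N)
  \<comment> \<open>\<open>T\<close> is the coefficient of \<open>y^2\<close> that completing the
    square in \<open>x\<close> leaves: \<open>2 s (c - 1 / (4 a)) = s N / (2 a)\<close>.\<close>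
  define T where "T = s * D / (2 * A)"
  have T: "T > 0" using A s by (simp add: T_def)
  have Q_split: "2 * s * Q x y = 2 * s * A * (x + y / (2 * A))\<^sup>2 + T * y\<^sup>2" for x y
    using A(1) by (simp add: Q_def T_def A(3) flip: A_def) (simp add: power2_eq_square field_simps)
  have Q'_split: "2 * Q' m n / s = m\<^sup>2 / (2 * s * A) + (n - m / (2 * A))\<^sup>2 / T" for m n
  proof -
    have c': "of_int c = (D + 1) / (4 * A)" using A by (simp add: field_simps)
    show ?thesis using A(1,2) s
      by (simp add: Q'_def T_def c' flip: A_def D_def) (simp add: power2_eq_square field_simps)
  qed
  let ?F = "\<lambda>k j. complex_of_real (exp (- 2 * pi * s * Q (of_int j + u) (of_int k + v)))"
  let ?E = "\<lambda>k. complex_of_real (exp (- pi * T * (of_int k + v)\<^sup>2))"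
  let ?M = "\<lambda>m. complex_of_real (exp (- pi * (of_int m)\<^sup>2 / (2 * s * A)))"
  let ?G = "\<lambda>m n. of_real (exp (- 2 * pi * Q' (of_int m) (of_int n) / s)) *
         cis (2 * pi * (of_int m * u + of_int n * v))"
  have Qge: "Q x y \<ge> (x\<^sup>2 + y\<^sup>2) / 2" for x y
  proof -
    have "of_int a \<ge> (1::real)" "of_int c \<ge> (1::real)" using a c by linarith+
    then have "1 * x\<^sup>2 \<le> of_int a * x\<^sup>2" "1 * y\<^sup>2 \<le> of_int c * y\<^sup>2"
      by (intro mult_right_mono; simp)+
    moreover have "0 \<le> x\<^sup>2 + y\<^sup>2 + 2 * (x * y)" using sum_squares_bound[of x "- y"] by simp
    ultimately show ?thesis unfolding Q_def by simp
  qed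
  have Q'ge: "Q' x y \<ge> (x\<^sup>2 + y\<^sup>2) / (2 * D)" for x y
  proof -
    have "of_int a \<ge> (1::real)" "of_int c \<ge> (1::real)" using a c by linarith+
    then have "1 * y\<^sup>2 \<le> of_int a * y\<^sup>2" "1 * x\<^sup>2 \<le> of_int c * x\<^sup>2"
      by (intro mult_right_mono; simp)+
    moreover have "0 \<le> x\<^sup>2 + y\<^sup>2 - 2 * (x * y)" using sum_squares_bound[of x y] by simp
    ultimately have "(x\<^sup>2 + y\<^sup>2) / 2 \<le> of_int c * x\<^sup>2 - x * y + of_int a * y\<^sup>2"
      by simp
    then have "(x\<^sup>2 + y\<^sup>2) / 2 / D \<le> (of_int c * x\<^sup>2 - x * y + of_int a * y\<^sup>2) / D"
      using A by (intro divide_right_mono) auto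
    then show ?thesis by (simp add: Q'_def D_def)
  qed
  have sumF: "(\<lambda>(j, k). ?F k j) summable_on UNIV"
  proof (rule summable_on_dominated[OF summable_on_gauss_pair[OF s s, of u v]], clarify)
    fix j k :: int
    have "- 2 * pi * s * Q (of_int j + u) (of_int k + v) \<le> - 2 * pi * s * (((of_int j + u)\<^sup>2 + (of_int k + v)\<^sup>2) / 2)"
      using Qge[of "of_int j + u" "of_int k + v"] s by (intro mult_left_mono_neg) auto
    also have "- 2 * pi * s * ((X + Y) / 2) = - pi * s * X + - pi * s * Y" for X Y
      by (simp add: field_simps)
    finally show "norm (?F k j) \<le> exp (- pi * s * (of_int j + u)\<^sup>2) * exp (- pi * s * (of_int k + v)\<^sup>2)"
      by (simp only: norm_of_real abs_exp_cancel exp_add[symmetric] exp_le_cancel_iff)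
  qed
  have sumG: "(\<lambda>(m, n). ?G m n) summable_on UNIV"
  proof (rule summable_on_dominated[OF summable_on_gauss_pair[of "1 / (D * s)" "1 / (D * s)" 0 0]], use A s in simp, use A s in simp, clarify)
    fix m n :: int
    have "- 2 * pi / s * Q' (of_int m) (of_int n) \<le> - 2 * pi / s * (((of_int m)\<^sup>2 + (of_int n)\<^sup>2) / (2 * D))"
      using Q'ge[of "of_int m" "of_int n"] s by (intro mult_left_mono_neg) auto
    also have "\<dots> = - pi * (1 / (D * s)) * (of_int m + 0)\<^sup>2 + - pi * (1 / (D * s)) * (of_int n + 0)\<^sup>2"
      using s A by (simp add: field_simps)
    finally have "exp (- 2 * pi * Q' (of_int m) (of_int n) / s) \<le> exp (- pi * (1 / (D * s)) * (of_int m + 0)\<^sup>2) * exp (- pi * (1 / (D * s)) * (of_int n + 0)\<^sup>2)"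
      by (simp only: exp_add[symmetric] exp_le_cancel_iff) simp
    then show "norm (?G m n) \<le> exp (- pi * (1 / (D * s)) * (of_int m + 0)\<^sup>2) * exp (- pi * (1 / (D * s)) * (of_int n + 0)\<^sup>2)"
      by (simp add: norm_mult)
  qed
  have sumH: "(\<lambda>(k, m). ?E k * (?M m * cis (2 * pi * of_int m * (u + (of_int k + v) / (2 * A))))) summable_on UNIV \<times> UNIV"
  proof -
    have "(\<lambda>(k, m). ?E k * (?M m * cis (2 * pi * of_int m * (u + (of_int k + v) / (2 * A))))) summable_on UNIV"
      by (rule summable_on_dominated[OF summable_on_gauss_pair[OF T, of "1 / (2 * s * A)" v 0]])
         (use A s in \<open>auto simp: norm_mult\<close>)
    then show ?thesis by simp
  qed
  have inner1: "(\<Sum>\<^sub>\<infinity>j. ?F k j) = of_real (1 / sqrt (2 * s * A)) *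
      (\<Sum>\<^sub>\<infinity>m. ?E k * (?M m * cis (2 * pi * of_int m * (u + (of_int k + v) / (2 * A)))))" for k
  proof -
    define x where "x = u + (of_int k + v) / (2 * A)"
    have "?F k j = ?E k * (of_real (exp (- pi * (2 * s * A) * (of_int j + x)\<^sup>2)) * cis (2 * pi * of_int j * 0))" for j
    proof -
      have "- 2 * pi * s * Q (of_int j + u) (of_int k + v) = - pi * (2 * s * Q (of_int j + u) (of_int k + v))"
        by simp
      also have "\<dots> = - pi * T * (of_int k + v)\<^sup>2 + - pi * (2 * s * A) * (of_int j + x)\<^sup>2"
        unfolding Q_split x_def by (simp add: algebra_simps)
      finally show ?thesis by (simp only: exp_add of_real_mult) simp
    qed
    then have "(\<Sum>\<^sub>\<infinity>j. ?F k j) = ?E k * (\<Sum>\<^sub>\<infinity>j::int. of_real (exp (- pi * (2 * s * A) * (of_int j + x)\<^sup>2)) * cis (2 * pi * of_int j * 0))"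
      by (simp only: infsum_cmult_right')
    also have "\<dots> = ?E k * (of_real (1 / sqrt (2 * s * A)) * (\<Sum>\<^sub>\<infinity>m::int. ?M m * cis (2 * pi * of_int m * x)))"
      using Poisson_Gaussian[of "2 * s * A" x 0] A s by simp
    finally show ?thesis unfolding x_def[symmetric] infsum_cmult_right' by (simp only: mult_ac)
  qed
  have inner2: "(\<Sum>\<^sub>\<infinity>k. ?E k * (?M m * cis (2 * pi * of_int m * (u + (of_int k + v) / (2 * A)))))
     = of_real (1 / sqrt T) * (\<Sum>\<^sub>\<infinity>n. ?G m n)" for m
  proof -
    define y where "y = of_int m / (2 * A)"
    have "?E k * (?M m * cis (2 * pi * of_int m * (u + (of_int k + v) / (2 * A))))
       = (?M m * cis (2 * pi * (of_int m * u + y * v))) * (?E k * cis (2 * pi * of_int k * y))" for k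
    proof -
      have "cis (2 * pi * of_int m * (u + (of_int k + v) / (2 * A))) = cis (2 * pi * (of_int m * u + y * v)) * cis (2 * pi * of_int k * y)"
        using A by (simp add: cis_mult y_def field_simps)
      then show ?thesis by (simp only: mult_ac)
    qed
    then have "(\<Sum>\<^sub>\<infinity>k. ?E k * (?M m * cis (2 * pi * of_int m * (u + (of_int k + v) / (2 * A)))))
       = (?M m * cis (2 * pi * (of_int m * u + y * v))) * (\<Sum>\<^sub>\<infinity>k. ?E k * cis (2 * pi * of_int k * y))"
      by (simp only: infsum_cmult_right')
    also have "\<dots> = (?M m * cis (2 * pi * (of_int m * u + y * v))) * (of_real (1 / sqrt T) *
       (\<Sum>\<^sub>\<infinity>n::int. of_real (exp (- pi * (of_int n - y)\<^sup>2 / T)) * cis (2 * pi * (of_int n - y) * v)))"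
      by (simp only: Poisson_Gaussian[OF T])
    also have "\<dots> = of_real (1 / sqrt T) * (\<Sum>\<^sub>\<infinity>n::int. (?M m * cis (2 * pi * (of_int m * u + y * v))) *
       (of_real (exp (- pi * (of_int n - y)\<^sup>2 / T)) * cis (2 * pi * (of_int n - y) * v)))"
      unfolding infsum_cmult_right' by (rule mult.left_commute)
    also have "(\<lambda>n::int. (?M m * cis (2 * pi * (of_int m * u + y * v))) *
       (of_real (exp (- pi * (of_int n - y)\<^sup>2 / T)) * cis (2 * pi * (of_int n - y) * v))) = (\<lambda>n. ?G m n)"
    proof
      fix n :: int
      have "cis (2 * pi * (of_int m * u + y * v)) * cis (2 * pi * (of_int n - y) * v) = cis (2 * pi * (of_int m * u + of_int n * v))"
        by (simp add: cis_mult algebra_simps)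
      moreover have "- 2 * pi * Q' (of_int m) (of_int n) / s = - pi * (of_int m)\<^sup>2 / (2 * s * A) + - pi * (of_int n - y)\<^sup>2 / T"
      proof -
        have "- 2 * pi * Q' (of_int m) (of_int n) / s = - pi * (2 * Q' (of_int m) (of_int n) / s)" by simp
        then show ?thesis unfolding Q'_split y_def by (simp add: algebra_simps)
      qed
      ultimately have "?G m n = (?M m * of_real (exp (- pi * (of_int n - y)\<^sup>2 / T))) *
          (cis (2 * pi * (of_int m * u + y * v)) * cis (2 * pi * (of_int n - y) * v))"
        by (simp only: exp_add of_real_mult)
      then show "(?M m * cis (2 * pi * (of_int m * u + y * v))) *
       (of_real (exp (- pi * (of_int n - y)\<^sup>2 / T)) * cis (2 * pi * (of_int n - y) * v)) = ?G m n"
        by (simp only: mult_ac)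
    qed
    finally show ?thesis .
  qed
  have "(\<Sum>\<^sub>\<infinity>(j, k). ?F k j) = (\<Sum>\<^sub>\<infinity>j. \<Sum>\<^sub>\<infinity>k. ?F k j)"
    using infsum_Sigma_banach[of "\<lambda>(j, k). ?F k j" UNIV "\<lambda>_. UNIV"] sumF by simp
  also have "\<dots> = (\<Sum>\<^sub>\<infinity>k. \<Sum>\<^sub>\<infinity>j. ?F k j)"
    by (rule infsum_swap_banach) (use sumF in simp)
  also have "\<dots> = of_real (1 / sqrt (2 * s * A)) *
      (\<Sum>\<^sub>\<infinity>k. \<Sum>\<^sub>\<infinity>m. ?E k * (?M m * cis (2 * pi * of_int m * (u + (of_int k + v) / (2 * A)))))"
    by (simp only: inner1 infsum_cmult_right')
  also have "(\<Sum>\<^sub>\<infinity>k. \<Sum>\<^sub>\<infinity>m. ?E k * (?M m * cis (2 * pi * of_int m * (u + (of_int k + v) / (2 * A)))))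
     = (\<Sum>\<^sub>\<infinity>m. \<Sum>\<^sub>\<infinity>k. ?E k * (?M m * cis (2 * pi * of_int m * (u + (of_int k + v) / (2 * A)))))"
    by (rule infsum_swap_banach) (rule sumH)
  also have "\<dots> = of_real (1 / sqrt T) * (\<Sum>\<^sub>\<infinity>m. \<Sum>\<^sub>\<infinity>n. ?G m n)"
    by (simp only: inner2 infsum_cmult_right')
  also have "(\<Sum>\<^sub>\<infinity>m. \<Sum>\<^sub>\<infinity>n. ?G m n) = (\<Sum>\<^sub>\<infinity>(m, n). ?G m n)"
    using infsum_Sigma_banach[of "\<lambda>(m, n). ?G m n" UNIV "\<lambda>_. UNIV"] sumG by simp
  also have "of_real (1 / sqrt (2 * s * A)) * (of_real (1 / sqrt T) * (\<Sum>\<^sub>\<infinity>(m, n). ?G m n))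
     = of_real (1 / sqrt (2 * s * A) * (1 / sqrt T)) * (\<Sum>\<^sub>\<infinity>(m, n). ?G m n)"
    by simp
  also have "1 / sqrt (2 * s * A) * (1 / sqrt T) = 1 / (s * sqrt (of_int N))"
  proof -
    have "sqrt (2 * s * A) * sqrt T = sqrt (s\<^sup>2 * D)"
      unfolding real_sqrt_mult[symmetric] using A by (simp add: T_def power2_eq_square field_simps)
    also have "\<dots> = s * sqrt D" using s by (simp add: real_sqrt_mult)
    finally show ?thesis by (simp add: D_def)
  qed
  finally show ?thesis .
qed

subsection \<open>The nome\<close>

lemma norm_nome: "norm (nome \<tau>) = exp (- 2 * pi * Im \<tau>)"
  by (simp add: nome_def)

lemma nome_nonzero [simp]: "nome \<tau> \<noteq> 0"
  by (simp add: nome_def)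

lemma norm_nome_less_1: "Im \<tau> > 0 \<Longrightarrow> norm (nome \<tau>) < 1"
  by (simp add: norm_nome)

lemma nome_add: "nome (\<tau> + \<sigma>) = nome \<tau> * nome \<sigma>"
  by (simp add: nome_def ring_distribs exp_add)

lemma nome_of_int [simp]: "nome (of_int n) = 1"
proof -
  have "nome (of_int n) = exp (\<i> * (of_int n * (of_real pi * 2)))"
    by (simp add: nome_def mult_ac)
  then show ?thesis by (simp only: exp_integer_2pi[OF Ints_of_int] mult_ac) (simp add: exp_eq_1)
qed

lemma nome_of_nat [simp]: "nome (of_nat n) = 1"
  using nome_of_int[of "int n"] by simp

lemma nome_add_int [simp]: "nome (\<tau> + of_int n) = nome \<tau>"
  by (simp add: nome_add)

lemma nome_power: "nome \<tau> ^ n = nome (of_nat n * \<tau>)"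
  by (simp add: nome_def exp_of_nat_mult[symmetric] mult_ac)

lemma nome_surj:
  assumes "z \<noteq> 0" "norm z < 1"
  obtains \<tau> where "Im \<tau> > 0" "nome \<tau> = z"
proof
  let ?\<tau> = "Ln z / (2 * of_real pi * \<i>)"
  have "2 * of_real pi * \<i> * ?\<tau> = Ln z" by simp
  then show nm: "nome ?\<tau> = z" using assms(1) by (simp only: nome_def exp_Ln simp_thms)
  then have "exp (- 2 * pi * Im ?\<tau>) < 1" using assms(2) norm_nome[of ?\<tau>] by simp
  then show "Im ?\<tau> > 0" by (simp add: mult_pos_pos zero_less_mult_iff)
qed

lemma Im_minus_inverse: "Im (- 1 / \<tau>) = Im \<tau> / (norm \<tau>)\<^sup>2"
  by (simp add: Im_divide cmod_power2)

lemma Im_minus_inverse_pos: "Im \<tau> > 0 \<Longrightarrow> Im (- 1 / \<tau>) > 0"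
  unfolding Im_minus_inverse by (auto intro!: divide_pos_pos)

lemma Im_inverse_neg: "Im \<tau> > 0 \<Longrightarrow> Im (1 / \<tau>) < 0"
  using Im_minus_inverse_pos[of \<tau>] by simp

subsection \<open>Power series on the unit disc\<close>

definition disc_fps :: "complex fps \<Rightarrow> bool" where
  "disc_fps a \<longleftrightarrow> fps_conv_radius a \<ge> 1"

abbreviation evq :: "complex fps \<Rightarrow> complex \<Rightarrow> complex" where
  "evq a \<tau> \<equiv> eval_fps a (nome \<tau>)"

lemma disc_fpsD: "disc_fps a \<Longrightarrow> norm z < 1 \<Longrightarrow> ereal (norm z) < fps_conv_radius a"
  unfolding disc_fps_def by (metis ereal_less(3) less_le_trans)

lemma disc_fpsI:
  assumes "\<And>z. norm z < 1 \<Longrightarrow> summable (\<lambda>n. fps_nth a n * z ^ n)"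
  shows "disc_fps a"
  using fps_conv_radius_ge_1I[of 1 a] assms by (simp add: disc_fps_def one_ereal_def)

lemma disc_fps_sums: "disc_fps a \<Longrightarrow> norm z < 1 \<Longrightarrow> (\<lambda>n. fps_nth a n * z ^ n) sums eval_fps a z"
  by (intro sums_eval_fps disc_fpsD)

lemma disc_fps_const [simp, intro]: "disc_fps (fps_const c)"
  by (simp add: disc_fps_def)

lemma disc_fps_X [simp, intro]: "disc_fps fps_X"
  by (simp add: disc_fps_def)

lemma disc_fps_mult [intro]: "disc_fps a \<Longrightarrow> disc_fps b \<Longrightarrow> disc_fps (a * b)"
  unfolding disc_fps_def using fps_conv_radius_mult[of a b] by (meson min.boundedI order_trans)

lemma disc_fps_add [intro]: "disc_fps a \<Longrightarrow> disc_fps b \<Longrightarrow> disc_fps (a + b)"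
  unfolding disc_fps_def using fps_conv_radius_add[of a b] by (meson min.boundedI order_trans)

lemma disc_fps_power [intro]: "disc_fps a \<Longrightarrow> disc_fps (a ^ n)"
  unfolding disc_fps_def using fps_conv_radius_power[of a n] by (meson order_trans)

lemma eval_disc_mult: "disc_fps a \<Longrightarrow> disc_fps b \<Longrightarrow> norm z < 1 \<Longrightarrow> eval_fps (a * b) z = eval_fps a z * eval_fps b z"
  by (intro eval_fps_mult disc_fpsD)

lemma eval_disc_add: "disc_fps a \<Longrightarrow> disc_fps b \<Longrightarrow> norm z < 1 \<Longrightarrow> eval_fps (a + b) z = eval_fps a z + eval_fps b z"
  by (intro eval_fps_add disc_fpsD)

lemma eval_disc_power: "disc_fps a \<Longrightarrow> norm z < 1 \<Longrightarrow> eval_fps (a ^ n) z = eval_fps a z ^ n"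
  by (intro eval_fps_power disc_fpsD)

lemma disc_fps_holomorphic: "disc_fps a \<Longrightarrow> eval_fps a holomorphic_on ball 0 1"
  by (intro holomorphic_on_eval_fps) (auto simp: disc_fpsD in_eball_iff)

text \<open>The nome takes every value of the unit disc except \<open>0\<close>, so the constant
  terms have to be compared by continuity.\<close>

lemma disc_fps_eqI:
  assumes a: "disc_fps a" and b: "disc_fps b"
    and eq: "\<And>\<tau>. Im \<tau> > 0 \<Longrightarrow> evq a \<tau> = evq b \<tau>"
  shows "a = b"
proof (rule eval_fps_eqD)
  show "fps_conv_radius a > 0" "fps_conv_radius b > 0"
    using disc_fpsD[OF a, of 0] disc_fpsD[OF b, of 0] by (simp_all add: zero_ereal_def)
  have "continuous_on (ball 0 1) (\<lambda>z. eval_fps a z - eval_fps b z)"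
    by (intro continuous_intros) (auto simp: disc_fpsD a b in_eball_iff)
  then have "isCont (\<lambda>z. eval_fps a z - eval_fps b z) 0"
    by (simp add: continuous_on_eq_continuous_at)
  then have lim: "((\<lambda>z. eval_fps a z - eval_fps b z) \<longlongrightarrow> eval_fps a 0 - eval_fps b 0) (at 0)"
    by (simp add: isCont_def)
  have eq': "eval_fps a z - eval_fps b z = 0" if "z \<in> ball 0 1 - {0}" for z
    using that nome_surj[of z] eq by (metis DiffD1 DiffD2 diff_self dist_0_norm mem_ball singletonI)
  have "eventually (\<lambda>z. z \<in> ball 0 1 - {0}) (at (0::complex))"
    by (rule eventually_at_in_open) auto
  then have "eventually (\<lambda>z. eval_fps a z - eval_fps b z = 0) (at 0)"
    by eventually_elim (rule eq')
  then have "((\<lambda>z. eval_fps a z - eval_fps b z) \<longlongrightarrow> 0) (at 0)"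
    by (rule tendsto_eventually)
  from LIM_unique[OF lim this] have 0: "eval_fps a 0 = eval_fps b 0" by simp
  have "eventually (\<lambda>z. z \<in> ball 0 1) (nhds (0::complex))"
    by (rule eventually_nhds_in_open) auto
  then show "eventually (\<lambda>z. eval_fps a z = eval_fps b z) (nhds 0)"
  proof eventually_elim
    case (elim z)
    then show ?case using eq'[of z] 0 by (cases "z = 0") auto
  qed
qed

subsection \<open>Generating the modular group\<close>

text \<open>Inversion and translation generate the modular group; the induction is Euclid's
  algorithm on the bottom row \<open>(c, d)\<close>. The pair \<open>(x, y)\<close> is a row vector
  on which matrices act from the right, nonzero modulo \<open>N\<close>. For \<open>N = 0\<close>
  the condition excludes only the pair of zeros, which covers level one.\<close>

lemma SL2_action:
  fixes \<Phi> :: "int \<Rightarrow> int \<Rightarrow> complex \<Rightarrow> complex" and N :: int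
  assumes S: "\<And>x y \<tau>. \<not> (N dvd x \<and> N dvd y) \<Longrightarrow> Im \<tau> > 0 \<Longrightarrow> \<Phi> x y (- 1 / \<tau>) = \<tau> ^ k * \<Phi> y (- x) \<tau>"
    and T: "\<And>x y \<tau> n. \<not> (N dvd x \<and> N dvd y) \<Longrightarrow> Im \<tau> > 0 \<Longrightarrow> \<Phi> x y (\<tau> + of_int n) = \<Phi> x (y + n * x) \<tau>"
    and det: "a * d - b * c = 1" and xy: "\<not> (N dvd x \<and> N dvd y)" and \<tau>: "Im \<tau> > 0"
  shows "\<Phi> x y ((of_int a * \<tau> + of_int b) / (of_int c * \<tau> + of_int d))
    = (of_int c * \<tau> + of_int d) ^ k * \<Phi> (x * a + y * c) (x * b + y * d) \<tau>"
proof -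
  \<comment> \<open>Inversion applied twice fixes \<open>\<tau>\<close> but negates the row; this
    compares a row with its negative.\<close>
  have neg: "\<Phi> x y \<tau> = (-1) ^ k * \<Phi> (- x) (- y) \<tau>" if xy: "\<not> (N dvd x \<and> N dvd y)" and \<tau>: "Im \<tau> > 0" for x y \<tau>
  proof -
    have "\<Phi> x y (- 1 / (- 1 / \<tau>)) = (- 1 / \<tau>) ^ k * \<Phi> y (- x) (- 1 / \<tau>)"
      using xy \<tau> by (intro S Im_minus_inverse_pos)
    also have "\<Phi> y (- x) (- 1 / \<tau>) = \<tau> ^ k * \<Phi> (- x) (- y) \<tau>"
      using xy \<tau> by (intro S) auto
    also have "(- 1 / \<tau>) ^ k * (\<tau> ^ k * \<Phi> (- x) (- y) \<tau>) = ((- 1 / \<tau>) * \<tau>) ^ k * \<Phi> (- x) (- y) \<tau>"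
      by (simp only: power_mult_distrib mult.assoc)
    also have "(- 1 / \<tau>) * \<tau> = - 1" using \<tau> by auto
    finally show ?thesis using \<tau> by auto
  qed
  show ?thesis using det xy \<tau>
  proof (induction "nat \<bar>c\<bar>" arbitrary: a b c d x y \<tau> rule: less_induct)
    case less
    show ?case
    proof (cases "c = 0")
      case True
      then have "a * d = 1" using less.prems by simp
      then consider "a = 1" "d = 1" | "a = - 1" "d = - 1" by (auto simp: zmult_eq_1_iff)
      then show ?thesis
      proof cases
        case 1
        then show ?thesis using T[of x y \<tau> b] less.prems True by (simp add: mult_ac add_ac)
      next
        case 2
        have "\<Phi> x y (\<tau> + of_int (- b)) = \<Phi> x (y - b * x) \<tau>"
          using T[of x y \<tau> "- b"] less.prems by simp
        also have "\<dots> = (-1) ^ k * \<Phi> (- x) (- (y - b * x)) \<tau>"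
        proof (rule neg)
          show "\<not> (N dvd x \<and> N dvd y - b * x)"
          proof
            assume *: "N dvd x \<and> N dvd y - b * x"
            then have "N dvd (y - b * x) + b * x" by (intro dvd_add) auto
            with * show False using less.prems(2) by simp
          qed
        qed (rule less.prems)
        finally show ?thesis using 2 True by (simp add: mult_ac)
      qed
    next
      case False
      define q r where "q = d div c" and "r = d mod c"
      have d: "d = q * c + r" by (simp add: q_def r_def)
      have r: "nat \<bar>r\<bar> < nat \<bar>c\<bar>"
        using False abs_mod_less[of c d] by (simp add: r_def)
      define u where "u = \<tau> + of_int q"
      have u: "Im u > 0" using less.prems by (simp add: u_def)
      then have u0: "u \<noteq> 0" by auto
      define w where "w = - 1 / u"
      have w: "Im w > 0" unfolding w_def by (rule Im_minus_inverse_pos[OF u])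
      \<comment> \<open>The given matrix is the one with rows \<open>(b', - a)\<close> and
        \<open>(r, - c)\<close>, times inversion, times translation by \<open>q\<close>. The lower
        left entry of the first factor is the remainder \<open>r\<close>, so the induction
        hypothesis applies to it.\<close>
      define b' where "b' = b - q * a"
      define P R where "P = x * a + y * c" and "R = x * b + y * d"
      define X Y where "X = x * b' + y * r" and "Y = x * (- a) + y * (- c)"
      have XY: "Y = - P" "X = R - q * P"
        by (simp_all add: X_def Y_def P_def R_def b'_def d algebra_simps)
      have det': "b' * (- c) - (- a) * r = 1"
        using less.prems(1) by (simp add: b'_def d algebra_simps)
      have validXY: "\<not> (N dvd X \<and> N dvd Y)"
      proof
        assume "N dvd X \<and> N dvd Y"
        moreover have "x = (b' * (- c) - (- a) * r) * x" "y = (b' * (- c) - (- a) * r) * y"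
          using det' by simp_all
        then have "x = X * (- c) - Y * r" "y = X * a + Y * b'"
          by (simp_all add: X_def Y_def algebra_simps)
        ultimately have "N dvd x \<and> N dvd y" by (metis dvd_add dvd_diff dvd_mult2)
        then show False using less.prems(2) by blast
      qed
      have nz: "of_int c * \<tau> + of_int d \<noteq> 0"
      proof
        assume "of_int c * \<tau> + of_int d = 0"
        then have "Im (of_int c * \<tau> + of_int d) = 0" by simp
        then show False using False less.prems by simp
      qed
      have ru: "of_int r + of_int c * u = of_int c * \<tau> + of_int d"
        by (simp add: u_def d algebra_simps)
      have rw: "of_int r * w + of_int (- c) = - (of_int c * \<tau> + of_int d) / u"
        unfolding ru[symmetric] using u0 by (simp add: w_def field_simps)
      have "(of_int b' * w + of_int (- a)) / (of_int r * w + of_int (- c))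
        = (of_int a * \<tau> + of_int b) / (of_int c * \<tau> + of_int d)"
      proof -
        have "of_int b' * w + of_int (- a) = - (of_int a * \<tau> + of_int b) / u"
          using u0 by (simp add: w_def b'_def field_simps) (simp add: u_def algebra_simps)
        moreover have "(- A / u) / (- B / u) = A / B" for A B using u0 by (simp add: divide_simps)
        ultimately show ?thesis unfolding rw by (simp only:)
      qed
      then have "\<Phi> x y ((of_int a * \<tau> + of_int b) / (of_int c * \<tau> + of_int d))
        = (of_int r * w + of_int (- c)) ^ k * \<Phi> X Y w"
        using less.hyps[OF r det' less.prems(2) w] by (simp only: X_def Y_def)
      also have "\<Phi> X Y w = u ^ k * \<Phi> Y (- X) u"
        unfolding w_def by (rule S[OF validXY u])
      also have "\<Phi> Y (- X) u = \<Phi> Y (- X + q * Y) \<tau>"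
        unfolding u_def by (rule T) (use validXY less.prems in auto)
      also have "\<Phi> Y (- X + q * Y) \<tau> = \<Phi> (- P) (- R) \<tau>"
        by (simp add: XY)
      also have "\<Phi> (- P) (- R) \<tau> = (-1) ^ k * \<Phi> P R \<tau>"
      proof -
        have "\<not> (N dvd - P \<and> N dvd - R)" using validXY by (auto simp: XY)
        from neg[OF this less.prems(3)] show ?thesis by simp
      qed
      also have "(of_int r * w + of_int (- c)) ^ k * (u ^ k * ((-1) ^ k * \<Phi> P R \<tau>))
         = ((of_int r * w + of_int (- c)) * u * (- 1)) ^ k * \<Phi> P R \<tau>"
        by (simp only: power_mult_distrib mult.assoc)
      also have "(of_int r * w + of_int (- c)) * u * (- 1) = of_int c * \<tau> + of_int d"
        unfolding rw using u0 by simp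
      finally show ?thesis by (simp only: P_def R_def)
    qed
  qed
qed

subsection \<open>The Legendre symbol\<close>

lemma Legendre_eqI:
  assumes "p > 2" "[Legendre a (int p) = x] (mod int p)" "x \<in> {-1, 0, 1}"
  shows "Legendre a (int p) = x"
proof -
  have "int p dvd Legendre a (int p) - x" using assms(2) by (simp add: cong_iff_dvd_diff)
  moreover have "\<bar>Legendre a (int p) - x\<bar> < int p"
    using assms(1,3) by (auto simp: Legendre_def)
  ultimately show ?thesis by (metis dvd_imp_le_int linorder_not_less diff_eq_eq add.left_neutral abs_of_nat)
qed

lemma Legendre_mult:
  assumes p: "prime p" "p > 2"
  shows "Legendre (a * b) (int p) = Legendre a (int p) * Legendre b (int p)"
proof (rule Legendre_eqI[OF p(2)])
  have "[Legendre (a * b) (int p) = a ^ ((p - 1) div 2) * b ^ ((p - 1) div 2)] (mod int p)"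
    using euler_criterion[OF p, of "a * b"] by (simp add: power_mult_distrib)
  also have "[a ^ ((p - 1) div 2) * b ^ ((p - 1) div 2) = Legendre a (int p) * Legendre b (int p)] (mod int p)"
    by (intro cong_mult cong_sym[OF euler_criterion[OF p]])
  finally show "[Legendre (a * b) (int p) = Legendre a (int p) * Legendre b (int p)] (mod int p)" .
qed (auto simp: Legendre_def)

lemma Legendre_minus_1:
  assumes p: "prime p" "p > 2"
  shows "Legendre (- 1) (int p) = (- 1) ^ ((p - 1) div 2)"
  by (rule Legendre_eqI[OF p(2) euler_criterion[OF p]]) (auto simp: uminus_power_if)

subsection \<open>Vectors of functions indexed by the cusps of level \<open>N\<close>\<close>

locale level =
  fixes N :: nat
  assumes N_prime: "prime N" and N_mod_4: "N mod 4 = 3"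
begin

definition eps :: "int \<Rightarrow> int" where "eps d = Legendre d (int N)"

lemma N_gt_2: "N > 2"
  using N_mod_4 by (cases "N \<le> 2") (auto simp: numeral_2_eq_2 le_Suc_eq)

lemma N_pos: "N > 0" using N_gt_2 by simp

lemma prime_int_N: "prime (int N)" using N_prime by simp

lemma eps_mult: "eps (a * b) = eps a * eps b"
  unfolding eps_def by (rule Legendre_mult[OF N_prime N_gt_2])

lemma eps_cong: "[a = b] (mod int N) \<Longrightarrow> eps a = eps b"
  unfolding eps_def Legendre_def QuadRes_def by (simp add: cong_def)

lemma half_N_odd: "odd ((N - 1) div 2)"
proof -
  have "N = 4 * (N div 4) + 3" using N_mod_4 by (metis mult_div_mod_eq)
  then obtain k where "N = 4 * k + 3" by blast
  then show ?thesis by simp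
qed

text \<open>As \<open>N\<close> is 3 modulo 4 the character is odd, as required in weight 1, where
  negating the row must change the sign.\<close>

lemma eps_minus_1: "eps (- 1) = - 1"
  unfolding eps_def Legendre_minus_1[OF N_prime N_gt_2] using half_N_odd by simp

lemma eps_minus: "eps (- a) = - eps a"
  using eps_mult[of "- 1" a] by (simp add: eps_minus_1)

lemma eps_eq_0_iff: "eps a = 0 \<longleftrightarrow> int N dvd a"
  by (simp add: eps_def Legendre_def cong_0_iff)

lemma eps_cases: "\<not> int N dvd a \<Longrightarrow> eps a = 1 \<or> eps a = - 1"
  by (simp add: eps_def Legendre_def cong_0_iff)

lemma eps_square: "\<not> int N dvd a \<Longrightarrow> eps a * eps a = 1"
  using eps_cases[of a] by auto

lemma coprime_N: "\<not> int N dvd a \<Longrightarrow> coprime a (int N)"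
  using prime_int_N by (metis prime_imp_coprime coprime_commute)

lemma cong_solve_N:
  assumes "\<not> int N dvd c"
  obtains e where "[c * e = d] (mod int N)"
proof -
  obtain x where "[c * x = 1] (mod int N)"
    using cong_solve_coprime_int[OF coprime_N[OF assms]] by auto
  then have "[c * x * d = 1 * d] (mod int N)" by (rule cong_mult) simp
  then show ?thesis using that[of "x * d"] by (simp add: mult.assoc)
qed

text \<open>The constant of the Fricke involution in weight 1: the theta series satisfy
  \<open>z(- 1 / \<tau>) = kappa \<tau> z(\<tau> / N)\<close>, see \<open>Theta_inversion\<close>.
  That the involution squares to the right sign is \<open>kappa_square\<close>.\<close>

definition kappa :: complex where "kappa = 1 / (\<i> * of_real (sqrt (real N)))"

lemma kappa_nonzero [simp]: "kappa \<noteq> 0"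
  using N_pos by (simp add: kappa_def)

lemma kappa_square: "kappa * kappa * of_nat N = - 1"
proof -
  have "of_real (sqrt (real N)) * of_real (sqrt (real N)) = complex_of_real (real N)"
    by (simp flip: of_real_mult)
  then show ?thesis using N_pos by (simp add: kappa_def field_simps)
qed

definition valid :: "int \<Rightarrow> int \<Rightarrow> bool" where
  "valid c d \<longleftrightarrow> \<not> (int N dvd c \<and> int N dvd d)"

text \<open>\<open>slash k a c d\<close> is what \<open>evq a\<close>, transforming with character \<open>eps\<^sup>k\<close> and Fricke factor
  \<open>kappa\<^sup>k\<close>, becomes under a matrix with bottom row \<open>(c, d)\<close>.\<close>

definition slash :: "nat \<Rightarrow> complex fps \<Rightarrow> int \<Rightarrow> int \<Rightarrow> complex \<Rightarrow> complex" where
  "slash k a c d \<tau> = (if int N dvd c then of_int (eps d) ^ k * evq a \<tau>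
     else (kappa * of_int (eps c)) ^ k * evq a ((\<tau> + of_int (SOME e. [c * e = d] (mod int N))) / of_nat N))"

lemma evq_cong_int:
  assumes "[e = e'] (mod int N)"
  shows "evq a ((\<tau> + of_int e) / of_nat N) = evq a ((\<tau> + of_int e') / of_nat N)"
proof -
  obtain m where m: "e' = e + int N * m" using assms by (auto simp: cong_iff_lin)
  have "(\<tau> + of_int e') / of_nat N = (\<tau> + of_int e) / of_nat N + of_int m"
    using N_pos by (simp add: m field_simps)
  then show ?thesis by (simp only: nome_add_int)
qed

lemma slash_inf: "int N dvd c \<Longrightarrow> slash k a c d \<tau> = of_int (eps d) ^ k * evq a \<tau>"
  by (simp add: slash_def)

text \<open>The choice inside \<open>slash\<close> is harmless: two solutions \<open>e\<close>
  differ by a multiple of \<open>N\<close>, which moves the argument by an integer.\<close>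

lemma slash_fin:
  assumes "\<not> int N dvd c" "[c * e = d] (mod int N)"
  shows "slash k a c d \<tau> = (kappa * of_int (eps c)) ^ k * evq a ((\<tau> + of_int e) / of_nat N)"
proof -
  define e' where "e' = (SOME e. [c * e = d] (mod int N))"
  have "[c * e' = d] (mod int N)" unfolding e'_def using assms(2) by (rule someI)
  then have "[c * e' = c * e] (mod int N)" using assms(2) by (meson cong_sym cong_trans)
  then have "[e' = e] (mod int N)" using coprime_N[OF assms(1)] by (simp add: cong_mult_lcancel)
  then show ?thesis using assms(1) evq_cong_int[of e' e a \<tau>] by (simp add: slash_def flip: e'_def)
qed

lemma slash_cong:
  assumes "[c = c'] (mod int N)" "[d = d'] (mod int N)"
  shows "slash k a c d \<tau> = slash k a c' d' \<tau>"
proof (cases "int N dvd c")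
  case True
  then have "int N dvd c'" using assms(1) by (simp add: cong_dvd_iff)
  with True show ?thesis using eps_cong[OF assms(2)] by (simp add: slash_inf)
next
  case False
  then have c': "\<not> int N dvd c'" using assms(1) by (simp add: cong_dvd_iff)
  obtain e where e: "[c * e = d] (mod int N)" using cong_solve_N[OF False] .
  have "[c' * e = c * e] (mod int N)" by (intro cong_mult cong_sym[OF assms(1)]) simp
  then have "[c' * e = d'] (mod int N)" using e assms(2) by (meson cong_trans)
  then show ?thesis using slash_fin[OF False e] slash_fin[OF c'] eps_cong[OF assms(1)] by simp
qed

lemma slash_T: "slash k a c d (\<tau> + of_int n) = slash k a c (d + n * c) \<tau>"
proof (cases "int N dvd c")
  case True
  then have "[d + n * c = d] (mod int N)" by (simp add: cong_iff_dvd_diff)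
  then show ?thesis using True eps_cong by (simp add: slash_inf)
next
  case False
  obtain e where e: "[c * e = d] (mod int N)" using cong_solve_N[OF False] .
  have "[c * (e + n) = d + n * c] (mod int N)"
    using cong_add[OF e cong_refl, of "c * n"] by (simp add: algebra_simps)
  then show ?thesis using slash_fin[OF False e] slash_fin[OF False, of "e + n"] by (simp add: add_ac)
qed

lemma slash_mult:
  assumes "disc_fps a" "disc_fps b" "Im \<tau> > 0"
  shows "slash (k + l) (a * b) c d \<tau> = slash k a c d \<tau> * slash l b c d \<tau>"
  using assms N_pos
  by (auto simp: slash_def eval_disc_mult norm_nome_less_1 power_add mult_ac)

lemma slash_power:
  assumes "disc_fps a" "Im \<tau> > 0"
  shows "slash (k * n) (a ^ n) c d \<tau> = slash k a c d \<tau> ^ n"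
  using assms N_pos
  by (auto simp: slash_def eval_disc_power norm_nome_less_1 power_mult power_mult_distrib)

lemma slash_add:
  assumes "disc_fps a" "disc_fps b" "Im \<tau> > 0"
  shows "slash k (a + b) c d \<tau> = slash k a c d \<tau> + slash k b c d \<tau>"
  using assms N_pos
  by (auto simp: slash_def eval_disc_add norm_nome_less_1 ring_distribs)

lemma slash_cmult:
  assumes "disc_fps a" "Im \<tau> > 0"
  shows "slash k (fps_const x * a) c d \<tau> = x * slash k a c d \<tau>"
  using assms N_pos
  by (auto simp: slash_def eval_disc_mult norm_nome_less_1 ring_distribs)

text \<open>Only inversion is demanded, because the translation law \<open>slash_T\<close> holds by
  construction. The rows \<open>(0, 1)\<close> and \<open>(1, 0)\<close> alone make the series an
  eigenfunction of the Fricke involution.\<close>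

definition modular :: "nat \<Rightarrow> complex fps \<Rightarrow> bool" where
  "modular k a \<longleftrightarrow> disc_fps a \<and>
     (\<forall>c d \<tau>. valid c d \<longrightarrow> Im \<tau> > 0 \<longrightarrow> slash k a c d (- 1 / \<tau>) = \<tau> ^ k * slash k a d (- c) \<tau>)"

lemma modular_disc: "modular k a \<Longrightarrow> disc_fps a"
  by (simp add: modular_def)

lemma modularD: "modular k a \<Longrightarrow> valid c d \<Longrightarrow> Im \<tau> > 0 \<Longrightarrow> slash k a c d (- 1 / \<tau>) = \<tau> ^ k * slash k a d (- c) \<tau>"
  by (simp add: modular_def)

lemma modularD': "modular k a \<Longrightarrow> valid c d \<Longrightarrow> Im \<tau> > 0 \<Longrightarrow> slash k a c d (- (1 / \<tau>)) = \<tau> ^ k * slash k a d (- c) \<tau>"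
  using modularD[of k a c d \<tau>] by simp

lemma modularI:
  assumes "disc_fps a" "\<And>c d \<tau>. valid c d \<Longrightarrow> Im \<tau> > 0 \<Longrightarrow> slash k a c d (- 1 / \<tau>) = \<tau> ^ k * slash k a d (- c) \<tau>"
  shows "modular k a"
  using assms by (simp add: modular_def)

lemma modular_mult: "modular k a \<Longrightarrow> modular l b \<Longrightarrow> modular (k + l) (a * b)"
  by (rule modularI)
     (auto simp: slash_mult modular_disc Im_inverse_neg modularD' power_add mult_ac)

lemma modular_power: "modular k a \<Longrightarrow> modular (k * n) (a ^ n)"
  by (rule modularI)
     (auto simp: slash_power modular_disc Im_inverse_neg modularD' power_mult power_mult_distrib)

lemma modular_add: "modular k a \<Longrightarrow> modular k b \<Longrightarrow> modular k (a + b)"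
  by (rule modularI) (auto simp: slash_add modular_disc Im_inverse_neg modularD' ring_distribs)

lemma modular_cmult: "modular k a \<Longrightarrow> modular k (fps_const x * a)"
  by (rule modularI) (auto simp: slash_cmult modular_disc Im_inverse_neg modularD')

lemma modular_uminus: "modular k a \<Longrightarrow> modular k (- a)"
  using modular_cmult[of k a "- 1"] by (simp flip: fps_const_neg)

lemma modular_diff: "modular k a \<Longrightarrow> modular k b \<Longrightarrow> modular k (a - b)"
  using modular_add[OF _ modular_uminus] by (simp only: diff_conv_add_uminus)

lemma modular_0: "modular k 0"
  by (rule modularI) (auto simp: disc_fps_def slash_def)

lemma modular_sum: "(\<And>i. i \<in> A \<Longrightarrow> modular k (f i)) \<Longrightarrow> modular k (\<Sum>i\<in>A. f i)"
  by (induction A rule: infinite_finite_induct) (auto intro: modular_0 modular_add)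

lemma modular_SL2:
  assumes "modular k f" "a * d - b * c = 1" "valid x y" "Im \<tau> > 0"
  shows "slash k f x y ((of_int a * \<tau> + of_int b) / (of_int c * \<tau> + of_int d))
    = (of_int c * \<tau> + of_int d) ^ k * slash k f (x * a + y * c) (x * b + y * d) \<tau>"
proof (rule SL2_action[where N = "int N"])
  show "slash k f x y (- 1 / \<tau>) = \<tau> ^ k * slash k f y (- x) \<tau>"
    if "\<not> (int N dvd x \<and> int N dvd y)" "Im \<tau> > 0" for x y \<tau>
    using that by (intro modularD[OF assms(1)]) (simp_all add: valid_def)
qed (use assms in \<open>simp_all add: slash_T valid_def\<close>)

text \<open>Any point of the upper half plane moves into \<open>Im \<tau> \<ge> 1 / 2\<close> by integer translations and
  inversions that at least double the imaginary part, so the sup of an invariant vector is attained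
  inside the unit disc.\<close>

lemma invariant_imp_const:
  assumes g: "disc_fps g"
    and inv: "\<And>c d \<tau>. valid c d \<Longrightarrow> Im \<tau> > 0 \<Longrightarrow> norm (slash 0 g c d (- 1 / \<tau>)) = norm (slash 0 g d (- c) \<tau>)"
  shows "g = fps_const (fps_nth g 0)"
proof -
  \<comment> \<open>For \<open>Im \<tau> \<ge> 1 / 2\<close> the largest nomes in a vector are those
    of the arguments divided by \<open>N\<close>; they are bounded by this \<open>r\<close>.\<close>
  define r where "r = exp (- pi / real N)"
  have r: "0 < r" "r < 1" using N_pos by (simp_all add: r_def)
  have hol: "eval_fps g holomorphic_on ball 0 1" by (rule disc_fps_holomorphic[OF g])
  have sub: "cball 0 r \<subseteq> ball (0::complex) 1" using r by auto
  have "continuous_on (cball 0 r) (\<lambda>z. norm (eval_fps g z))"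
    using holomorphic_on_imp_continuous_on[OF hol] sub
    by (intro continuous_on_norm) (rule continuous_on_subset)
  from continuous_attains_sup[OF compact_cball _ this] r
  have "\<exists>z0\<in>cball 0 r. \<forall>z\<in>cball 0 r. norm (eval_fps g z) \<le> norm (eval_fps g z0)" by simp
  then obtain z0 where z0: "z0 \<in> cball 0 r" and max0: "\<And>z. z \<in> cball 0 r \<Longrightarrow> norm (eval_fps g z) \<le> norm (eval_fps g z0)"
    by blast
  define M where "M = norm (eval_fps g z0)"
  have base: "norm (slash 0 g c d \<tau>) \<le> M" if "Im \<tau> \<ge> 1 / 2" for c d \<tau>
  proof -
    have "norm (nome \<tau>) \<le> r"
    proof -
      have "pi / real N \<le> pi" using N_pos by (simp add: field_simps)
      also have "pi \<le> 2 * pi * Im \<tau>" using mult_left_mono[of 1 "2 * Im \<tau>" pi] that by simp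
      finally show ?thesis by (simp add: norm_nome r_def)
    qed
    moreover have "norm (nome ((\<tau> + of_int e) / of_nat N)) \<le> r" for e
    proof -
      have "Im ((\<tau> + of_int e) / of_nat N) = Im \<tau> / real N" by simp
      moreover have "pi / real N \<le> 2 * pi * Im \<tau> / real N"
        using mult_left_mono[of 1 "2 * Im \<tau>" pi] that by (intro divide_right_mono) auto
      ultimately show ?thesis by (simp add: norm_nome r_def)
    qed
    ultimately show ?thesis using max0 by (simp add: slash_def M_def)
  qed
  have bound: "norm (slash 0 g c d \<tau>) \<le> M" if "valid c d" "Im \<tau> > 0" "Im \<tau> * 2 ^ n \<ge> 1 / 2" for n c d \<tau>
    using that
  proof (induction n arbitrary: c d \<tau>)
    case 0
    then show ?case by (intro base) simp
  next
    case (Suc n)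
    show ?case
    proof (cases "Im \<tau> \<ge> 1 / 2")
      case False
      define m where "m = round (Re \<tau>)"
      define \<sigma> where "\<sigma> = \<tau> - of_int m"
      define w where "w = - 1 / \<sigma>"
      have \<sigma>: "Im \<sigma> = Im \<tau>" "\<bar>Re \<sigma>\<bar> \<le> 1 / 2"
        using of_int_round_abs_le[of "Re \<tau>"] by (simp_all add: \<sigma>_def m_def abs_minus_commute)
      have w: "Im w > 0" unfolding w_def using \<sigma> Suc.prems by (intro Im_minus_inverse_pos) simp
      have \<sigma>w: "\<sigma> = - 1 / w" using \<sigma> Suc.prems by (auto simp: w_def)
      have "(Re \<sigma>)\<^sup>2 \<le> (1 / 2)\<^sup>2" "(Im \<sigma>)\<^sup>2 \<le> (1 / 2)\<^sup>2"
        using \<sigma> False Suc.prems by (auto simp: abs_le_square_iff[symmetric])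
      then have "(norm \<sigma>)\<^sup>2 \<le> 1 / 2" unfolding cmod_power2 by (simp add: power2_eq_square)
      moreover have "(norm \<sigma>)\<^sup>2 > 0" using \<sigma> Suc.prems by auto
      ultimately have "Im \<sigma> * 2 \<le> Im w"
        using \<sigma> Suc.prems unfolding w_def Im_minus_inverse by (simp add: field_simps mult_left_le)
      then have "Im \<sigma> * 2 * 2 ^ n \<le> Im w * 2 ^ n" by (rule mult_right_mono) simp
      moreover have "1 / 2 \<le> Im \<sigma> * 2 * 2 ^ n" using Suc.prems \<sigma> by (simp add: mult_ac)
      ultimately have w': "1 / 2 \<le> Im w * 2 ^ n" by (rule order_trans[rotated])
      have v: "valid c (d + m * c)" "valid (d + m * c) (- c)"
        using Suc.prems(1) by (auto simp: valid_def dvd_add_left_iff)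
      have "slash 0 g c d \<tau> = slash 0 g c (d + m * c) (- 1 / w)"
        using slash_T[of 0 g c d \<sigma> m] unfolding \<sigma>w[symmetric] by (simp add: \<sigma>_def)
      then have "norm (slash 0 g c d \<tau>) = norm (slash 0 g (d + m * c) (- c) w)"
        using inv[OF v(1) w] by simp
      also have "\<dots> \<le> M" by (rule Suc.IH[OF v(2) w w'])
      finally show ?thesis .
    qed (rule base)
  qed
  have le: "norm (eval_fps g z) \<le> norm (eval_fps g z0)" if z1: "z \<in> ball 0 1" for z
  proof (cases "z = 0")
    case True
    then show ?thesis using max0 r by simp
  next
    case False
    then obtain \<tau> where \<tau>: "Im \<tau> > 0" "nome \<tau> = z" using nome_surj[of z] z1 by auto
    obtain n where "1 / 2 / Im \<tau> < 2 ^ n" using real_arch_pow[of 2 "1 / 2 / Im \<tau>"] by auto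
    then have "Im \<tau> * 2 ^ n \<ge> 1 / 2" using \<tau>(1) by (simp add: field_simps)
    moreover have "valid 0 1" using N_gt_2 by (simp add: valid_def)
    ultimately show ?thesis using bound[of 0 1 \<tau> n] \<tau> by (simp add: slash_inf M_def)
  qed
  have "eval_fps g constant_on ball 0 1"
    by (rule maximum_modulus_principle[OF hol open_ball connected_ball open_ball order_refl])
       (use z0 sub le in auto)
  then obtain C where C: "\<And>z. z \<in> ball 0 1 \<Longrightarrow> eval_fps g z = C" by (auto simp: constant_on_def)
  have "g = fps_const C"
    by (rule disc_fps_eqI[OF g disc_fps_const]) (simp add: C norm_nome_less_1)
  then show ?thesis by simp
qed

end

subsection \<open>Hecke operators\<close>

text \<open>The second term lacks the character value \<open>eps p ^ k\<close>, which is \<open>1\<close> whenever the operator is used.\<close>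

definition hecke :: "nat \<Rightarrow> nat \<Rightarrow> 'a::comm_ring_1 fps \<Rightarrow> 'a fps" where
  "hecke p k a = Abs_fps (\<lambda>n. fps_nth a (p * n) +
     (if p dvd n then of_nat p ^ (k - 1) * fps_nth a (n div p) else 0))"

lemma sum_roots_of_unity:
  assumes p: "prime p" and u: "coprime u p"
  shows "(\<Sum>i<p. nome (of_nat (u * i * n) / of_nat p)) = (if p dvd n then of_nat p else 0)"
proof -
  define w where "w = nome (of_nat (u * n) / of_nat p)"
  have p0: "p > 0" using p by (simp add: prime_gt_0_nat)
  have wi: "nome (of_nat (u * i * n) / of_nat p) = w ^ i" for i
    by (simp add: w_def nome_power mult_ac)
  have wp: "w ^ p = 1"
  proof -
    have "w ^ p = nome (of_nat (u * n))" using p0 by (simp add: w_def nome_power del: nome_of_nat of_nat_mult)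
    then show ?thesis by (simp only: nome_of_nat)
  qed
  show ?thesis
  proof (cases "p dvd n")
    case True
    then obtain m where "n = p * m" by blast
    then have "w = nome (of_nat (u * m))" using p0 by (simp add: w_def field_simps)
    then have "w = 1" by (simp only: nome_of_nat)
    then show ?thesis unfolding wi using True by simp
  next
    case False
    have "w \<noteq> 1"
    proof
      assume "w = 1"
      then obtain m :: int where "2 * pi * (real (u * n) / real p) = real_of_int (2 * m) * pi"
        by (auto simp: w_def nome_def exp_eq_1)
      then have "(2 * pi) * (real (u * n) / real p) = (2 * pi) * real_of_int m" by (simp only: of_int_mult of_int_numeral mult_ac)
      moreover have "X = Y" if "(2 * pi) * X = (2 * pi) * Y" for X Y :: real using that by simp
      ultimately have "real (u * n) / real p = real_of_int m" by blast
      then have "real (u * n) = real_of_int m * real p" using p0 by (simp add: field_simps)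
      then have "int (u * n) = m * int p" by (metis of_int_eq_iff of_int_mult of_int_of_nat_eq)
      then have "int p dvd int (u * n)" by simp
      then have "p dvd u * n" by (simp only: int_dvd_int_iff)
      then have "p dvd n" using u by (simp add: coprime_dvd_mult_right_iff coprime_commute)
      with False show False by simp
    qed
    then show ?thesis unfolding wi using False wp by (simp add: geometric_sum)
  qed
qed

lemma hecke_parts:
  assumes p: "prime p" and a: "disc_fps a" and z: "norm z < 1"
  shows "(\<lambda>n. (if p dvd n then fps_nth a (n div p) else 0) * z ^ n) sums eval_fps a (z ^ p)"
proof -
  have p0: "p > 0" using p by (simp add: prime_gt_0_nat)
  have sm: "strict_mono (\<lambda>n. p * n)" using p0 by (simp add: strict_mono_def)
  have zp: "norm (z ^ p) < 1" using z p0 by (simp add: norm_power power_Suc_less_one power_less_one_iff)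
  have "(\<lambda>n. (if p dvd p * n then fps_nth a (p * n div p) else 0) * z ^ (p * n)) sums eval_fps a (z ^ p)"
    using disc_fps_sums[OF a zp] p0 by (simp add: power_mult)
  then show ?thesis
    by (rule iffD1[OF sums_mono_reindex[OF sm, of "\<lambda>n. (if p dvd n then fps_nth a (n div p) else 0) * z ^ n"], rotated])
       (auto simp: dvd_def)
qed

text \<open>Multiplying \<open>i\<close> by a unit \<open>u\<close> only permutes the residues. With
  \<open>u = N\<close> the shifts do not disturb rows modulo \<open>N\<close>, as needed at the
  infinite cusp; at the other cusp, where the argument is already divided by \<open>N\<close>, the
  choice is \<open>u = 1\<close>.\<close>

lemma hecke_U_part:
  assumes p: "prime p" and a: "disc_fps a" and \<tau>: "Im \<tau> > 0" and u: "coprime u p"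
  shows "(\<lambda>n. fps_nth a (p * n) * nome \<tau> ^ n) sums
    (1 / of_nat p * (\<Sum>i<p. evq a ((\<tau> + of_nat (u * i)) / of_nat p)))"
proof -
  have p0: "p > 0" using p by (simp add: prime_gt_0_nat)
  have sm: "strict_mono (\<lambda>n. p * n)" using p0 by (simp add: strict_mono_def)
  define x where "x = nome (\<tau> / of_nat p)"
  have xi: "nome ((\<tau> + of_nat (u * i)) / of_nat p) ^ n = x ^ n * nome (of_nat (u * i * n) / of_nat p)" for i n
    using p0 by (simp add: x_def nome_power add_divide_distrib ring_distribs mult_ac flip: nome_add)
  have xp: "x ^ p = nome \<tau>" using p0 by (simp add: x_def nome_power)
  have "(\<lambda>n. \<Sum>i<p. fps_nth a n * nome ((\<tau> + of_nat (u * i)) / of_nat p) ^ n) sums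
      (\<Sum>i<p. evq a ((\<tau> + of_nat (u * i)) / of_nat p))"
    by (intro sums_sum disc_fps_sums a norm_nome_less_1) (use \<tau> p0 in simp)
  then have "(\<lambda>n. 1 / of_nat p * (\<Sum>i<p. fps_nth a n * nome ((\<tau> + of_nat (u * i)) / of_nat p) ^ n)) sums
      (1 / of_nat p * (\<Sum>i<p. evq a ((\<tau> + of_nat (u * i)) / of_nat p)))"
    by (rule sums_mult)
  also have "(\<lambda>n. 1 / of_nat p * (\<Sum>i<p. fps_nth a n * nome ((\<tau> + of_nat (u * i)) / of_nat p) ^ n))
     = (\<lambda>n. if p dvd n then fps_nth a n * x ^ n else 0)"
  proof
    fix n
    have "(\<Sum>i<p. fps_nth a n * nome ((\<tau> + of_nat (u * i)) / of_nat p) ^ n)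
      = fps_nth a n * x ^ n * (\<Sum>i<p. nome (of_nat (u * i * n) / of_nat p))"
      by (simp only: xi sum_distrib_left mult.assoc)
    then show "1 / of_nat p * (\<Sum>i<p. fps_nth a n * nome ((\<tau> + of_nat (u * i)) / of_nat p) ^ n)
       = (if p dvd n then fps_nth a n * x ^ n else 0)"
      using p0 by (simp only: sum_roots_of_unity[OF p u]) simp
  qed
  finally have "(\<lambda>n. if p dvd p * n then fps_nth a (p * n) * x ^ (p * n) else 0) sums
      (1 / of_nat p * (\<Sum>i<p. evq a ((\<tau> + of_nat (u * i)) / of_nat p)))"
    by (subst sums_mono_reindex[OF sm, of "\<lambda>n. if p dvd n then fps_nth a n * x ^ n else 0"]) auto
  then show ?thesis by (simp add: power_mult xp)
qed

lemma hecke_sums: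
  assumes p: "prime p" and a: "disc_fps a" and \<tau>: "Im \<tau> > 0" and u: "coprime u p"
  shows "(\<lambda>n. fps_nth (hecke p k a) n * nome \<tau> ^ n) sums
    (1 / of_nat p * (\<Sum>i<p. evq a ((\<tau> + of_nat (u * i)) / of_nat p)) + of_nat p ^ (k - 1) * evq a (of_nat p * \<tau>))"
proof -
  have "(\<lambda>n. fps_nth a (p * n) * nome \<tau> ^ n + of_nat p ^ (k - 1) * ((if p dvd n then fps_nth a (n div p) else 0) * nome \<tau> ^ n)) sums
    (1 / of_nat p * (\<Sum>i<p. evq a ((\<tau> + of_nat (u * i)) / of_nat p)) + of_nat p ^ (k - 1) * eval_fps a (nome \<tau> ^ p))"
    by (intro sums_add sums_mult hecke_U_part hecke_parts assms norm_nome_less_1)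
  moreover have "fps_nth (hecke p k a) n * nome \<tau> ^ n = fps_nth a (p * n) * nome \<tau> ^ n + of_nat p ^ (k - 1) * ((if p dvd n then fps_nth a (n div p) else 0) * nome \<tau> ^ n)" for n
    by (simp add: hecke_def ring_distribs)
  ultimately show ?thesis by (simp only: nome_power)
qed

lemma disc_hecke:
  assumes "prime p" "disc_fps a"
  shows "disc_fps (hecke p k a)"
proof (rule disc_fpsI)
  fix z :: complex assume z: "norm z < 1"
  show "summable (\<lambda>n. fps_nth (hecke p k a) n * z ^ n)"
  proof (cases "z = 0")
    case False
    then obtain \<tau> where "Im \<tau> > 0" "nome \<tau> = z" using nome_surj z by blast
    then show ?thesis using hecke_sums[OF assms, of \<tau> 1] by (auto simp: sums_iff)
  qed simp
qed

lemma evq_hecke: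
  assumes "prime p" "disc_fps a" "Im \<tau> > 0" "coprime u p"
  shows "evq (hecke p k a) \<tau> = 1 / of_nat p * (\<Sum>i<p. evq a ((\<tau> + of_nat (u * i)) / of_nat p))
     + of_nat p ^ (k - 1) * evq a (of_nat p * \<tau>)"
  using hecke_sums[OF assms, of k] disc_fps_sums[OF disc_hecke[OF assms(1,2), of k] norm_nome_less_1[OF assms(3)]]
  by (rule sums_unique2[symmetric])

section \<open>The Hecke operator on vectors indexed by the cusps\<close>

context level
begin

text \<open>The matrices of determinant \<open>p\<close> act on the row as well, so
  \<open>(p c, d)\<close> and \<open>(c, p d)\<close> appear on the right. Either row may contribute
  the factor \<open>eps p ^ k\<close>, which is assumed to be 1.\<close>

lemma slash_hecke:
  assumes p: "prime p" "p \<noteq> N" and a: "disc_fps a" and \<tau>: "Im \<tau> > 0" and ep: "eps (int p) ^ k = 1"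
  shows "slash k (hecke p k a) c d \<tau> =
    1 / of_nat p * (\<Sum>i<p. slash k a (int p * c) d ((\<tau> + of_nat (N * i)) / of_nat p))
    + of_nat p ^ (k - 1) * slash k a c (int p * d) (of_nat p * \<tau>)"
proof -
  have p0: "p > 0" using p by (simp add: prime_gt_0_nat)
  have cop: "coprime N p" using p N_prime primes_coprime by blast
  have Np: "\<not> int N dvd int p" using cop N_gt_2 by (metis coprime_absorb_left int_dvd_int_iff not_prime_unit N_prime)
  have ep': "of_int (eps (int p)) ^ k = (1::complex)" using ep by (metis of_int_1 of_int_power)
  show ?thesis
  proof (cases "int N dvd c")
    case True
    then show ?thesis
      using evq_hecke[OF p(1) a \<tau> cop, of k]
      by (simp add: slash_inf eps_mult power_mult_distrib ep' sum_distrib_left ring_distribs mult_ac)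
  next
    case False
    then have pc: "\<not> int N dvd int p * c" using Np prime_int_N by (simp add: prime_dvd_mult_iff)
    obtain e where e: "[int p * c * e = d] (mod int N)" using cong_solve_N[OF pc] .
    have e': "[c * (int p * e) = d] (mod int N)" using e by (simp add: mult_ac)
    have e'': "[c * (int p * (int p * e)) = int p * d] (mod int N)"
      using cong_mult[OF cong_refl[of "int p"] e] by (simp add: mult_ac)
    define w where "w = (\<tau> + of_int (int p * e)) / of_nat N"
    have w: "Im w > 0" using \<tau> N_pos by (simp add: w_def)
    have fac: "(kappa * of_int (eps (int p * c))) ^ k = (kappa * of_int (eps c)) ^ k"
      by (simp add: eps_mult power_mult_distrib ep')
    have 1: "((\<tau> + of_nat (N * i)) / of_nat p + of_int e) / of_nat N = (w + of_nat (1 * i)) / of_nat p" for i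
      using N_pos p0 by (simp add: w_def field_simps)
    have 2: "(of_nat p * \<tau> + of_int (int p * (int p * e))) / of_nat N = of_nat p * w"
      using N_pos by (simp add: w_def field_simps)
    have "slash k (hecke p k a) c d \<tau> = (kappa * of_int (eps c)) ^ k * evq (hecke p k a) w"
      unfolding w_def by (rule slash_fin[OF False e'])
    also have "evq (hecke p k a) w = 1 / of_nat p * (\<Sum>i<p. evq a ((w + of_nat (1 * i)) / of_nat p))
       + of_nat p ^ (k - 1) * evq a (of_nat p * w)"
      by (rule evq_hecke[OF p(1) a w]) simp
    finally show ?thesis
      unfolding slash_fin[OF pc e] slash_fin[OF False e''] fac 1 2
      by (simp add: sum_distrib_left ring_distribs mult_ac)
  qed
qed

text \<open>The matrix with rows \<open>(N i, - B)\<close> and \<open>(p, - N i')\<close> has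
  determinant 1. It takes the point with shift \<open>i'\<close> to the inverted point with shift
  \<open>i\<close>, and modulo \<open>N\<close> it takes the row \<open>(p c, d)\<close> to
  \<open>(p d, - c)\<close>.\<close>

lemma slash_hecke_S:
  assumes k: "modular k a" and v: "valid c d" and \<tau>: "Im \<tau> > 0" and p: "coprime N p" "p > 0"
    and i: "[int (N * i) * int (N * i') = - 1] (mod int p)"
  shows "slash k a (int p * c) d ((- 1 / \<tau> + of_nat (N * i)) / of_nat p)
     = \<tau> ^ k * slash k a (int p * d) (- c) ((\<tau> + of_nat (N * i')) / of_nat p)"
proof -
  obtain B where "int (N * i) * int (N * i') - (- 1) = int p * B"
    using i by (auto simp: cong_iff_dvd_diff dvd_def)
  then have B: "int (N * i) * int (N * i') + 1 = int p * B" by simp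
  define w where "w = (\<tau> + of_nat (N * i')) / of_nat p"
  have w: "Im w > 0" using \<tau> p by (simp add: w_def)
  have v': "valid (int p * c) d"
  proof -
    have "coprime (int N) (int p)" using p by simp
    then show ?thesis using v by (auto simp: valid_def coprime_dvd_mult_right_iff)
  qed
  have B': "complex_of_nat (N * i) * of_nat (N * i') + 1 = of_nat p * of_int B"
    using arg_cong[OF B, of complex_of_int] by simp
  have den: "of_int (int p) * w + of_int (- int (N * i')) = \<tau>"
    using p by (simp add: w_def)
  have num: "of_int (int (N * i)) * w + of_int (- B) = (of_nat (N * i) * \<tau> - 1) / of_nat p"
  proof -
    have "of_nat p * (of_int (int (N * i)) * w + of_int (- B)) = of_nat (N * i) * (\<tau> + of_nat (N * i')) - of_nat p * of_int B"
      using p by (simp add: w_def field_simps)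
    also have "\<dots> = of_nat (N * i) * \<tau> - 1" unfolding B'[symmetric] by (simp add: algebra_simps)
    finally show ?thesis using p by (simp add: field_simps)
  qed
  have arg: "(of_int (int (N * i)) * w + of_int (- B)) / (of_int (int p) * w + of_int (- int (N * i')))
     = (- 1 / \<tau> + of_nat (N * i)) / of_nat p"
  proof -
    have "\<tau> \<noteq> 0" "complex_of_nat p \<noteq> 0" using \<tau> p by auto
    then show ?thesis unfolding den num by (simp add: divide_simps)
  qed
  have "slash k a (int p * c) d ((- 1 / \<tau> + of_nat (N * i)) / of_nat p)
     = \<tau> ^ k * slash k a (int p * c * int (N * i) + d * int p) (int p * c * (- B) + d * (- int (N * i'))) w"
  proof -
    have "int (N * i) * (- int (N * i')) - (- B) * int p = 1" using B by (simp add: algebra_simps)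
    from modular_SL2[OF k this v' w] show ?thesis by (simp only: arg[unfolded den] den)
  qed
  also have "slash k a (int p * c * int (N * i) + d * int p) (int p * c * (- B) + d * (- int (N * i'))) w
     = slash k a (int p * d) (- c) w"
  proof (rule slash_cong)
    have "int p * c * int (N * i) + d * int p - int p * d = int N * (int p * c * int i)"
      by (simp add: algebra_simps)
    then show "[int p * c * int (N * i) + d * int p = int p * d] (mod int N)"
      by (simp only: cong_iff_dvd_diff) simp
    have "int p * c * (- B) + d * (- int (N * i')) - (- c) = - c * (int p * B - 1) - int N * (d * int i')"
      by (simp add: algebra_simps)
    also have "int p * B - 1 = int N * (int i * int (N * i'))" using B by (simp add: algebra_simps)
    finally have "int p * c * (- B) + d * (- int (N * i')) - (- c) = int N * (- c * (int i * int (N * i')) - d * int i')"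
      by (simp add: algebra_simps)
    then show "[int p * c * (- B) + d * (- int (N * i')) = - c] (mod int N)"
      by (simp only: cong_iff_dvd_diff) simp
  qed
  finally show ?thesis by (simp only: w_def)
qed

lemma negative_inverse_involution:
  assumes p: "prime p" "coprime N p"
  shows "\<exists>g. \<forall>i\<in>{1..<p}. g i \<in> {1..<p} \<and> g (g i) = i \<and> [int (N * i) * int (N * g i) = - 1] (mod int p)"
proof -
  define R where "R = (\<lambda>i j. [int (N * i) * int (N * j) = - 1] (mod int p))"
  have p0: "p > 1" using prime_gt_1_nat[OF p(1)] by simp
  have cop: "coprime i p" if "i \<in> {1..<p}" for i
    using that p by (metis atLeastLessThan_iff coprime_commute nat_dvd_not_less not_one_le_zero prime_imp_coprime zero_less_iff_neq_zero)
  have ex: "\<exists>j. j \<in> {1..<p} \<and> R i j" if i: "i \<in> {1..<p}" for i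
  proof -
    have "coprime (int (N * N * i)) (int p)" using cop[OF i] p by (simp add: coprime_mult_left_iff)
    then obtain x where x: "[int (N * N * i) * x = 1] (mod int p)"
      using cong_solve_coprime_int by blast
    define j where "j = nat ((- x) mod int p)"
    have j: "int j = (- x) mod int p" using p0 by (simp add: j_def)
    have "[int (N * i) * int (N * j) = int (N * N * i) * int j] (mod int p)" by (simp add: mult_ac)
    also have "[int (N * N * i) * int j = int (N * N * i) * (- x)] (mod int p)"
      unfolding j by (intro cong_mult cong_refl) (simp add: cong_def)
    also have "[int (N * N * i) * (- x) = - 1] (mod int p)"
      using x by (metis cong_minus_minus_iff mult_minus_right)
    finally have R: "R i j" by (simp add: R_def)
    have "j < p" using p0 unfolding j_def by (simp add: nat_less_iff)
    moreover have "j \<noteq> 0"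
    proof
      assume "j = 0"
      then have "int p dvd 1" using R by (simp add: R_def cong_iff_dvd_diff)
      then show False using p0 by simp
    qed
    ultimately have "j \<in> {1..<p}" by simp
    with R show ?thesis by blast
  qed
  define g where "g = (\<lambda>i. SOME j. j \<in> {1..<p} \<and> R i j)"
  have g: "g i \<in> {1..<p}" "R i (g i)" if "i \<in> {1..<p}" for i
    using someI_ex[OF ex[OF that]] by (simp_all add: g_def)
  have "g (g i) = i" if i: "i \<in> {1..<p}" for i
  proof -
    have "[int (N * g i) * int (N * g (g i)) = int (N * g i) * int (N * i)] (mod int p)"
      using g(2)[OF g(1)[OF i]] g(2)[OF i] unfolding R_def by (metis cong_sym cong_trans mult.commute)
    then have "[int (N * g i * N) * int (g (g i)) = int (N * g i * N) * int i] (mod int p)"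
      by (simp add: mult_ac)
    moreover have "coprime (int (N * g i * N)) (int p)" using cop[OF g(1)[OF i]] p by (simp add: coprime_mult_left_iff)
    ultimately have "[int (g (g i)) = int i] (mod int p)" by (simp only: cong_mult_lcancel)
    then have "[g (g i) = i] (mod p)" by (simp only: cong_int_iff)
    then show ?thesis using g(1)[OF g(1)[OF i]] i by (simp add: cong_def)
  qed
  with g show ?thesis unfolding R_def by blast
qed

text \<open>Inversion permutes the \<open>p + 1\<close> summands: a nonzero shift \<open>i\<close>
  goes to the \<open>i'\<close> with \<open>N i N i' = - 1\<close> modulo \<open>p\<close>, while
  the shift \<open>0\<close> is exchanged with the summand at \<open>p \<tau>\<close>. The powers of
  \<open>p\<close> from these last two match the weights \<open>1 / p\<close> and
  \<open>p ^ (k - 1)\<close>.\<close>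

lemma modular_hecke:
  assumes p: "prime p" "p \<noteq> N" and a: "modular k a" and k: "k > 0" and ep: "eps (int p) ^ k = 1"
  shows "modular k (hecke p k a)"
proof (rule modularI)
  have disc: "disc_fps a" using a by (rule modular_disc)
  show "disc_fps (hecke p k a)" by (rule disc_hecke[OF p(1) disc])
  have p0: "p > 0" using p by (simp add: prime_gt_0_nat)
  have cop: "coprime N p" using p N_prime primes_coprime by blast
  obtain g where g: "\<And>i. i \<in> {1..<p} \<Longrightarrow> g i \<in> {1..<p}" "\<And>i. i \<in> {1..<p} \<Longrightarrow> g (g i) = i"
    "\<And>i. i \<in> {1..<p} \<Longrightarrow> [int (N * i) * int (N * g i) = - 1] (mod int p)"
    using negative_inverse_involution[OF p(1) cop] by blast
  fix c d :: int and \<tau> :: complex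
  assume v: "valid c d" and \<tau>: "Im \<tau> > 0"
  have \<tau>0: "\<tau> \<noteq> 0" using \<tau> by auto
  define L where "L = (\<lambda>i. slash k a (int p * c) d ((- 1 / \<tau> + of_nat (N * i)) / of_nat p))"
  define R where "R = (\<lambda>i. slash k a (int p * d) (- c) ((\<tau> + of_nat (N * i)) / of_nat p))"
  have split: "{..<p} = insert 0 {1..<p}" using p0 by auto
  have cop': "coprime (int N) (int p)" using cop by simp
  have "(\<Sum>i\<in>{1..<p}. L i) = (\<Sum>i\<in>{1..<p}. \<tau> ^ k * R i)"
  proof (rule sum.reindex_bij_witness[of _ g g])
    show "\<tau> ^ k * R (g i) = L i" if "i \<in> {1..<p}" for i
      unfolding L_def R_def by (rule slash_hecke_S[OF a v \<tau> cop p0 g(3)[OF that], symmetric])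
  qed (use g in auto)
  then have sumLR: "(\<Sum>i<p. L i) - L 0 = \<tau> ^ k * ((\<Sum>i<p. R i) - R 0)"
    unfolding split by (simp add: sum_distrib_left)
  have L0: "L 0 = (of_nat p * \<tau>) ^ k * slash k a d (- (int p * c)) (of_nat p * \<tau>)"
  proof -
    have "L 0 = slash k a (int p * c) d (- 1 / (of_nat p * \<tau>))"
      by (simp add: L_def mult.commute)
    also have "\<dots> = (of_nat p * \<tau>) ^ k * slash k a d (- (int p * c)) (of_nat p * \<tau>)"
      using v \<tau> p0 cop' by (intro modularD[OF a]) (auto simp: valid_def coprime_dvd_mult_right_iff)
    finally show ?thesis .
  qed
  have R0: "slash k a c (int p * d) (of_nat p * (- 1 / \<tau>)) = (\<tau> / of_nat p) ^ k * R 0"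
  proof -
    have "slash k a c (int p * d) (of_nat p * (- 1 / \<tau>)) = slash k a c (int p * d) (- 1 / (\<tau> / of_nat p))"
      by simp
    also have "\<dots> = (\<tau> / of_nat p) ^ k * slash k a (int p * d) (- c) (\<tau> / of_nat p)"
      using v \<tau> p0 cop' by (intro modularD[OF a]) (auto simp: valid_def coprime_dvd_mult_right_iff)
    finally show ?thesis by (simp add: R_def)
  qed
  obtain k' where k': "k = Suc k'" using k by (cases k) auto
  have pc: "complex_of_nat p \<noteq> 0" using p0 by simp
  have "slash k (hecke p k a) c d (- 1 / \<tau>) = 1 / of_nat p * (\<Sum>i<p. L i) + of_nat p ^ (k - 1) * slash k a c (int p * d) (of_nat p * (- 1 / \<tau>))"
    unfolding L_def by (rule slash_hecke[OF p disc Im_minus_inverse_pos[OF \<tau>] ep])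
  also have "\<dots> = 1 / of_nat p * (L 0 + \<tau> ^ k * ((\<Sum>i<p. R i) - R 0)) + of_nat p ^ (k - 1) * ((\<tau> / of_nat p) ^ k * R 0)"
    unfolding sumLR[symmetric] R0 by simp
  also have "\<dots> = \<tau> ^ k * (1 / of_nat p * (\<Sum>i<p. R i) + of_nat p ^ (k - 1) * slash k a d (- (int p * c)) (of_nat p * \<tau>))"
    unfolding L0 k' using pc by (simp add: power_divide power_mult_distrib field_simps)
  also have "\<dots> = \<tau> ^ k * slash k (hecke p k a) d (- c) \<tau>"
    unfolding R_def slash_hecke[OF p disc \<tau> ep] by simp
  finally show "slash k (hecke p k a) c d (- 1 / \<tau>) = \<tau> ^ k * slash k (hecke p k a) d (- c) \<tau>" .
qed

end

subsection \<open>Series over fibres of an exponent\<close>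

definition of_int_fps :: "int fps \<Rightarrow> complex fps" where
  "of_int_fps F = Abs_fps (\<lambda>n. of_int (fps_nth F n))"

definition fibre_fps :: "('i \<Rightarrow> nat) \<Rightarrow> ('i \<Rightarrow> int) \<Rightarrow> int fps" where
  "fibre_fps e s = Abs_fps (\<lambda>n. \<Sum>i | e i = n. s i)"

lemma fibre_fps_sums:
  assumes fin: "\<And>n. finite {i. e i = n}"
    and sm: "(\<lambda>i. of_int (s i) * z ^ e i) summable_on (UNIV :: 'i set)"
  shows "(\<lambda>n. fps_nth (of_int_fps (fibre_fps e s)) n * z ^ n) sums (\<Sum>\<^sub>\<infinity>i. of_int (s i) * (z :: complex) ^ e i)"
proof -
  have bij: "bij_betw snd (SIGMA n:UNIV. {i. e i = n}) UNIV"
    by (rule bij_betwI[where g = "\<lambda>i. (e i, i)"]) auto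
  have "((\<lambda>i. of_int (s i) * z ^ e i) has_sum (\<Sum>\<^sub>\<infinity>i. of_int (s i) * z ^ e i)) UNIV"
    using sm by (rule has_sum_infsum)
  then have "((\<lambda>x. of_int (s (snd x)) * z ^ e (snd x)) has_sum (\<Sum>\<^sub>\<infinity>i. of_int (s i) * z ^ e i)) (SIGMA n:UNIV. {i. e i = n})"
    using has_sum_reindex_bij_betw[OF bij, of "\<lambda>i. of_int (s i) * z ^ e i"] by simp
  then have "((\<lambda>n. \<Sum>i | e i = n. of_int (s i) * z ^ e i) has_sum (\<Sum>\<^sub>\<infinity>i. of_int (s i) * z ^ e i)) UNIV"
    by (rule has_sum_SigmaD) (auto intro!: has_sum_finiteI fin)
  also have "(\<lambda>n. \<Sum>i | e i = n. of_int (s i) * z ^ e i) = (\<lambda>n. fps_nth (of_int_fps (fibre_fps e s)) n * z ^ n)"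
    by (simp add: fun_eq_iff of_int_fps_def fibre_fps_def sum_distrib_right)
  finally show ?thesis by (rule has_sum_imp_sums)
qed

lemma disc_fibre_fps:
  assumes fin: "\<And>n. finite {i. e i = n}"
    and sm: "\<And>z :: complex. norm z < 1 \<Longrightarrow> (\<lambda>i. of_int (s i) * z ^ e i) summable_on (UNIV :: 'i set)"
  shows "disc_fps (of_int_fps (fibre_fps e s))"
    and "norm z < 1 \<Longrightarrow> eval_fps (of_int_fps (fibre_fps e s)) z = (\<Sum>\<^sub>\<infinity>i. of_int (s i) * z ^ e i)"
proof -
  show disc: "disc_fps (of_int_fps (fibre_fps e s))"
    by (rule disc_fpsI) (use fibre_fps_sums[OF fin sm] in \<open>auto simp: sums_iff\<close>)
  show "eval_fps (of_int_fps (fibre_fps e s)) z = (\<Sum>\<^sub>\<infinity>i. of_int (s i) * z ^ e i)" if "norm z < 1"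
    by (rule sums_unique2[OF disc_fps_sums[OF disc that] fibre_fps_sums[OF fin sm[OF that]]])
qed

lemma nome_imaginary: "nome (\<i> * of_real y) = of_real (exp (- 2 * pi * y))"
proof -
  have "2 * of_real pi * \<i> * (\<i> * of_real y) = complex_of_real (- 2 * pi * y)"
    by (simp add: mult_ac)
  then show ?thesis by (simp only: nome_def exp_of_real)
qed

lemma nome_of_real: "nome (of_real x) = cis (2 * pi * x)"
  by (simp add: nome_def cis_conv_exp mult_ac)

lemma holomorphic_on_evq:
  assumes "disc_fps f" "g holomorphic_on A" "\<And>x. x \<in> A \<Longrightarrow> Im (g x) > 0"
  shows "(\<lambda>x. evq f (g x)) holomorphic_on A"
proof -
  have "(\<lambda>x. nome (g x)) holomorphic_on A"
    unfolding nome_def by (intro holomorphic_intros assms)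
  moreover have "(\<lambda>x. nome (g x)) ` A \<subseteq> ball 0 1"
    using assms(3) norm_nome_less_1 by auto
  ultimately show ?thesis
    using holomorphic_on_compose_gen[OF _ disc_fps_holomorphic[OF assms(1)]] by (auto simp: o_def)
qed

text \<open>Poisson summation is available for real parameters only and so gives transformation laws
  on the imaginary axis; the identity theorem carries them to the half plane.\<close>

lemma upper_half_plane_identity:
  assumes f: "f holomorphic_on {\<tau>. Im \<tau> > 0}" and g: "g holomorphic_on {\<tau>. Im \<tau> > 0}"
    and eq: "\<And>y::real. y > 0 \<Longrightarrow> f (\<i> * of_real y) = g (\<i> * of_real y)" and \<tau>: "Im \<tau> > 0"
  shows "f \<tau> = g \<tau>"
proof -
  have lim: "\<i> islimpt ((\<lambda>y. \<i> * of_real y) ` {0<..})"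
  proof (unfold islimpt_approachable, intro allI impI)
    fix e :: real assume e: "e > 0"
    have "\<i> * of_real (1 + e / 2) \<in> (\<lambda>y. \<i> * of_real y) ` {0<..}" using e by (intro imageI) auto
    moreover have "\<i> * of_real (1 + e / 2) - \<i> = \<i> * of_real (e / 2)" by (simp add: ring_distribs)
    then have "dist (\<i> * of_real (1 + e / 2)) \<i> = e / 2"
      unfolding dist_norm using e by (metis abs_of_pos half_gt_zero mult_1 norm_ii norm_mult norm_of_real)
    ultimately show "\<exists>x'\<in>(\<lambda>y. \<i> * of_real y) ` {0<..}. x' \<noteq> \<i> \<and> dist x' \<i> < e"
      using e by (intro bexI[of _ "\<i> * of_real (1 + e / 2)"]) auto
  qed
  have "f \<tau> - g \<tau> = 0"
  proof (rule analytic_continuation[where f = "\<lambda>\<tau>. f \<tau> - g \<tau>" and w = \<tau> and S = "{\<tau>. Im \<tau> > 0}" and U = "(\<lambda>y. \<i> * of_real y) ` {0<..}" and \<xi> = \<i>])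
    show "(\<lambda>\<tau>. f \<tau> - g \<tau>) holomorphic_on {\<tau>. Im \<tau> > 0}" by (intro holomorphic_intros f g)
    show "connected {\<tau>. Im \<tau> > 0}" by (intro convex_connected convex_halfspace_Im_gt)
    show "open {\<tau>. Im \<tau> > 0}" by (rule open_halfspace_Im_gt)
  qed (use lim eq \<tau> in auto)
  then show ?thesis by simp
qed

subsection \<open>Binary theta series\<close>

text \<open>With middle coefficient 1 the form \<open>a j^2 + j k + c k^2\<close> has discriminant
  \<open>1 - 4 a c = - N\<close>.\<close>

locale form = level N for N +
  fixes a c :: int
  assumes a_pos: "a > 0" and c_pos: "c > 0" and N_eq: "int N = 4 * a * c - 1"
begin

definition Q :: "int \<Rightarrow> int \<Rightarrow> int" where "Q j k = a * j\<^sup>2 + j * k + c * k\<^sup>2"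

lemma Q_ge: "2 * Q j k \<ge> j\<^sup>2 + k\<^sup>2"
proof -
  have "1 * j\<^sup>2 \<le> a * j\<^sup>2" "1 * k\<^sup>2 \<le> c * k\<^sup>2"
    using a_pos c_pos by (intro mult_right_mono; simp)+
  moreover have "(j + k)\<^sup>2 \<ge> 0" by simp
  ultimately show ?thesis by (simp add: Q_def power2_eq_square algebra_simps)
qed

lemma Q_nonneg: "Q j k \<ge> 0"
  using Q_ge[of j k] by (smt (verit) zero_le_power2)

definition theta :: "int fps" where
  "theta = fibre_fps (\<lambda>(j, k). nat (Q j k)) (\<lambda>_. 1)"

abbreviation Theta :: "complex fps" where "Theta \<equiv> of_int_fps theta"

lemma abs_le_square_int: "\<bar>j\<bar> \<le> (j :: int)\<^sup>2"
proof (cases "j = 0")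
  case False
  then have "\<bar>j\<bar> * 1 \<le> \<bar>j\<bar> * \<bar>j\<bar>" by (intro mult_left_mono) auto
  then show ?thesis by (simp add: power2_eq_square)
qed simp

lemma finite_Q_le: "finite {x. nat (case x of (j, k) \<Rightarrow> Q j k) = n}"
proof (rule finite_subset)
  show "{x. nat (case x of (j, k) \<Rightarrow> Q j k) = n} \<subseteq> {- 2 * int n..2 * int n} \<times> {- 2 * int n..2 * int n}"
  proof clarify
    fix j k assume "n = nat (Q j k)"
    then have "2 * int n \<ge> j\<^sup>2 + k\<^sup>2" using Q_ge[of j k] Q_nonneg[of j k] by simp
    moreover have "0 \<le> j\<^sup>2" "0 \<le> k\<^sup>2" by simp_all
    ultimately have "\<bar>j\<bar> \<le> 2 * int n" "\<bar>k\<bar> \<le> 2 * int n"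
      using abs_le_square_int[of j] abs_le_square_int[of k] by linarith+
    then show "j \<in> {- 2 * int (nat (Q j k))..2 * int (nat (Q j k))} \<and> k \<in> {- 2 * int (nat (Q j k))..2 * int (nat (Q j k))}"
      using \<open>n = nat (Q j k)\<close> by auto
  qed
qed auto

lemma summable_Q:
  assumes z: "norm (z :: complex) < 1"
  shows "(\<lambda>(j, k). z ^ nat (Q j k)) summable_on UNIV"
proof -
  \<comment> \<open>The maximum keeps \<open>s\<close> positive, so that \<open>ln s\<close> gives a
    Gaussian rate also for \<open>z = 0\<close>.\<close>
  define s where "s = max (1 / 2) (norm z)"
  have s: "0 < s" "s < 1" "norm z \<le> s" using z by (auto simp: s_def)
  define t where "t = - ln s / (2 * pi)"
  have "ln s < 0" using s by simp
  then have t: "t > 0" by (simp add: t_def divide_neg_pos)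
  have st: "s = exp (- 2 * pi * t)" using s by (simp add: t_def)
  show ?thesis
  proof (rule summable_on_dominated[OF summable_on_gauss_pair[OF t t, of 0 0]], clarify)
    fix j k
    have "norm (z ^ nat (Q j k)) \<le> s ^ nat (Q j k)"
      unfolding norm_power using s by (intro power_mono) auto
    also have "\<dots> = exp (- pi * t * (2 * of_int (Q j k)))"
      unfolding st using Q_nonneg[of j k] by (simp add: exp_of_nat_mult[symmetric] mult_ac)
    also have "\<dots> \<le> exp (- pi * t * ((of_int j)\<^sup>2 + (of_int k)\<^sup>2))"
    proof -
      have "real_of_int (j\<^sup>2 + k\<^sup>2) \<le> of_int (2 * Q j k)" using Q_ge[of j k] by (simp only: of_int_le_iff)
      then have "(of_int j)\<^sup>2 + (of_int k)\<^sup>2 \<le> 2 * real_of_int (Q j k)" by simp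
      then show ?thesis using t by simp
    qed
    also have "\<dots> = exp (- pi * t * (of_int j + 0)\<^sup>2) * exp (- pi * t * (of_int k + 0)\<^sup>2)"
      by (simp add: ring_distribs flip: exp_add)
    finally show "norm (z ^ nat (Q j k)) \<le> exp (- pi * t * (of_int j + 0)\<^sup>2) * exp (- pi * t * (of_int k + 0)\<^sup>2)" .
  qed
qed

lemma disc_Theta: "disc_fps Theta"
  and eval_Theta: "norm z < 1 \<Longrightarrow> eval_fps Theta z = (\<Sum>\<^sub>\<infinity>(j, k). z ^ nat (Q j k))"
  unfolding theta_def using disc_fibre_fps[where e = "\<lambda>(j, k). nat (Q j k)" and s = "\<lambda>_. 1"]
    finite_Q_le summable_Q by (simp_all add: case_prod_unfold)

lemma evq_Theta:
  assumes "Im \<tau> > 0"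
  shows "evq Theta \<tau> = (\<Sum>\<^sub>\<infinity>(j, k). nome (of_int (Q j k) * \<tau>))"
    and "(\<lambda>(j, k). nome (of_int (Q j k) * \<tau>)) summable_on UNIV"
  using eval_Theta[OF norm_nome_less_1[OF assms]] summable_Q[OF norm_nome_less_1[OF assms]]
  by (simp_all add: nome_power Q_nonneg)

text \<open>Since \<open>4 a c\<close> is 1 modulo \<open>N\<close>, the form is \<open>a\<close>
  times a square there. In \<open>Theta_gauss\<close> this identifies the phase
  \<open>e' a m2^2\<close> with \<open>e'\<close> times a value of \<open>Q\<close>.\<close>

lemma dual_form_substitution: "[a * (m - 2 * c * n)\<^sup>2 = Q m (- n)] (mod int N)"
proof -
  have "a * (m - 2 * c * n)\<^sup>2 - Q m (- n) = int N * (c * n\<^sup>2 - m * n)"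
    unfolding Q_def N_eq by (simp add: power2_eq_square algebra_simps)
  then show ?thesis by (simp add: cong_iff_dvd_diff)
qed

section \<open>Additive characters and Gauss sums modulo N\<close>

lemma nome_periodic:
  assumes "[x = y] (mod int N)"
  shows "nome (of_int x / of_nat N) = nome (of_int y / of_nat N)"
proof -
  obtain m where "y = x + int N * m" using assms by (auto simp: cong_iff_lin)
  then have "of_int y / of_nat N = of_int x / of_nat N + (of_int m :: complex)"
    using N_pos by (simp add: field_simps)
  then show ?thesis by (simp only: nome_add_int)
qed

lemma sum_residues_shift:
  fixes f :: "int \<Rightarrow> complex"
  assumes per: "\<And>x y. [x = y] (mod int N) \<Longrightarrow> f x = f y"
    and bij: "coprime u (int N)"
  shows "(\<Sum>i\<in>{0..<int N}. f (u * i + h)) = (\<Sum>i\<in>{0..<int N}. f i)"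
proof -
  have inj: "inj_on (\<lambda>i. (u * i + h) mod int N) {0..<int N}"
  proof (rule inj_onI)
    fix i j assume ij: "i \<in> {0..<int N}" "j \<in> {0..<int N}" and "(u * i + h) mod int N = (u * j + h) mod int N"
    then have "[u * i + h = u * j + h] (mod int N)" by (simp add: cong_def)
    then have "[u * i = u * j] (mod int N)" by (simp add: cong_add_rcancel)
    then have "[i = j] (mod int N)" using bij by (simp add: cong_mult_lcancel)
    then show "i = j" using ij by (simp add: cong_def)
  qed
  moreover have "(\<lambda>i. (u * i + h) mod int N) ` {0..<int N} \<subseteq> {0..<int N}" using N_pos by auto
  ultimately have "bij_betw (\<lambda>i. (u * i + h) mod int N) {0..<int N} {0..<int N}"
    by (metis bij_betw_def endo_inj_surj finite_atLeastLessThan_int)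
  from sum.reindex_bij_betw[OF this, of f]
  have "(\<Sum>i\<in>{0..<int N}. f ((u * i + h) mod int N)) = (\<Sum>i\<in>{0..<int N}. f i)" .
  moreover have "f ((u * i + h) mod int N) = f (u * i + h)" for i by (rule per) (simp add: cong_def)
  ultimately show ?thesis by simp
qed

lemma sum_residues_character:
  "(\<Sum>i\<in>{0..<int N}. nome (of_int (m * i) / of_nat N)) = (if int N dvd m then of_nat N else 0)"
proof (cases "int N dvd m")
  case True
  have "nome (of_int (m * i) / of_nat N) = nome (of_int 0 / of_nat N)" for i
    by (rule nome_periodic) (use True in \<open>simp add: cong_0_iff\<close>)
  then have "nome (of_int (m * i) / of_nat N) = 1" for i using nome_of_int[of 0] by simp
  then show ?thesis using True by simp
next
  case False
  let ?S = "\<Sum>i\<in>{0..<int N}. nome (of_int (m * i) / of_nat N)"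
  have "(\<Sum>i\<in>{0..<int N}. nome (of_int (m * (1 * i + 1)) / of_nat N)) = ?S"
  proof (rule sum_residues_shift[where f = "\<lambda>i. nome (of_int (m * i) / of_nat N)"])
    show "nome (of_int (m * x) / of_nat N) = nome (of_int (m * y) / of_nat N)" if "[x = y] (mod int N)" for x y
      by (intro nome_periodic cong_mult cong_refl that)
  qed simp
  moreover have "nome (of_int (m * (1 * i + 1)) / of_nat N) = nome (of_int m / of_nat N) * nome (of_int (m * i) / of_nat N)" for i
    by (simp add: ring_distribs add_divide_distrib nome_add)
  ultimately have "nome (of_int m / of_nat N) * ?S = ?S" by (simp add: sum_distrib_left)
  moreover have "nome (of_int m / of_nat N) \<noteq> 1"
  proof
    assume "nome (of_int m / of_nat N) = 1"
    then obtain n :: int where n: "2 * pi * (real_of_int m / real N) = real_of_int (2 * n) * pi"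
      by (auto simp: nome_def exp_eq_1)
    have "X = Y" if "2 * pi * X = real_of_int (2 * n) * pi" "Y = real_of_int n" for X Y
      using that by simp
    from this[OF n refl] have "real_of_int m = real_of_int (n * int N)" using N_pos by (simp add: field_simps)
    then have "m = n * int N" by (simp only: of_int_eq_iff)
    with False show False by simp
  qed
  ultimately show ?thesis using False by simp
qed

definition gauss_sum :: "int \<Rightarrow> complex" where
  "gauss_sum x = (\<Sum>s\<in>{0..<int N}. nome (of_int (x * s\<^sup>2) / of_nat N))"

text \<open>Modulo \<open>N\<close> the form degenerates to \<open>c (2 a j + k)\<^sup>2\<close>.\<close>

lemma double_gauss_sum:
  assumes ee: "[e * e' = - 1] (mod int N)"
  shows "(\<Sum>j\<in>{0..<int N}. \<Sum>k\<in>{0..<int N}. nome (of_int (e * Q j k + m1 * j + m2 * k) / of_nat N))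
    = (if int N dvd m1 - 2 * a * m2 then of_nat N * nome (of_int (e' * a * m2\<^sup>2) / of_nat N) * gauss_sum (e * c) else 0)"
proof -
  have inner: "(\<Sum>k\<in>{0..<int N}. nome (of_int (e * Q j k + m1 * j + m2 * k) / of_nat N))
     = nome (of_int ((m1 - 2 * a * m2) * j) / of_nat N) * (nome (of_int (e' * a * m2\<^sup>2) / of_nat N) * gauss_sum (e * c))" for j
  proof -
    \<comment> \<open>With \<open>s = 2 a j + k\<close>, this \<open>h\<close> solves
      \<open>2 e c h = m2\<close> modulo \<open>N\<close>, so \<open>e c (s + h)^2\<close> absorbs
      the term \<open>m2 s\<close>; the constant left over is \<open>e' a m2^2\<close>, and
      \<open>m2 k = m2 s - 2 a m2 j\<close> leaves the linear term in \<open>j\<close>.\<close>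
    define h where "h = - (e' * 2 * a * m2)"
    have per: "nome (of_int (e * c * (x\<^sup>2)) / of_nat N) = nome (of_int (e * c * (y\<^sup>2)) / of_nat N)"
      if "[x = y] (mod int N)" for x y
      using that by (intro nome_periodic cong_mult cong_pow) auto
    have "nome (of_int (e * Q j k + m1 * j + m2 * k) / of_nat N)
      = nome (of_int ((m1 - 2 * a * m2) * j) / of_nat N) * (nome (of_int (e' * a * m2\<^sup>2) / of_nat N) *
         nome (of_int (e * c * (1 * k + (2 * a * j + h))\<^sup>2) / of_nat N))" for k
    proof -
      obtain r where r: "e * e' = - 1 + int N * r"
        using ee by (metis cong_iff_lin cong_sym)
      define s where "s = 2 * a * j + k"
      have 1: "c * s\<^sup>2 = Q j k + int N * (a * j\<^sup>2 + j * k)"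
        unfolding s_def Q_def N_eq by (simp add: power2_eq_square algebra_simps)
      have 2: "e * c * (s + h)\<^sup>2 = e * (c * s\<^sup>2) - 4 * a * c * (e * e') * m2 * s + (4 * a * c) * (e * e') * e' * a * m2\<^sup>2"
        unfolding h_def by (simp add: power2_eq_square algebra_simps)
      have 3: "4 * a * c = 1 + int N" using N_eq by simp
      have E: "e * c * (s + h)\<^sup>2 = e * (Q j k + int N * (a * j\<^sup>2 + j * k)) - (1 + int N) * (- 1 + int N * r) * m2 * s
          + (1 + int N) * (- 1 + int N * r) * e' * a * m2\<^sup>2"
        using 2 by (simp only: 1 3 r)
      have "(m1 - 2 * a * m2) * j + e' * a * m2\<^sup>2 + e * c * (s + h)\<^sup>2 - (e * Q j k + m1 * j + m2 * k)
        = int N * (e * (a * j\<^sup>2 + j * k) + m2 * s - (1 + int N) * r * m2 * s + (- 1 + int N * r) * (e' * a * m2\<^sup>2) + r * (e' * a * m2\<^sup>2))"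
        unfolding E unfolding s_def by (simp add: power2_eq_square algebra_simps)
      then have "[e * Q j k + m1 * j + m2 * k = (m1 - 2 * a * m2) * j + (e' * a * m2\<^sup>2 + e * c * (s + h)\<^sup>2)] (mod int N)"
        by (subst cong_sym_eq) (simp add: cong_iff_dvd_diff add.assoc)
      from nome_periodic[OF this]
      have "nome (of_int (e * Q j k + m1 * j + m2 * k) / of_nat N) =
          nome (of_int ((m1 - 2 * a * m2) * j) / of_nat N + (of_int (e' * a * m2\<^sup>2) / of_nat N + of_int (e * c * (s + h)\<^sup>2) / of_nat N))"
        by (simp only: of_int_add add_divide_distrib)
      moreover have "s + h = 1 * k + (2 * a * j + h)" by (simp add: s_def)
      ultimately show ?thesis by (simp only: nome_add)
    qed
    then show ?thesis
      using sum_residues_shift[of "\<lambda>x. nome (of_int (e * c * x\<^sup>2) / of_nat N)" 1 "2 * a * j + h", OF per]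
      by (simp only: sum_distrib_left[symmetric] gauss_sum_def) simp
  qed
  show ?thesis
    unfolding inner sum_distrib_right[symmetric] sum_residues_character by simp
qed

section \<open>Transformation laws of the theta series\<close>

lemma kappa_imaginary: "kappa * (\<i> * of_real y) = of_real (y / sqrt (real N))"
  using N_pos by (simp add: kappa_def field_simps)

lemma Q'_eq_Q: "(real_of_int c * (of_int m)\<^sup>2 - of_int m * of_int n + of_int a * (of_int n)\<^sup>2) = of_int (Q n (- m))"
  by (simp add: Q_def)

text \<open>Poisson summation without shifts. The dual form at \<open>(m, n)\<close> is
  \<open>Q n (- m) / N\<close>, so the same theta series returns with argument
  \<open>\<tau> / N\<close>.\<close>

lemma Theta_inversion:
  assumes "Im \<tau> > 0"
  shows "evq Theta (- 1 / \<tau>) = kappa * \<tau> * evq Theta (\<tau> / of_nat N)"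
proof (rule upper_half_plane_identity[where f = "\<lambda>\<tau>. evq Theta (- 1 / \<tau>)" and g = "\<lambda>\<tau>. kappa * \<tau> * evq Theta (\<tau> / of_nat N)"])
  show "(\<lambda>\<tau>. evq Theta (- 1 / \<tau>)) holomorphic_on {\<tau>. 0 < Im \<tau>}"
    by (intro holomorphic_on_evq disc_Theta holomorphic_intros Im_minus_inverse_pos) auto
  show "(\<lambda>\<tau>. kappa * \<tau> * evq Theta (\<tau> / of_nat N)) holomorphic_on {\<tau>. 0 < Im \<tau>}"
    using N_pos by (intro holomorphic_intros holomorphic_on_evq disc_Theta) auto
  fix y :: real assume y: "y > 0"
  have 1: "- 1 / (\<i> * of_real y) = \<i> * of_real (1 / y)" using y by (simp add: field_simps)
  have iN: "real_of_int (int N) = real N" by simp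
  have "evq Theta (- 1 / (\<i> * of_real y)) = (\<Sum>\<^sub>\<infinity>(j, k). nome (of_int (Q j k) * (\<i> * of_real (1 / y))))"
    unfolding 1 by (rule evq_Theta) (use y in simp)
  also have "\<dots> = (\<Sum>\<^sub>\<infinity>(j, k). complex_of_real (exp (- 2 * pi * (1 / y) *
      (of_int a * (of_int j + 0)\<^sup>2 + (of_int j + 0) * (of_int k + 0) + of_int c * (of_int k + 0)\<^sup>2))))"
  proof (intro infsum_cong, clarify)
    fix j k :: int
    have "nome (of_int (Q j k) * (\<i> * of_real (1 / y))) = nome (\<i> * of_real (of_int (Q j k) / y))"
      by (simp add: mult_ac)
    then show "nome (of_int (Q j k) * (\<i> * of_real (1 / y))) = complex_of_real (exp (- 2 * pi * (1 / y) *
      (of_int a * (of_int j + 0)\<^sup>2 + (of_int j + 0) * (of_int k + 0) + of_int c * (of_int k + 0)\<^sup>2)))"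
      by (simp only: nome_imaginary) (simp add: Q_def)
  qed
  also have "\<dots> = of_real (1 / (1 / y * sqrt (of_int (int N)))) *
      (\<Sum>\<^sub>\<infinity>(m, n). of_real (exp (- 2 * pi * ((of_int c * (of_int m)\<^sup>2 - of_int m * of_int n + of_int a * (of_int n)\<^sup>2) / of_int (int N)) / (1 / y))) *
         cis (2 * pi * (of_int m * 0 + of_int n * 0)))"
    by (rule Poisson_binary_form[OF a_pos c_pos N_eq, of "1 / y" 0 0]) (use y in simp)
  also have "of_real (1 / (1 / y * sqrt (of_int (int N)))) = kappa * (\<i> * of_real y)"
    unfolding kappa_imaginary using y by simp
  also have "(\<Sum>\<^sub>\<infinity>(m, n). of_real (exp (- 2 * pi * ((of_int c * (of_int m)\<^sup>2 - of_int m * of_int n + of_int a * (of_int n)\<^sup>2) / of_int (int N)) / (1 / y))) *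
         cis (2 * pi * (of_int m * 0 + of_int n * 0)))
     = (\<Sum>\<^sub>\<infinity>(j, k). nome (of_int (Q j k) * (\<i> * of_real y / of_nat N)))"
  proof (rule infsum_reindex_bij_witness[where i = "\<lambda>(j, k). (- k, j)" and j = "\<lambda>(m, n). (n, - m)"])
    fix x :: "int \<times> int"
    obtain m n where x: "x = (m, n)" by (cases x)
    have "nome (of_int (Q n (- m)) * (\<i> * of_real y / of_nat N)) = nome (\<i> * of_real (y * of_int (Q n (- m)) / real N))"
      by (simp add: mult_ac)
    then show "(case case x of (m, n) \<Rightarrow> (n, - m) of (j, k) \<Rightarrow> nome (of_int (Q j k) * (\<i> * of_real y / of_nat N)))
      = (case x of (m, n) \<Rightarrow> of_real (exp (- 2 * pi * ((of_int c * (of_int m)\<^sup>2 - of_int m * of_int n + of_int a * (of_int n)\<^sup>2) / of_int (int N)) / (1 / y))) *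
         cis (2 * pi * (of_int m * 0 + of_int n * 0)))"
      unfolding x prod.case nome_imaginary Q'_eq_Q by (simp add: mult_ac)
  qed auto
  also have "\<dots> = evq Theta (\<i> * of_real y / of_nat N)"
    by (rule evq_Theta(1)[symmetric]) (use y N_pos in simp)
  finally show "evq Theta (- 1 / (\<i> * of_real y)) = kappa * (\<i> * of_real y) * evq Theta (\<i> * of_real y / of_nat N)" .
qed (use assms in simp)

lemma Theta_Fricke:
  assumes "Im \<tau> > 0"
  shows "evq Theta (- 1 / (of_nat N * \<tau>)) = of_nat N * kappa * \<tau> * evq Theta \<tau>"
  using Theta_inversion[of "of_nat N * \<tau>"] assms N_pos by (simp add: mult_ac)

lemma infsum_residues:
  fixes f :: "int \<times> int \<Rightarrow> complex"
  assumes f: "f summable_on UNIV"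
  shows "infsum f UNIV = (\<Sum>j\<in>{0..<int N}. \<Sum>k\<in>{0..<int N}. \<Sum>\<^sub>\<infinity>(s, t). f (int N * s + j, int N * t + k))"
proof -
  define g where "g = (\<lambda>((j, k), (s, t)). (int N * s + j, int N * t + k))"
  define R where "R = {0..<int N} \<times> {0..<int N}"
  have bij: "bij_betw g (SIGMA r:R. UNIV) UNIV"
  proof (rule bij_betwI[where g = "\<lambda>(x, y). ((x mod int N, y mod int N), (x div int N, y div int N))"])
    show "g \<in> (SIGMA r:R. UNIV) \<rightarrow> UNIV" by simp
    show "(\<lambda>(x, y). ((x mod int N, y mod int N), (x div int N, y div int N))) \<in> UNIV \<rightarrow> (SIGMA r:R. UNIV)"
      using N_pos by (auto simp: R_def)
  qed (use N_pos in \<open>auto simp: g_def R_def\<close>)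
  have "infsum f UNIV = infsum (\<lambda>x. f (g x)) (SIGMA r:R. UNIV)"
    by (rule infsum_reindex_bij_betw[OF bij, symmetric])
  also have "\<dots> = infsum (\<lambda>r. infsum (\<lambda>x. f (g (r, x))) UNIV) R"
    by (rule infsum_Sigma_banach[symmetric]) (simp add: summable_on_reindex_bij_betw[OF bij] f)
  also have "\<dots> = (\<Sum>r\<in>R. infsum (\<lambda>x. f (g (r, x))) UNIV)"
    by (rule infsum_finite) (simp add: R_def)
  also have "\<dots> = (\<Sum>j\<in>{0..<int N}. \<Sum>k\<in>{0..<int N}. infsum (\<lambda>x. f (g ((j, k), x))) UNIV)"
    unfolding R_def sum.cartesian_product by (simp add: case_prod_unfold)
  finally show ?thesis by (simp add: g_def case_prod_unfold)
qed

lemma summable_infsum_sum: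
  fixes f :: "'j \<Rightarrow> 'x \<Rightarrow> complex"
  assumes "finite J" "\<And>j. j \<in> J \<Longrightarrow> f j summable_on A"
  shows "(\<lambda>x. \<Sum>j\<in>J. f j x) summable_on A"
    and "(\<Sum>\<^sub>\<infinity>x\<in>A. \<Sum>j\<in>J. f j x) = (\<Sum>j\<in>J. infsum (f j) A)"
  using assms by (induction J rule: finite_induct) (auto simp: infsum_add summable_on_add)

text \<open>On each residue class modulo \<open>N\<close> the phase coming from \<open>e\<close> is
  constant, so Poisson summation applies class by class. Summing over the classes first gives the
  finite Fourier transform \<open>double_gauss_sum\<close>, which is supported on a sublattice of
  the dual lattice and there contributes one Gauss sum and a phase belonging to
  \<open>e'\<close>.\<close>

lemma Theta_gauss:
  assumes \<tau>: "Im \<tau> > 0" and ee: "[e * e' = - 1] (mod int N)"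
  shows "evq Theta ((- 1 / \<tau> + of_int e) / of_nat N) = kappa * gauss_sum (e * c) * \<tau> * evq Theta ((\<tau> + of_int e') / of_nat N)"
proof (rule upper_half_plane_identity[where f = "\<lambda>\<tau>. evq Theta ((- 1 / \<tau> + of_int e) / of_nat N)" and g = "\<lambda>\<tau>. kappa * gauss_sum (e * c) * \<tau> * evq Theta ((\<tau> + of_int e') / of_nat N)"])
  have "Im ((- 1 / \<tau> + of_int e) / of_nat N) > 0" if "Im \<tau> > 0" for \<tau>
  proof -
    have "Im ((- 1 / \<tau> + of_int e) / of_nat N) = Im (- 1 / \<tau>) / real N" by simp
    then show ?thesis using Im_minus_inverse_pos[OF that] N_pos by (simp only: divide_pos_pos of_nat_0_less_iff)
  qed
  then show "(\<lambda>\<tau>. evq Theta ((- 1 / \<tau> + of_int e) / of_nat N)) holomorphic_on {\<tau>. 0 < Im \<tau>}"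
    using N_pos by (intro holomorphic_on_evq disc_Theta holomorphic_intros) auto
  show "(\<lambda>\<tau>. kappa * gauss_sum (e * c) * \<tau> * evq Theta ((\<tau> + of_int e') / of_nat N)) holomorphic_on {\<tau>. 0 < Im \<tau>}"
    using N_pos by (intro holomorphic_intros holomorphic_on_evq disc_Theta) auto
  fix y :: real assume y: "y > 0"
  define f where "f = (\<lambda>(j, k). nome (of_int (Q j k) * ((\<i> * of_real (1 / y) + of_int e) / of_nat N)))"
  define W where "W = (\<lambda>m n :: int. nome (of_int (Q n (- m)) * (\<i> * of_real y / of_nat (N ^ 2))))"
  define C where "C = kappa * (\<i> * of_real y) / of_nat N"
  have 1: "- 1 / (\<i> * of_real y) = \<i> * of_real (1 / y)" using y by (simp add: field_simps)
  have Im1: "Im ((\<i> * of_real (1 / y) + of_int e) / of_nat N) > 0" using y N_pos by simp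
  have Im2: "Im (\<i> * of_real y / of_nat (N ^ 2)) > 0" using y N_pos by (simp add: Im_divide_of_nat)
  have fsum: "f summable_on UNIV" unfolding f_def by (rule evq_Theta(2)[OF Im1])
  have Wsum: "(\<lambda>(m, n). W m n * X m n) summable_on UNIV" if X: "\<And>m n. norm (X m n) = 1" for X
  proof -
    have bij: "bij_betw (\<lambda>(m, n). (n, - m)) UNIV (UNIV :: (int \<times> int) set)"
      by (rule bij_betwI[where g = "\<lambda>(j, k). (- k, j)"]) auto
    have "(\<lambda>(m, n). W m n) summable_on UNIV"
      using summable_on_reindex_bij_betw[OF bij, of "\<lambda>(j, k). nome (of_int (Q j k) * (\<i> * of_real y / of_nat (N ^ 2)))"] evq_Theta(2)[OF Im2]
      by (simp add: W_def case_prod_unfold)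
    then have "(\<lambda>x. norm (case x of (m, n) \<Rightarrow> W m n)) summable_on UNIV"
      using summable_on_iff_abs_summable_on_complex by blast
    then show ?thesis by (rule summable_on_dominated) (auto simp: norm_mult X)
  qed
  have inner: "(\<Sum>\<^sub>\<infinity>(s, t). f (int N * s + j, int N * t + k))
     = C * (\<Sum>\<^sub>\<infinity>(m, n). W m n * nome (of_int (e * Q j k + m * j + n * k) / of_nat N))" for j k
  proof -
    define s0 where "s0 = real N / y"
    have s0: "s0 > 0" using y N_pos by (simp add: s0_def)
    have fN: "f (int N * s + j, int N * t + k) = nome (of_int (e * Q j k) / of_nat N) *
       complex_of_real (exp (- 2 * pi * s0 * (of_int a * (of_int s + of_int j / real N)\<^sup>2
          + (of_int s + of_int j / real N) * (of_int t + of_int k / real N) + of_int c * (of_int t + of_int k / real N)\<^sup>2)))" for s t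
    proof -
      define q where "q = Q (int N * s + j) (int N * t + k)"
      have "q - Q j k = int N * (a * (int N * s\<^sup>2 + 2 * s * j) + (int N * s * t + s * k + j * t) + c * (int N * t\<^sup>2 + 2 * t * k))"
        by (simp add: q_def Q_def power2_eq_square algebra_simps)
      then have "[q = Q j k] (mod int N)" by (simp add: cong_iff_dvd_diff)
      then have "[e * q = e * Q j k] (mod int N)" by (intro cong_mult cong_refl)
      then have n1: "nome (of_int (e * q) / of_nat N) = nome (of_int (e * Q j k) / of_nat N)"
        by (rule nome_periodic)
      have "real_of_int q = (real N)\<^sup>2 * (of_int a * (of_int s + of_int j / real N)\<^sup>2
          + (of_int s + of_int j / real N) * (of_int t + of_int k / real N) + of_int c * (of_int t + of_int k / real N)\<^sup>2)"
        using N_pos by (simp add: q_def Q_def power2_eq_square field_simps)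
      then have n2: "of_int q / y / real N = s0 * (of_int a * (of_int s + of_int j / real N)\<^sup>2
          + (of_int s + of_int j / real N) * (of_int t + of_int k / real N) + of_int c * (of_int t + of_int k / real N)\<^sup>2)"
        using N_pos y by (simp add: s0_def power2_eq_square)
      have "f (int N * s + j, int N * t + k) = nome (of_int (e * q) / of_nat N + \<i> * of_real (of_int q / y / real N))"
        unfolding f_def prod.case q_def[symmetric] using N_pos y by (simp add: field_simps)
      then show ?thesis by (simp only: nome_add n1 n2 nome_imaginary mult.assoc)
    qed
    have iN: "real_of_int (int N) = real N" by simp
    have "(\<Sum>\<^sub>\<infinity>(s, t). f (int N * s + j, int N * t + k)) = nome (of_int (e * Q j k) / of_nat N) *
       (\<Sum>\<^sub>\<infinity>(s, t). complex_of_real (exp (- 2 * pi * s0 * (of_int a * (of_int s + of_int j / real N)\<^sup>2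
          + (of_int s + of_int j / real N) * (of_int t + of_int k / real N) + of_int c * (of_int t + of_int k / real N)\<^sup>2))))"
      unfolding fN infsum_cmult_right'[symmetric] by (simp add: case_prod_unfold)
    also have "\<dots> = nome (of_int (e * Q j k) / of_nat N) * (of_real (1 / (s0 * sqrt (of_int (int N)))) *
      (\<Sum>\<^sub>\<infinity>(m, n). of_real (exp (- 2 * pi * ((of_int c * (of_int m)\<^sup>2 - of_int m * of_int n + of_int a * (of_int n)\<^sup>2) / of_int (int N)) / s0)) *
         cis (2 * pi * (of_int m * (of_int j / real N) + of_int n * (of_int k / real N)))))"
      by (subst Poisson_binary_form[OF a_pos c_pos N_eq s0]) (rule refl)
    also have "of_real (1 / (s0 * sqrt (of_int (int N)))) = C"
    proof -
      have "C = of_real (y / sqrt (real N)) / of_nat N" unfolding C_def kappa_imaginary ..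
      also have "\<dots> = of_real (y / sqrt (real N) / real N)" by simp
      finally show ?thesis by (simp add: s0_def iN mult_ac)
    qed
    also have "nome (of_int (e * Q j k) / of_nat N) * (C *
      (\<Sum>\<^sub>\<infinity>(m, n). of_real (exp (- 2 * pi * ((of_int c * (of_int m)\<^sup>2 - of_int m * of_int n + of_int a * (of_int n)\<^sup>2) / of_int (int N)) / s0)) *
         cis (2 * pi * (of_int m * (of_int j / real N) + of_int n * (of_int k / real N)))))
      = C * (\<Sum>\<^sub>\<infinity>x. nome (of_int (e * Q j k) / of_nat N) * (case x of (m, n) \<Rightarrow> of_real (exp (- 2 * pi * ((of_int c * (of_int m)\<^sup>2 - of_int m * of_int n + of_int a * (of_int n)\<^sup>2) / of_int (int N)) / s0)) *
         cis (2 * pi * (of_int m * (of_int j / real N) + of_int n * (of_int k / real N)))))"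
      unfolding infsum_cmult_right' by (rule mult.left_commute)
    also have "(\<Sum>\<^sub>\<infinity>x. nome (of_int (e * Q j k) / of_nat N) * (case x of (m, n) \<Rightarrow> of_real (exp (- 2 * pi * ((of_int c * (of_int m)\<^sup>2 - of_int m * of_int n + of_int a * (of_int n)\<^sup>2) / of_int (int N)) / s0)) *
         cis (2 * pi * (of_int m * (of_int j / real N) + of_int n * (of_int k / real N)))))
       = (\<Sum>\<^sub>\<infinity>(m, n). W m n * nome (of_int (e * Q j k + m * j + n * k) / of_nat N))"
    proof (intro infsum_cong, clarify)
      fix m n :: int
      have "W m n = nome (\<i> * of_real (of_int (Q n (- m)) / real N / s0))"
        unfolding W_def s0_def using y by (simp add: power2_eq_square field_simps)
      then have W': "W m n = of_real (exp (- 2 * pi * (of_int (Q n (- m)) / real N) / s0))"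
        by (simp only: nome_imaginary) simp
      have "cis (2 * pi * (of_int m * (of_int j / real N) + of_int n * (of_int k / real N))) = nome (of_real (of_int m * (of_int j / real N) + of_int n * (of_int k / real N)))"
        by (simp only: nome_of_real)
      also have "complex_of_real (of_int m * (of_int j / real N) + of_int n * (of_int k / real N)) = of_int (m * j + n * k) / of_nat N"
        by (simp add: add_divide_distrib)
      finally have cis': "cis (2 * pi * (of_int m * (of_int j / real N) + of_int n * (of_int k / real N))) = nome (of_int (m * j + n * k) / of_nat N)" .
      have n3: "nome (of_int (e * Q j k + m * j + n * k) / of_nat N) = nome (of_int (e * Q j k) / of_nat N) * nome (of_int (m * j + n * k) / of_nat N)"
        by (simp only: nome_add[symmetric] add_divide_distrib[symmetric] of_int_add[symmetric] add.assoc)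
      show "nome (of_int (e * Q j k) / of_nat N) * (of_real (exp (- 2 * pi * ((of_int c * (of_int m)\<^sup>2 - of_int m * of_int n + of_int a * (of_int n)\<^sup>2) / of_int (int N)) / s0)) *
         cis (2 * pi * (of_int m * (of_int j / real N) + of_int n * (of_int k / real N))))
         = W m n * nome (of_int (e * Q j k + m * j + n * k) / of_nat N)"
        unfolding n3 cis' W' Q'_eq_Q iN by (rule mult.left_commute)
    qed
    finally show ?thesis .
  qed
  define G where "G = gauss_sum (e * c)"
  define T where "T = {(m, n). int N dvd m - 2 * a * n}"
  have "evq Theta ((- 1 / (\<i> * of_real y) + of_int e) / of_nat N) = infsum f UNIV"
    unfolding 1 f_def by (rule evq_Theta(1)[OF Im1])
  also have "\<dots> = (\<Sum>j\<in>{0..<int N}. \<Sum>k\<in>{0..<int N}. C * (\<Sum>\<^sub>\<infinity>(m, n). W m n * nome (of_int (e * Q j k + m * j + n * k) / of_nat N)))"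
    unfolding infsum_residues[OF fsum] inner ..
  also have "\<dots> = C * (\<Sum>\<^sub>\<infinity>x. \<Sum>j\<in>{0..<int N}. \<Sum>k\<in>{0..<int N}. (case x of (m, n) \<Rightarrow> W m n * nome (of_int (e * Q j k + m * j + n * k) / of_nat N)))"
  proof -
    have sm: "(\<lambda>x. case x of (m, n) \<Rightarrow> W m n * nome (of_int (e * Q j k + m * j + n * k) / of_nat N)) summable_on UNIV" for j k
    proof (rule Wsum)
      show "norm (nome (of_int (e * Q j k + m * j + n * k) / of_nat N)) = 1" for m n
        by (simp add: norm_nome Im_divide_of_nat)
    qed
    show ?thesis
      by (simp only: summable_infsum_sum[OF finite_atLeastLessThan_int] sm sum_distrib_left[symmetric])
  qed
  also have "(\<Sum>\<^sub>\<infinity>x. \<Sum>j\<in>{0..<int N}. \<Sum>k\<in>{0..<int N}. (case x of (m, n) \<Rightarrow> W m n * nome (of_int (e * Q j k + m * j + n * k) / of_nat N)))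
     = (\<Sum>\<^sub>\<infinity>(m, n)\<in>T. W m n * (of_nat N * nome (of_int (e' * a * n\<^sup>2) / of_nat N) * G))"
  proof (rule infsum_cong_neutral)
    fix x :: "int \<times> int"
    obtain m n where x: "x = (m, n)" by (cases x)
    have *: "(\<Sum>j\<in>{0..<int N}. \<Sum>k\<in>{0..<int N}. (case x of (m, n) \<Rightarrow> W m n * nome (of_int (e * Q j k + m * j + n * k) / of_nat N)))
      = W m n * (if x \<in> T then of_nat N * nome (of_int (e' * a * n\<^sup>2) / of_nat N) * G else 0)"
      unfolding x prod.case sum_distrib_left[symmetric] double_gauss_sum[OF ee] T_def G_def by simp
    show "(\<Sum>j\<in>{0..<int N}. \<Sum>k\<in>{0..<int N}. (case x of (m, n) \<Rightarrow> W m n * nome (of_int (e * Q j k + m * j + n * k) / of_nat N))) = 0"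
      if "x \<in> UNIV - T" using that unfolding * by simp
    show "(\<Sum>j\<in>{0..<int N}. \<Sum>k\<in>{0..<int N}. (case x of (m, n) \<Rightarrow> W m n * nome (of_int (e * Q j k + m * j + n * k) / of_nat N)))
       = (case x of (m, n) \<Rightarrow> W m n * (of_nat N * nome (of_int (e' * a * n\<^sup>2) / of_nat N) * G))"
      if "x \<in> UNIV \<inter> T" using that unfolding * by (simp add: x)
  qed auto
  txt \<open>The sublattice \<open>T\<close> is parametrised by \<open>(2 a m\<^sub>2 - N n, m\<^sub>2)\<close> with \<open>m\<^sub>2 = m + 2 c n\<close>; in these
    coordinates the dual form is again \<open>N Q\<close>.\<close>
  also have "\<dots> = (\<Sum>\<^sub>\<infinity>(m, n). of_nat N * G * nome (of_int (Q m n) * ((\<i> * of_real y + of_int e') / of_nat N)))"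
  proof (rule infsum_reindex_bij_witness[symmetric])
    let ?j = "\<lambda>(m, n). (2 * a * (m + 2 * c * n) - int N * n, m + 2 * c * n)"
    let ?i = "\<lambda>(m1, m2). (m2 + 2 * c * ((m1 - 2 * a * m2) div int N), - ((m1 - 2 * a * m2) div int N))"
    have dv: "- (int N * z) div int N = - z" for z
      using nonzero_mult_div_cancel_left[of "int N" "- z"] N_pos by simp
    fix x :: "int \<times> int"
    show "?i (?j x) = x" "?j x \<in> T" using N_pos by (auto simp: T_def dv split: prod.splits)
    show "?j (?i x) = x" if "x \<in> T" using that by (auto simp: T_def split: prod.splits)
    obtain m n where x: "x = (m, n)" by (cases x)
    define m2 where "m2 = m + 2 * c * n"
    define m1 where "m1 = 2 * a * m2 - int N * n"
    have q: "Q m2 (- m1) = int N * Q m n"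
      unfolding Q_def m1_def m2_def N_eq by (simp add: power2_eq_square algebra_simps)
    have cg: "[a * m2\<^sup>2 = Q m n] (mod int N)"
      using dual_form_substitution[of m "- n"] by (simp add: m2_def)
    have "[e' * a * m2\<^sup>2 = e' * Q m n] (mod int N)"
      using cong_mult[OF cong_refl[of e'] cg] by (simp add: mult.assoc)
    then have n1: "nome (of_int (e' * a * m2\<^sup>2) / of_nat N) = nome (of_int (e' * Q m n) / of_nat N)"
      by (rule nome_periodic)
    have "W m1 m2 = nome (of_int (Q m n) * (\<i> * of_real y) / of_nat N)"
      unfolding W_def q using N_pos by (simp add: power2_eq_square field_simps)
    then have "W m1 m2 * nome (of_int (e' * a * m2\<^sup>2) / of_nat N)
        = nome (of_int (Q m n) * (\<i> * of_real y) / of_nat N + of_int (e' * Q m n) / of_nat N)"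
      unfolding nome_add n1 by (simp only:)
    also have "of_int (Q m n) * (\<i> * of_real y) / of_nat N + of_int (e' * Q m n) / of_nat N
        = of_int (Q m n) * ((\<i> * of_real y + of_int e') / of_nat N)"
      by (simp add: ring_distribs add_divide_distrib mult_ac)
    finally have "W m1 m2 * nome (of_int (e' * a * m2\<^sup>2) / of_nat N) = nome (of_int (Q m n) * ((\<i> * of_real y + of_int e') / of_nat N))" .
    then show "(case ?j x of (m, n) \<Rightarrow> W m n * (of_nat N * nome (of_int (e' * a * n\<^sup>2) / of_nat N) * G))
       = (case x of (m, n) \<Rightarrow> of_nat N * G * nome (of_int (Q m n) * ((\<i> * of_real y + of_int e') / of_nat N)))"
      unfolding x prod.case m2_def[symmetric] m1_def[symmetric] by (simp add: mult_ac)
  qed auto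
  also have "\<dots> = of_nat N * G * evq Theta ((\<i> * of_real y + of_int e') / of_nat N)"
  proof -
    have "evq Theta ((\<i> * of_real y + of_int e') / of_nat N) = (\<Sum>\<^sub>\<infinity>(m, n). nome (of_int (Q m n) * ((\<i> * of_real y + of_int e') / of_nat N)))"
      by (rule evq_Theta(1)) (use y N_pos in simp)
    then show ?thesis by (simp only: case_prod_unfold infsum_cmult_right')
  qed
  finally show "evq Theta ((- 1 / (\<i> * of_real y) + of_int e) / of_nat N) = kappa * gauss_sum (e * c) * (\<i> * of_real y) * evq Theta ((\<i> * of_real y + of_int e') / of_nat N)"
    unfolding C_def G_def using N_pos by simp
qed (use \<tau> in simp)

lemma theta_nth_0: "fps_nth theta 0 = 1"
proof -
  have "{x. nat (case x of (j, k) \<Rightarrow> Q j k) = 0} = {(0, 0)}"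
  proof -
    have "j = 0 \<and> k = 0" if "Q j k \<le> 0" for j k
    proof -
      have "j\<^sup>2 + k\<^sup>2 \<le> 0" using Q_ge[of j k] that by simp
      moreover have "0 \<le> j\<^sup>2" "0 \<le> k\<^sup>2" by simp_all
      ultimately have "j\<^sup>2 = 0" "k\<^sup>2 = 0" by linarith+
      then show ?thesis by simp
    qed
    moreover have "Q 0 0 = 0" by (simp add: Q_def)
    ultimately show ?thesis by auto
  qed
  then show ?thesis by (simp add: theta_def fibre_fps_def case_prod_unfold)
qed

text \<open>Two routes lead from \<open>w\<close> to the same point: \<open>Theta_gauss\<close> with
  \<open>e = 1\<close>, and Fricke involution, translation by \<open>-1\<close>, Fricke involution.
  Comparing them where the theta series does not vanish evaluates the Gauss sum, including its
  sign.\<close>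

lemma gauss_sum_c: "kappa * gauss_sum c = 1"
proof -
  have "\<exists>w. Im w > 0 \<and> evq Theta w \<noteq> 0"
  proof (rule ccontr)
    assume "\<not> ?thesis"
    then have "Theta = fps_const 0"
      by (intro disc_fps_eqI disc_Theta disc_fps_const) auto
    then have "fps_nth Theta 0 = 0" by simp
    then show False by (simp add: of_int_fps_def theta_nth_0)
  qed
  then obtain w where w: "Im w > 0" and nz: "evq Theta w \<noteq> 0" by blast
  \<comment> \<open>Chosen so that \<open>(\<tau> - 1) / N = w\<close>, which is the argument on the
    right of \<open>Theta_gauss\<close> for \<open>e = 1\<close> and
    \<open>e' = - 1\<close>.\<close>
  define \<tau> where "\<tau> = of_nat N * w + 1"
  have \<tau>: "Im \<tau> > 0" using w N_pos by (simp add: \<tau>_def)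
  then have \<tau>0: "\<tau> \<noteq> 0" by auto
  have w0: "w \<noteq> 0" using w by auto
  define u where "u = - 1 / (of_nat N * w) + of_int (- 1)"
  have Nw: "Im (of_nat N * w) > 0" using w N_pos by simp
  have u: "Im u > 0" unfolding u_def using Im_minus_inverse_pos[OF Nw] by simp
  have u': "u = - \<tau> / (of_nat N * w)" using N_pos w0 by (simp add: u_def \<tau>_def field_simps)
  have "kappa * gauss_sum (1 * c) * \<tau> * evq Theta ((\<tau> + of_int (- 1)) / of_nat N) = evq Theta ((- 1 / \<tau> + of_int 1) / of_nat N)"
    by (rule Theta_gauss[OF \<tau>, symmetric]) simp
  also have "(\<tau> + of_int (- 1)) / of_nat N = w" using N_pos by (simp add: \<tau>_def)
  also have "(- 1 / \<tau> + of_int 1) / of_nat N = - 1 / (of_nat N * u)"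
  proof -
    have "(- 1 / \<tau> + of_int 1) / of_nat N = (\<tau> - 1) / (of_nat N * \<tau>)" using \<tau>0 N_pos by (simp add: field_simps)
    also have "\<dots> = w / \<tau>" using N_pos by (simp add: \<tau>_def)
    also have "\<dots> = - 1 / (of_nat N * u)" unfolding u' using N_pos w0 \<tau>0 by (simp add: field_simps)
    finally show ?thesis .
  qed
  also have "evq Theta (- 1 / (of_nat N * u)) = of_nat N * kappa * u * evq Theta u"
    by (rule Theta_Fricke[OF u])
  also have "evq Theta u = evq Theta (- 1 / (of_nat N * w))" unfolding u_def nome_add_int ..
  also have "\<dots> = of_nat N * kappa * w * evq Theta w" by (rule Theta_Fricke[OF w])
  also have "of_nat N * kappa * u * (of_nat N * kappa * w * evq Theta w)
     = (kappa * kappa * of_nat N) * (of_nat N * w * u) * evq Theta w" by (simp add: mult_ac)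
  also have "\<dots> = \<tau> * evq Theta w" unfolding kappa_square u' using N_pos w0 by simp
  finally show ?thesis using \<tau>0 nz by simp
qed

lemma gauss_sum_square:
  assumes "[e = x\<^sup>2] (mod int N)" "\<not> int N dvd e"
  shows "gauss_sum (e * t) = gauss_sum t"
proof -
  have "\<not> int N dvd x"
    using assms by (metis cong_dvd_iff dvd_power_same dvd_power zero_less_numeral dvd_trans)
  then have cop: "coprime x (int N)" by (rule coprime_N)
  have "gauss_sum (e * t) = (\<Sum>s\<in>{0..<int N}. nome (of_int (t * (x * s + 0)\<^sup>2) / of_nat N))"
    unfolding gauss_sum_def
  proof (intro sum.cong refl nome_periodic)
    fix s
    have "[t * s\<^sup>2 * e = t * s\<^sup>2 * x\<^sup>2] (mod int N)" by (intro cong_mult cong_refl assms)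
    then show "[e * t * s\<^sup>2 = t * (x * s + 0)\<^sup>2] (mod int N)" by (simp add: power_mult_distrib mult_ac)
  qed
  also have "\<dots> = gauss_sum t"
    unfolding gauss_sum_def
  proof (rule sum_residues_shift[where f = "\<lambda>s. nome (of_int (t * s\<^sup>2) / of_nat N)", OF _ cop])
    show "nome (of_int (t * x\<^sup>2) / of_nat N) = nome (of_int (t * y\<^sup>2) / of_nat N)" if "[x = y] (mod int N)" for x y
      by (intro nome_periodic cong_mult cong_pow cong_refl that)
  qed
  finally show ?thesis .
qed

lemma eps_eq_1_square:
  assumes "eps e = 1"
  shows "\<exists>x. [e = x\<^sup>2] (mod int N)"
  using assms unfolding eps_def Legendre_def QuadRes_def by (auto split: if_splits intro: cong_sym)

lemma gauss_sum_minus: "gauss_sum (- x) = cnj (gauss_sum x)"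
proof -
  have "nome (of_int (- y) / of_nat N) = cnj (nome (of_int y / of_nat N))" for y
  proof -
    have H: "nome (of_int z / of_nat N) = cis (2 * pi * (of_int z / real N))" for z
      using nome_of_real[of "of_int z / real N"] by simp
    show ?thesis unfolding H by (simp add: cis_cnj)
  qed
  then show ?thesis by (simp add: gauss_sum_def del: of_int_minus)
qed

text \<open>Square factors are absorbed by a substitution. If \<open>e\<close> is not a square, then
  \<open>- e\<close> is one, the character being odd; conjugating the Gauss sum and the purely
  imaginary \<open>kappa\<close> yields the sign.\<close>

lemma gauss_sum_eps:
  assumes "\<not> int N dvd e"
  shows "kappa * gauss_sum (e * c) = of_int (eps e)"
proof -
  have kc: "cnj kappa = - kappa" by (simp add: kappa_def)
  from eps_cases[OF assms] show ?thesis
  proof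
    assume 1: "eps e = 1"
    then obtain x where "[e = x\<^sup>2] (mod int N)" using eps_eq_1_square by blast
    then show ?thesis using gauss_sum_square[OF _ assms] gauss_sum_c 1 by simp
  next
    assume m1: "eps e = - 1"
    then have "eps (- e) = 1" by (simp add: eps_minus)
    then obtain x where "[- e = x\<^sup>2] (mod int N)" using eps_eq_1_square by blast
    then have "gauss_sum (- e * - c) = gauss_sum (- c)"
      using gauss_sum_square[of "- e" x "- c"] assms by simp
    then have "kappa * gauss_sum (e * c) = - cnj (kappa * gauss_sum c)"
      by (simp add: gauss_sum_minus kc)
    then show ?thesis by (simp add: gauss_sum_c m1)
  qed
qed

text \<open>Inversion exchanges the infinite row with the row of \<open>\<tau> / N\<close>, by
  \<open>Theta_inversion\<close> and \<open>Theta_Fricke\<close>, and permutes the other rows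
  through \<open>e e' = - 1\<close> modulo \<open>N\<close>. There the Gauss sum supplies
  \<open>eps e\<close>, which is what turns \<open>eps C\<close> into \<open>eps D\<close>.\<close>

theorem modular_Theta: "modular 1 Theta"
proof (rule modularI[OF disc_Theta])
  fix C D :: int and \<tau> :: complex
  assume v: "valid C D" and \<tau>: "Im \<tau> > 0"
  consider "int N dvd C" "\<not> int N dvd D" | "\<not> int N dvd C" "int N dvd D" | "\<not> int N dvd C" "\<not> int N dvd D"
    using v by (auto simp: valid_def)
  then show "slash 1 Theta C D (- 1 / \<tau>) = \<tau> ^ 1 * slash 1 Theta D (- C) \<tau>"
  proof cases
    case 1
    have "[D * 0 = - C] (mod int N)" using 1 by (simp add: cong_iff_dvd_diff)
    from slash_fin[OF 1(2) this] show ?thesis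
      using 1 by (simp add: slash_inf Theta_inversion[OF \<tau>, simplified])
  next
    case 2
    have "[C * 0 = D] (mod int N)" using 2 by (simp add: cong_iff_dvd_diff)
    from slash_fin[OF 2(1) this, of 1 Theta "- 1 / \<tau>"]
    have "slash 1 Theta C D (- 1 / \<tau>) = kappa * of_int (eps C) * evq Theta (- 1 / (of_nat N * \<tau>))"
      by (simp add: mult.commute)
    also have "\<dots> = (kappa * kappa * of_nat N) * of_int (eps C) * \<tau> * evq Theta \<tau>"
      unfolding Theta_Fricke[OF \<tau>] by (simp add: mult_ac)
    finally show ?thesis unfolding kappa_square using 2 by (simp add: slash_inf eps_minus)
  next
    case 3
    obtain e where e: "[C * e = D] (mod int N)" using cong_solve_N[OF 3(1)] .
    obtain e' where e': "[D * e' = - C] (mod int N)" using cong_solve_N[OF 3(2)] .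
    have "[C * (e * e') = D * e'] (mod int N)" using cong_mult[OF e cong_refl[of e']] by (simp add: mult_ac)
    then have "[C * (e * e') = C * (- 1)] (mod int N)" using e' by (auto intro: cong_trans)
    then have ee: "[e * e' = - 1] (mod int N)" using coprime_N[OF 3(1)] by (simp only: cong_mult_lcancel)
    have ne: "\<not> int N dvd e"
    proof
      assume "int N dvd e"
      then have "int N dvd C * e" by simp
      then show False using e 3(2) by (simp add: cong_dvd_iff)
    qed
    have "eps D = eps C * eps e" using eps_cong[OF e] by (simp add: eps_mult)
    then show ?thesis
      unfolding slash_fin[OF 3(1) e] slash_fin[OF 3(2) e'] Theta_gauss[OF \<tau> ee] gauss_sum_eps[OF ne]
      by simp
  qed
qed

end

subsection \<open>Euler's pentagonal number theorem\<close>

definition pent_exp :: "int \<Rightarrow> nat" where "pent_exp n = nat (n * (3 * n - 1) div 2)"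

lemma even_pent: "even (n * (3 * n - 1 :: int))"
  by (cases "even n") auto

lemma pent_exp_double: "2 * int (pent_exp n) = n * (3 * n - 1)"
proof -
  have "n * (3 * n - 1) \<ge> 0"
    by (cases "n \<le> 0") (auto simp: zero_le_mult_iff)
  then show ?thesis using even_pent[of n] by (simp add: pent_exp_def)
qed

lemma pent_exp_ge: "int (pent_exp n) \<ge> n\<^sup>2"
proof -
  have "n \<le> n\<^sup>2" using power2_nonneg_ge_1_iff[of n] by (cases "n \<le> 0") (auto intro: order_trans[of _ 0] self_le_power)
  then have "2 * n\<^sup>2 \<le> n * (3 * n - 1)" by (simp add: power2_eq_square algebra_simps)
  then show ?thesis using pent_exp_double[of n] by simp
qed

definition pent :: "int fps" where
  "pent = fibre_fps pent_exp (\<lambda>n. if even n then 1 else - 1)"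

abbreviation Pent :: "complex fps" where "Pent \<equiv> of_int_fps pent"

lemma finite_pent_fibre: "finite {n. pent_exp n = m}"
proof (rule finite_subset)
  show "{n. pent_exp n = m} \<subseteq> {- int m..int m}"
  proof clarify
    fix n :: int
    have "\<bar>n\<bar> \<le> n\<^sup>2"
    proof (cases "n = 0")
      case False
      then have "\<bar>n\<bar> * 1 \<le> \<bar>n\<bar> * \<bar>n\<bar>" by (intro mult_left_mono) auto
      then show ?thesis by (simp add: power2_eq_square)
    qed simp
    then show "n \<in> {- int (pent_exp n)..int (pent_exp n)}" using pent_exp_ge[of n] by auto
  qed
qed simp

lemma summable_pent:
  assumes z: "norm (z :: complex) < 1"
  shows "(\<lambda>n. of_int (if even n then 1 else - 1) * z ^ pent_exp n) summable_on UNIV"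
proof -
  define s where "s = max (1 / 2) (norm z)"
  have s: "0 < s" "s < 1" "norm z \<le> s" using z by (auto simp: s_def)
  define t where "t = - ln s / pi"
  have "ln s < 0" using s by simp
  then have t: "t > 0" by (simp add: t_def divide_neg_pos)
  have st: "s = exp (- pi * t)" using s by (simp add: t_def)
  show ?thesis
  proof (rule summable_on_dominated[OF summable_on_gauss_real[OF t, of 0]])
    fix n :: int
    have "norm (of_int (if even n then 1 else - 1) * z ^ pent_exp n) = norm z ^ pent_exp n"
      by (simp add: norm_mult norm_power)
    also have "\<dots> \<le> s ^ pent_exp n"
      using s by (intro power_mono) auto
    also have "\<dots> \<le> s ^ nat (n\<^sup>2)"
      using s pent_exp_ge[of n] by (intro power_decreasing) auto
    also have "\<dots> = exp (- pi * t * (of_int n + 0)\<^sup>2)"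
      unfolding st by (simp add: exp_of_nat_mult[symmetric] mult_ac)
    finally show "norm (of_int (if even n then 1 else - 1) * z ^ pent_exp n) \<le> exp (- pi * t * (of_int n + 0)\<^sup>2)" .
  qed
qed

lemma disc_Pent: "disc_fps Pent"
  and eval_Pent: "norm z < 1 \<Longrightarrow> eval_fps Pent z = (\<Sum>\<^sub>\<infinity>n. of_int (if even n then 1 else - 1) * z ^ pent_exp n)"
  unfolding pent_def
  using disc_fibre_fps[where e = pent_exp and s = "\<lambda>n. if even n then 1 else - 1"] finite_pent_fibre summable_pent
  by blast+

text \<open>Shanks' finite form of Euler's theorem. Only \<open>P n\<close>, the term
  \<open>s = 0\<close>, survives on the left as \<open>n\<close> grows. The induction step adds the
  exponents \<open>n + 1\<close> and \<open>- (n + 1)\<close>: one is the end of a telescoping sum,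
  the other the new term \<open>s = n + 1\<close>.\<close>

lemma Shanks_identity:
  fixes q :: "'a::field"
  assumes nz: "\<And>i. 1 - q ^ Suc i \<noteq> 0"
  defines "P \<equiv> (\<lambda>n. \<Prod>i<n. 1 - q ^ Suc i)"
  shows "(\<Sum>s\<le>n. (-1) ^ s * (P n / P s) * q ^ (s * n + s * (s + 1) div 2))
    = (\<Sum>k\<in>{- int n..int n}. of_int (if even k then 1 else - 1) * q ^ pent_exp k)"
proof (induction n)
  case 0
  show ?case by (simp add: P_def pent_exp_def)
next
  case (Suc n)
  have P: "P s \<noteq> 0" for s unfolding P_def using nz by simp
  have PS: "P (Suc s) = P s * (1 - q ^ Suc s)" for s by (simp add: P_def)
  have P00: "P 0 = 1" by (simp add: P_def)
  define tri where "tri = (\<lambda>s::nat. s * (s + 1) div 2)"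
  have tri: "tri (Suc s) = tri s + Suc s" for s by (simp add: tri_def)
  \<comment> \<open>\<open>U\<close> is the telescoping certificate: passing from \<open>n\<close>
    to \<open>n + 1\<close> changes the \<open>s\<close>-th term by \<open>U (Suc s) - U s\<close>.
    The value \<open>0\<close> at \<open>s = 0\<close> makes this hold at the lower end.\<close>
  define U where "U = (\<lambda>s. if s = 0 then 0 else (-1) ^ s * (P n / P (s - 1)) * q ^ (tri (s - 1) + s * Suc n))"
  have diff: "(-1) ^ s * (P (Suc n) / P s) * q ^ (s * Suc n + tri s)
      - (-1) ^ s * (P n / P s) * q ^ (s * n + tri s) = U (Suc s) - U s" for s
  proof (cases s)
    case 0
    then show ?thesis using P[of n] nz[of 0] by (simp add: U_def PS P00 tri_def algebra_simps)
  next
    case (Suc r)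
    define A where "A = q ^ (tri r + r + r * n + n)"
    have 1: "q ^ (s * n + tri s) = A * q" unfolding A_def Suc tri by (simp add: algebra_simps power_add)
    have 2: "q ^ (s * Suc n + tri s) = A * q * (q ^ r * q)" unfolding A_def Suc tri by (simp add: algebra_simps power_add)
    have 3: "q ^ (tri (Suc s - 1) + Suc s * Suc n) = A * q * q ^ r * q * (q ^ n * q)"
      unfolding A_def Suc diff_Suc_1 tri by (simp add: algebra_simps power_add)
    have 4: "q ^ (tri (s - 1) + s * Suc n) = A * q" unfolding A_def Suc diff_Suc_1 by (simp add: algebra_simps power_add)
    have 5: "P s = P r * (1 - q ^ r * q)" "P (Suc r) = P r * (1 - q ^ r * q)" unfolding Suc PS by (simp_all add: mult.commute)
    have 6: "P (Suc n) = P n * (1 - q ^ n * q)" unfolding PS by (simp add: mult.commute)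
    have "1 - q ^ r * q \<noteq> 0" using nz[of r] by (simp add: mult.commute)
    then show ?thesis
      unfolding U_def 1 2 3 4 6 using P[of r]
      by (simp add: 5 Suc divide_simps) (simp add: algebra_simps)
  qed
  have "(\<Sum>s\<le>n. (-1) ^ s * (P (Suc n) / P s) * q ^ (s * Suc n + tri s))
      - (\<Sum>s\<le>n. (-1) ^ s * (P n / P s) * q ^ (s * n + tri s)) = (\<Sum>s\<le>n. U (Suc s) - U s)"
    unfolding sum_subtractf[symmetric] diff ..
  also have "\<dots> = U (Suc n) - U 0"
    using sum_lessThan_telescope[of U "Suc n"] by (simp only: lessThan_Suc_atMost)
  also have "\<dots> = U (Suc n)" by (simp add: U_def)
  finally have "(\<Sum>s\<le>n. (-1) ^ s * (P (Suc n) / P s) * q ^ (s * Suc n + tri s))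
    = (\<Sum>s\<le>n. (-1) ^ s * (P n / P s) * q ^ (s * n + tri s)) + U (Suc n)" by (simp add: algebra_simps)
  then have F: "(\<Sum>s\<le>n. (-1) ^ s * (P (Suc n) / P s) * q ^ (s * Suc n + tri s))
    = (\<Sum>k\<in>{- int n..int n}. of_int (if even k then 1 else - 1) * q ^ pent_exp k) + U (Suc n)"
    using Suc.IH by (simp only: tri_def)
  have cancel: "m = e" if "int (2 * m) = 2 * int e" for m e using that by simp
  have V2: "U (Suc n) = of_int (if even (int (Suc n)) then 1 else - 1) * q ^ pent_exp (int (Suc n))"
  proof -
    have "tri n + Suc n * Suc n = pent_exp (int (Suc n))"
      by (rule cancel, unfold pent_exp_double) (simp add: tri_def algebra_simps)
    then show ?thesis using P[of n] by (simp add: U_def uminus_power_if)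
  qed
  have V1: "(-1) ^ Suc n * (P (Suc n) / P (Suc n)) * q ^ (Suc n * Suc n + tri (Suc n))
     = of_int (if even (- int (Suc n)) then 1 else - 1) * q ^ pent_exp (- int (Suc n))"
  proof -
    have "Suc n * Suc n + tri (Suc n) = pent_exp (- int (Suc n))"
      by (rule cancel, unfold pent_exp_double) (simp add: tri_def algebra_simps)
    then show ?thesis using P[of "Suc n"] by (simp add: uminus_power_if)
  qed
  have ins: "{- int (Suc n)..int (Suc n)} = insert (- int (Suc n)) (insert (int (Suc n)) {- int n..int n})" by auto
  have nin: "- int (Suc n) \<notin> insert (int (Suc n)) {- int n..int n}" "int (Suc n) \<notin> {- int n..int n}" by auto
  have Sk: "(\<Sum>k\<in>{- int (Suc n)..int (Suc n)}. of_int (if even k then 1 else - 1) * q ^ pent_exp k)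
    = of_int (if even (- int (Suc n)) then 1 else - 1) * q ^ pent_exp (- int (Suc n))
      + (of_int (if even (int (Suc n)) then 1 else - 1) * q ^ pent_exp (int (Suc n))
         + (\<Sum>k\<in>{- int n..int n}. of_int (if even k then 1 else - 1) * q ^ pent_exp k))"
    unfolding ins by (subst sum.insert, simp, rule nin(1), subst sum.insert, simp, rule nin(2), rule refl)
  have tri': "s * (s + 1) div 2 = tri s" for s by (simp add: tri_def)
  show ?case
    unfolding tri' sum.atMost_Suc F V1 V2 Sk by (simp only: add_ac)
qed

text \<open>In \<open>Shanks_identity\<close> the terms with \<open>s > 0\<close> all contain
  \<open>q ^ n\<close>, and the quotients \<open>P n / P s\<close> stay bounded because the product
  converges to a nonzero limit. Hence the left side differs from \<open>P n\<close> by at most a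
  constant times \<open>n * norm q ^ n\<close>.\<close>

theorem pentagonal_number_theorem:
  fixes q :: complex
  assumes q: "norm q < 1"
  shows "eval_fps Pent q = (\<Prod>n. 1 - q ^ Suc n)" and "eval_fps Pent q \<noteq> 0"
proof -
  have nz: "1 - q ^ Suc i \<noteq> 0" for i
  proof
    assume "1 - q ^ Suc i = 0"
    then have "norm (q ^ Suc i) = 1" by simp
    moreover have "norm (q ^ Suc i) < 1" using q by (simp add: norm_power power_less_one_iff del: power_Suc)
    ultimately show False by simp
  qed
  have cp: "convergent_prod (\<lambda>n. 1 - q ^ Suc n)"
  proof (intro abs_convergent_prod_imp_convergent_prod summable_imp_abs_convergent_prod)
    have "summable (\<lambda>n. norm q * norm q ^ n)" using q by (intro summable_mult summable_geometric) simp
    then show "summable (\<lambda>i. norm (1 - q ^ Suc i - 1))" by (simp add: norm_mult norm_power)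
  qed
  define P where "P = (\<lambda>n. \<Prod>i<n. 1 - q ^ Suc i)"
  have P00: "P 0 = 1" by (simp add: P_def)
  define L where "L = (\<Prod>n. 1 - q ^ Suc n)"
  have L0: "L \<noteq> 0" unfolding L_def by (rule prodinf_nonzero[OF cp nz])
  have "(\<lambda>n. \<Prod>i\<le>n. 1 - q ^ Suc i) \<longlonglongrightarrow> L" unfolding L_def by (rule convergent_prod_LIMSEQ[OF cp])
  then have "(\<lambda>n. P (Suc n)) \<longlonglongrightarrow> L" by (simp add: P_def lessThan_Suc_atMost)
  then have P: "P \<longlonglongrightarrow> L" by (rule LIMSEQ_imp_Suc)
  have P0: "P n \<noteq> 0" for n unfolding P_def using nz by simp
  obtain B where B: "\<And>n. norm (P n) \<le> B" using convergent_imp_Bseq[of P] P by (auto simp: convergent_def Bseq_def)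
  have "(\<lambda>n. inverse (P n)) \<longlonglongrightarrow> inverse L" using P L0 by (rule tendsto_inverse)
  then obtain B' where B': "\<And>n. norm (inverse (P n)) \<le> B'" using convergent_imp_Bseq[of "\<lambda>n. inverse (P n)"] by (auto simp: convergent_def Bseq_def)
  have B0: "0 \<le> B" using order_trans[OF norm_ge_zero B[of 0]] .
  have BB: "norm (P n / P s) \<le> B * B'" for n s
    unfolding divide_inverse norm_mult using B[of n] B'[of s] B0 by (intro mult_mono) auto
  define F where "F = (\<lambda>n. \<Sum>s\<le>n. (-1) ^ s * (P n / P s) * q ^ (s * n + s * (s + 1) div 2))"
  have Fdiff: "norm (F n - P n) \<le> (B * B') * (real n * norm q ^ n)" for n
  proof -
    have "{..n} = insert 0 {1..n}" by auto
    then have "F n - P n = (\<Sum>s\<in>{1..n}. (-1) ^ s * (P n / P s) * q ^ (s * n + s * (s + 1) div 2))"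
      by (simp add: F_def P00)
    also have "norm \<dots> \<le> (\<Sum>s\<in>{1..n}. (B * B') * norm q ^ n)"
    proof (rule sum_norm_le)
      fix s assume s: "s \<in> {1..n}"
      have "1 * n \<le> s * n" using s by (intro mult_right_mono) auto
      then have "n \<le> s * n + s * (s + 1) div 2" by linarith
      then have "norm q ^ (s * n + s * (s + 1) div 2) \<le> norm q ^ n"
        by (rule power_decreasing) (use q in auto)
      then show "norm ((-1) ^ s * (P n / P s) * q ^ (s * n + s * (s + 1) div 2)) \<le> (B * B') * norm q ^ n"
        using BB[of n s] order_trans[OF norm_ge_zero BB[of n s]]
        unfolding norm_mult norm_power norm_minus_cancel norm_one power_one mult_1
        by (intro mult_mono) auto
    qed
    finally show ?thesis by (simp add: mult_ac)
  qed
  have "(\<lambda>n. (B * B') * (real n * norm q ^ n)) \<longlonglongrightarrow> (B * B') * 0"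
    using q by (intro tendsto_mult tendsto_const powser_times_n_limit_0) simp
  then have "(\<lambda>n. F n - P n) \<longlonglongrightarrow> 0"
    by (intro Lim_null_comparison[OF always_eventually[OF allI[OF Fdiff]]]) simp
  from tendsto_add[OF this P] have "F \<longlonglongrightarrow> L" by simp
  moreover have "F \<longlonglongrightarrow> eval_fps Pent q"
  proof -
    have "F = (\<lambda>n. \<Sum>k\<in>{- int n..int n}. of_int (if even k then 1 else - 1) * q ^ pent_exp k)"
      unfolding F_def P_def by (intro ext Shanks_identity nz)
    moreover have "((\<lambda>k. of_int (if even k then 1 else - 1) * q ^ pent_exp k) has_sum eval_fps Pent q) UNIV"
      unfolding eval_Pent[OF q] by (rule has_sum_infsum[OF summable_pent[OF q]])
    then have "(\<lambda>n. \<Sum>k\<in>{- int n..int n}. of_int (if even k then 1 else - 1) * q ^ pent_exp k) \<longlonglongrightarrow> eval_fps Pent q"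
      by (rule has_sum_int_imp_tendsto) auto
    ultimately show ?thesis by simp
  qed
  ultimately have "eval_fps Pent q = L" by (metis LIMSEQ_unique)
  with L0 show "eval_fps Pent q = (\<Prod>n. 1 - q ^ Suc n)" "eval_fps Pent q \<noteq> 0" by (simp_all add: L_def)
qed

subsection \<open>The discriminant\<close>

lemma infsum_int_mod:
  fixes f :: "int \<Rightarrow> complex" and m :: int
  assumes f: "f summable_on UNIV" and m: "m > 0"
  shows "infsum f UNIV = (\<Sum>r\<in>{0..<m}. \<Sum>\<^sub>\<infinity>l. f (m * l + r))"
    and "(\<lambda>l. f (m * l + r)) summable_on UNIV"
proof -
  define g where "g = (\<lambda>(r, l). m * l + r)"
  have bij: "bij_betw g (SIGMA r:{0..<m}. UNIV) UNIV"
  proof (rule bij_betwI[where g = "\<lambda>x. (x mod m, x div m)"])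
    show "(\<lambda>x. (x mod m, x div m)) \<in> UNIV \<rightarrow> (SIGMA r:{0..<m}. UNIV)" using m by auto
  qed (use m in \<open>auto simp: g_def\<close>)
  have "infsum f UNIV = infsum (\<lambda>x. f (g x)) (SIGMA r:{0..<m}. UNIV)"
    by (rule infsum_reindex_bij_betw[OF bij, symmetric])
  also have "\<dots> = infsum (\<lambda>r. infsum (\<lambda>l. f (g (r, l))) UNIV) {0..<m}"
    by (rule infsum_Sigma_banach[symmetric]) (simp add: summable_on_reindex_bij_betw[OF bij] f)
  finally show "infsum f UNIV = (\<Sum>r\<in>{0..<m}. \<Sum>\<^sub>\<infinity>l. f (m * l + r))" by (simp add: g_def)
  have "f summable_on (range (\<lambda>l. m * l + r))" by (rule summable_on_subset_banach[OF f]) simp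
  then show "(\<lambda>l. f (m * l + r)) summable_on UNIV"
    using m by (subst (asm) summable_on_reindex) (auto simp: inj_on_def o_def)
qed

definition eta_im :: "real \<Rightarrow> complex" where
  "eta_im y = of_real (exp (- 2 * pi * y / 24)) * evq Pent (\<i> * of_real y)"

lemma cis_half_pi_odd: "cis (pi * of_int n) = (if even n then 1 else - 1)"
proof (cases "even n")
  case True
  then obtain m where "n = 2 * m" by blast
  then show ?thesis using cis_multiple_2pi[of "of_int m"] by (simp add: mult_ac)
next
  case False
  then obtain m where m: "n = 2 * m + 1" by (elim oddE)
  have "pi * of_int n = 2 * pi * of_int m + pi" by (simp add: m algebra_simps)
  then have "cis (pi * of_int n) = cis (2 * pi * of_int m) * cis pi" by (simp only: cis_mult)
  also have "cis (2 * pi * of_int m) = 1" by (rule cis_multiple_2pi) simp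
  finally show ?thesis using False by simp
qed

text \<open>Because \<open>n (3 n - 1) / 2 + 1 / 24 = 3 (n - 1 / 6)^2 / 2\<close>, the pentagonal
  series with its factor \<open>q^(1/24)\<close> is a shifted Gaussian sum; the sign is the phase at
  \<open>1 / 2\<close>.\<close>

lemma eta_im_sum:
  assumes y: "y > 0"
  shows "((\<lambda>n::int. of_real (exp (- pi * (3 * y) * (of_int n + (- 1 / 6))\<^sup>2)) * cis (2 * pi * of_int n * (1 / 2))) has_sum eta_im y) UNIV"
proof -
  have q: "norm (nome (\<i> * of_real y)) < 1" by (rule norm_nome_less_1) (use y in simp)
  have "((\<lambda>n. of_real (exp (- 2 * pi * y / 24)) * (of_int (if even n then 1 else - 1) * nome (\<i> * of_real y) ^ pent_exp n)) has_sum eta_im y) UNIV"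
    unfolding eta_im_def eval_Pent[OF q] by (intro has_sum_cmult_right has_sum_infsum summable_pent q)
  also have "(\<lambda>n. of_real (exp (- 2 * pi * y / 24)) * (of_int (if even n then 1 else - 1) * nome (\<i> * of_real y) ^ pent_exp n))
    = (\<lambda>n::int. of_real (exp (- pi * (3 * y) * (of_int n + (- 1 / 6))\<^sup>2)) * cis (2 * pi * of_int n * (1 / 2)))"
  proof
    fix n :: int
    have "2 * real (pent_exp n) = of_int (n * (3 * n - 1))" using pent_exp_double[of n] by (metis of_int_eq_iff of_int_mult of_int_numeral of_int_of_nat_eq)
    then have pe: "real (pent_exp n) = of_int n * (3 * of_int n - 1) / 2" by simp
    have "exp (- 2 * pi * y / 24) * exp (- 2 * pi * y) ^ pent_exp n = exp (- 2 * pi * y / 24 + real (pent_exp n) * (- 2 * pi * y))"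
      by (simp only: exp_add exp_of_nat_mult)
    also have "- 2 * pi * y / 24 + real (pent_exp n) * (- 2 * pi * y) = - pi * (3 * y) * (of_int n + (- 1 / 6))\<^sup>2"
      unfolding pe by (simp add: power2_eq_square field_simps)
    finally have h1: "of_real (exp (- 2 * pi * y / 24)) * nome (\<i> * of_real y) ^ pent_exp n = complex_of_real (exp (- pi * (3 * y) * (of_int n + (- 1 / 6))\<^sup>2))"
      unfolding nome_imaginary of_real_power[symmetric] of_real_mult[symmetric] by (simp only:)
    have h2: "cis (2 * pi * of_int n * (1 / 2)) = of_int (if even n then 1 else - 1)"
      using cis_half_pi_odd[of n] by simp
    show "of_real (exp (- 2 * pi * y / 24)) * (of_int (if even n then 1 else - 1) * nome (\<i> * of_real y) ^ pent_exp n)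
      = of_real (exp (- pi * (3 * y) * (of_int n + (- 1 / 6))\<^sup>2)) * cis (2 * pi * of_int n * (1 / 2))"
      unfolding h1[symmetric] h2 by (simp only: mult_ac)
  qed
  finally show ?thesis .
qed

text \<open>Poisson summation gives a series that is sorted by its index modulo 3. The classes 0 and
  1 reproduce eta at \<open>1 / y\<close> with phases of angle \<open>pi / 6\<close> and
  \<open>- pi / 6\<close>, whose sum \<open>sqrt 3\<close> cancels against the factor
  \<open>1 / sqrt (3 y)\<close>. The class 2 is antisymmetric under \<open>l\<close> to
  \<open>- 1 - l\<close> and cancels.\<close>

lemma eta_im_inversion:
  assumes y: "y > 0"
  shows "eta_im y = of_real (1 / sqrt y) * eta_im (1 / y)"
proof -
  define T where "T = (\<lambda>k::int. complex_of_real (exp (- pi * (of_int k - 1 / 2)\<^sup>2 / (3 * y))) * cis (2 * pi * (of_int k - 1 / 2) * (- 1 / 6)))"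
  define E where "E = (\<lambda>n::int. complex_of_real (exp (- pi * (3 * (1 / y)) * (of_int n + (- 1 / 6))\<^sup>2)) * cis (2 * pi * of_int n * (1 / 2)))"
  have hsE: "(E has_sum eta_im (1 / y)) UNIV" unfolding E_def by (rule eta_im_sum) (use y in simp)
  have Tsum: "T summable_on UNIV"
  proof -
    have "(\<lambda>n::int. of_real (exp (- pi * (1 / (3 * y)) * (of_int n + (- 1 / 2))\<^sup>2)) * cis (2 * pi * (of_int n + (- 1 / 2)) * (- 1 / 6))) summable_on UNIV"
      by (rule has_sum_imp_summable[OF has_sum_gauss]) (use y in simp)
    then show ?thesis by (simp add: T_def)
  qed
  have "eta_im y = (\<Sum>\<^sub>\<infinity>n::int. of_real (exp (- pi * (3 * y) * (of_int n + (- 1 / 6))\<^sup>2)) * cis (2 * pi * of_int n * (1 / 2)))"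
    using infsumI[OF eta_im_sum[OF y]] by simp
  also have "\<dots> = of_real (1 / sqrt (3 * y)) * infsum T UNIV"
    unfolding T_def by (rule Poisson_Gaussian) (use y in simp)
  also have "infsum T UNIV = (\<Sum>r\<in>{0, 1, 2}. \<Sum>\<^sub>\<infinity>l. T (3 * l + r))"
    unfolding infsum_int_mod(1)[OF Tsum, of 3, simplified] by (rule sum.cong) auto
  also have "\<dots> = (\<Sum>\<^sub>\<infinity>l. T (3 * l)) + (\<Sum>\<^sub>\<infinity>l. T (3 * l + 1)) + (\<Sum>\<^sub>\<infinity>l. T (3 * l + 2))" by simp
  also have "(\<Sum>\<^sub>\<infinity>l. T (3 * l)) = cis (pi / 6) * eta_im (1 / y)"
  proof -
    have "T (3 * l) = cis (pi / 6) * E l" for l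
    proof -
      have "cis (2 * pi * (of_int (3 * l) - 1 / 2) * (- 1 / 6)) = cis (pi / 6) * cis (- (pi * of_int l))"
      proof -
        have "2 * pi * (of_int (3 * l) - 1 / 2) * (- 1 / 6) = pi / 6 + - (pi * of_int l)" by (simp add: field_simps)
        then show ?thesis by (simp only: cis_mult)
      qed
      also have "cis (- (pi * of_int l)) = cis (2 * pi * of_int l * (1 / 2))"
        using cis_half_pi_odd[of l] cis_half_pi_odd[of "- l"] by simp
      finally have "cis (2 * pi * (of_int (3 * l) - 1 / 2) * (- 1 / 6)) = cis (pi / 6) * cis (2 * pi * of_int l * (1 / 2))" .
      moreover have "- pi * (of_int (3 * l) - 1 / 2)\<^sup>2 / (3 * y) = - pi * (3 * (1 / y)) * (of_int l + (- 1 / 6))\<^sup>2"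
        using y by (simp add: power2_eq_square field_simps)
      ultimately show ?thesis by (simp only: T_def E_def mult_ac)
    qed
    then show ?thesis using infsumI[OF has_sum_cmult_right[OF hsE, of "cis (pi / 6)"]] by simp
  qed
  also have "(\<Sum>\<^sub>\<infinity>l. T (3 * l + 1)) = cis (- pi / 6) * eta_im (1 / y)"
  proof -
    have "T (3 * l + 1) = cis (- pi / 6) * E (- l)" for l
    proof -
      have "cis (2 * pi * (of_int (3 * l + 1) - 1 / 2) * (- 1 / 6)) = cis (- pi / 6) * cis (- (pi * of_int l))"
      proof -
        have "2 * pi * (of_int (3 * l + 1) - 1 / 2) * (- 1 / 6) = - pi / 6 + - (pi * of_int l)" by (simp add: field_simps)
        then show ?thesis by (simp only: cis_mult)
      qed
      also have "cis (- (pi * of_int l)) = cis (2 * pi * of_int (- l) * (1 / 2))" by simp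
      finally have "cis (2 * pi * (of_int (3 * l + 1) - 1 / 2) * (- 1 / 6)) = cis (- pi / 6) * cis (2 * pi * of_int (- l) * (1 / 2))" .
      moreover have "- pi * (of_int (3 * l + 1) - 1 / 2)\<^sup>2 / (3 * y) = - pi * (3 * (1 / y)) * (of_int (- l) + (- 1 / 6))\<^sup>2"
        using y by (simp add: power2_eq_square field_simps)
      ultimately show ?thesis by (simp only: T_def E_def mult_ac)
    qed
    moreover have "bij (uminus :: int \<Rightarrow> int)" by (rule bij_uminus)
    then have "(\<Sum>\<^sub>\<infinity>l. E (- l)) = eta_im (1 / y)"
      using infsum_reindex_bij_betw[of uminus UNIV UNIV E] infsumI[OF hsE] by simp
    ultimately show ?thesis by (simp add: infsum_cmult_right')
  qed
  also have "(\<Sum>\<^sub>\<infinity>l. T (3 * l + 2)) = 0"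
  proof -
    have "T (3 * (- 1 - l) + 2) = - T (3 * l + 2)" for l
    proof -
      have "- pi * (of_int (3 * (- 1 - l) + 2) - 1 / 2)\<^sup>2 / (3 * y) = - pi * (of_int (3 * l + 2) - 1 / 2)\<^sup>2 / (3 * y)"
        by (simp add: power2_eq_square algebra_simps)
      moreover have "cis (2 * pi * (of_int (3 * (- 1 - l) + 2) - 1 / 2) * (- 1 / 6)) = - cis (2 * pi * (of_int (3 * l + 2) - 1 / 2) * (- 1 / 6))"
      proof -
        have "cis (2 * pi * (of_int (3 * (- 1 - l) + 2) - 1 / 2) * (- 1 / 6)) = cis (2 * pi * (of_int (3 * l + 2) - 1 / 2) * (- 1 / 6)) * cis (pi * of_int (2 * l + 1))"
        proof -
          have "2 * pi * (of_int (3 * (- 1 - l) + 2) - 1 / 2) * (- 1 / 6) = 2 * pi * (of_int (3 * l + 2) - 1 / 2) * (- 1 / 6) + pi * of_int (2 * l + 1)"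
            by (simp add: field_simps)
          then show ?thesis by (simp only: cis_mult)
        qed
        then show ?thesis unfolding cis_half_pi_odd by simp
      qed
      ultimately show ?thesis by (simp only: T_def mult_minus_right)
    qed
    moreover have "bij (\<lambda>l::int. - 1 - l)" by (rule bij_betwI[where g = "\<lambda>l. - 1 - l"]) auto
    then have "(\<Sum>\<^sub>\<infinity>l. T (3 * (- 1 - l) + 2)) = (\<Sum>\<^sub>\<infinity>l. T (3 * l + 2))"
      using infsum_reindex_bij_betw[of "\<lambda>l. - 1 - l" UNIV UNIV "\<lambda>l. T (3 * l + 2)"] by simp
    ultimately show ?thesis by (simp add: infsum_uminus)
  qed
  also have "of_real (1 / sqrt (3 * y)) * (cis (pi / 6) * eta_im (1 / y) + cis (- pi / 6) * eta_im (1 / y) + 0)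
     = of_real (1 / sqrt y) * eta_im (1 / y)"
  proof -
    have "cis (pi / 6) + cis (- pi / 6) = of_real (sqrt 3)"
      by (simp add: complex_eq_iff cos_30)
    moreover have "1 / sqrt (3 * y) * sqrt 3 = 1 / sqrt y" by (simp add: real_sqrt_mult)
    then have "of_real (1 / sqrt (3 * y)) * complex_of_real (sqrt 3) = of_real (1 / sqrt y)" by (simp only: of_real_mult[symmetric])
    ultimately show ?thesis by (simp add: distrib_right[symmetric] mult.assoc[symmetric])
  qed
  finally show ?thesis .
qed

definition delta :: "int fps" where "delta = fps_X * pent ^ 24"

lemma of_int_fps_mult [simp]: "of_int_fps (a * b) = of_int_fps a * of_int_fps b"
  by (simp add: of_int_fps_def fps_eq_iff fps_mult_nth)

lemma of_int_fps_add [simp]: "of_int_fps (a + b) = of_int_fps a + of_int_fps b"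
  by (simp add: of_int_fps_def fps_eq_iff)

lemma of_int_fps_diff [simp]: "of_int_fps (a - b) = of_int_fps a - of_int_fps b"
  by (simp add: of_int_fps_def fps_eq_iff)

lemma of_int_fps_const [simp]: "of_int_fps (fps_const x) = fps_const (of_int x)"
  by (simp add: of_int_fps_def fps_eq_iff)

lemma of_int_fps_1 [simp]: "of_int_fps 1 = 1"
  by (simp add: of_int_fps_def fps_eq_iff)

lemma of_int_fps_X [simp]: "of_int_fps fps_X = fps_X"
  by (simp add: of_int_fps_def fps_eq_iff)

lemma of_int_fps_power [simp]: "of_int_fps (a ^ n) = of_int_fps a ^ n"
  by (induction n) simp_all

lemma of_int_fps_eq_iff [simp]: "of_int_fps a = of_int_fps b \<longleftrightarrow> a = b"
  by (simp add: of_int_fps_def fps_eq_iff)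

abbreviation Delta :: "complex fps" where "Delta \<equiv> of_int_fps delta"

lemma Delta_eq: "Delta = fps_X * Pent ^ 24"
  by (simp add: delta_def)

lemma disc_Delta: "disc_fps Delta"
  unfolding Delta_eq by (intro disc_fps_mult disc_fps_power disc_fps_X disc_Pent)

lemma evq_Delta:
  assumes "Im \<tau> > 0"
  shows "evq Delta \<tau> = nome \<tau> * evq Pent \<tau> ^ 24"
  unfolding Delta_eq using norm_nome_less_1[OF assms]
  by (simp add: eval_disc_mult eval_disc_power disc_fps_power disc_Pent)

lemma Delta_inversion:
  assumes "Im \<tau> > 0"
  shows "evq Delta (- 1 / \<tau>) = \<tau> ^ 12 * evq Delta \<tau>"
proof (rule upper_half_plane_identity[where f = "\<lambda>\<tau>. evq Delta (- 1 / \<tau>)" and g = "\<lambda>\<tau>. \<tau> ^ 12 * evq Delta \<tau>"])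
  show "(\<lambda>\<tau>. evq Delta (- 1 / \<tau>)) holomorphic_on {\<tau>. 0 < Im \<tau>}"
    by (intro holomorphic_on_evq disc_Delta holomorphic_intros Im_minus_inverse_pos) auto
  show "(\<lambda>\<tau>. \<tau> ^ 12 * evq Delta \<tau>) holomorphic_on {\<tau>. 0 < Im \<tau>}"
    by (intro holomorphic_intros holomorphic_on_evq disc_Delta) auto
  fix y :: real assume y: "y > 0"
  have D: "evq Delta (\<i> * of_real y) = eta_im y ^ 24" if "y > 0" for y
  proof -
    have "exp (- 2 * pi * y / 24) ^ 24 = exp (- 2 * pi * y)" by (simp flip: exp_of_nat_mult)
    then show ?thesis
      using that by (subst evq_Delta) (simp_all add: eta_im_def power_mult_distrib nome_imaginary flip: of_real_power)
  qed
  have "of_real (sqrt y) * eta_im y = (of_real (sqrt y) * of_real (1 / sqrt y)) * eta_im (1 / y)"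
    by (subst eta_im_inversion[OF y]) (simp only: mult.assoc)
  moreover have "of_real (sqrt y) * complex_of_real (1 / sqrt y) = 1" using y by (simp flip: of_real_mult)
  ultimately have "eta_im (1 / y) = of_real (sqrt y) * eta_im y" by simp
  then have "eta_im (1 / y) ^ 24 = of_real ((sqrt y)\<^sup>2 ^ 12) * eta_im y ^ 24"
    by (simp add: power_mult_distrib flip: power_mult)
  then have "eta_im (1 / y) ^ 24 = (\<i> * of_real y) ^ 12 * eta_im y ^ 24"
    using y by (simp add: power_mult_distrib)
  moreover have "- 1 / (\<i> * of_real y) = \<i> * of_real (1 / y)" using y by (simp add: field_simps)
  ultimately show "evq Delta (- 1 / (\<i> * of_real y)) = (\<i> * of_real y) ^ 12 * evq Delta (\<i> * of_real y)"
    using D[of y] D[of "1 / y"] y by simp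
qed (use assms in simp)

lemma Delta_SL2:
  assumes "a * d - b * c = 1" "Im \<tau> > 0"
  shows "evq Delta ((of_int a * \<tau> + of_int b) / (of_int c * \<tau> + of_int d)) = (of_int c * \<tau> + of_int d) ^ 12 * evq Delta \<tau>"
  using SL2_action[where N = 0 and x = 0 and y = 1 and \<Phi> = "\<lambda>_ _ \<tau>. evq Delta \<tau>" and k = 12, OF _ _ assms(1) _ assms(2)]
  by (simp add: Delta_inversion[simplified])

subsection \<open>Power series congruences\<close>

definition fps_cong :: "nat \<Rightarrow> int fps \<Rightarrow> int fps \<Rightarrow> bool" where
  "fps_cong p a b \<longleftrightarrow> (\<forall>n. [fps_nth a n = fps_nth b n] (mod int p))"

lemma fps_cong_refl [simp, intro]: "fps_cong p a a"
  by (simp add: fps_cong_def)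

lemma fps_cong_sym: "fps_cong p a b \<Longrightarrow> fps_cong p b a"
  by (simp add: fps_cong_def cong_sym)

lemma fps_cong_trans [trans]: "fps_cong p a b \<Longrightarrow> fps_cong p b c \<Longrightarrow> fps_cong p a c"
  unfolding fps_cong_def by (blast intro: cong_trans)

lemma fps_cong_add: "fps_cong p a b \<Longrightarrow> fps_cong p c d \<Longrightarrow> fps_cong p (a + c) (b + d)"
  by (simp add: fps_cong_def cong_add)

lemma fps_cong_mult: "fps_cong p a b \<Longrightarrow> fps_cong p c d \<Longrightarrow> fps_cong p (a * c) (b * d)"
  by (auto simp: fps_cong_def fps_mult_nth intro!: cong_sum cong_mult)

lemma fps_cong_power: "fps_cong p a b \<Longrightarrow> fps_cong p (a ^ n) (b ^ n)"
  by (induction n) (auto intro: fps_cong_mult)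

definition dilate :: "nat \<Rightarrow> 'a::zero fps \<Rightarrow> 'a fps" where
  "dilate p a = Abs_fps (\<lambda>n. if p dvd n then fps_nth a (n div p) else 0)"

lemma power_nth_prefix:
  fixes a b :: "'a::comm_ring_1 fps"
  assumes "\<And>m. m \<le> n \<Longrightarrow> fps_nth a m = fps_nth b m" "m \<le> n"
  shows "fps_nth (a ^ k) m = fps_nth (b ^ k) m"
  using assms(2)
proof (induction k arbitrary: m)
  case (Suc k)
  then show ?case by (auto simp: fps_mult_nth assms(1) intro!: sum.cong)
qed simp

lemma freshman_dream:
  assumes "prime p"
  shows "fps_cong p ((a + b) ^ p) (a ^ p + b ^ p)"
proof -
  have p0: "p > 0" using assms by (simp add: prime_gt_0_nat)
  have "(a + b) ^ p = (\<Sum>k\<le>p. of_nat (p choose k) * a ^ k * b ^ (p - k))"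
    by (rule binomial_ring)
  also have "{..p} = insert 0 (insert p {1..<p})" using p0 by auto
  also have "(\<Sum>k\<in>\<dots>. of_nat (p choose k) * a ^ k * b ^ (p - k))
     = (a ^ p + b ^ p) + (\<Sum>k\<in>{1..<p}. of_nat (p choose k) * a ^ k * b ^ (p - k))"
    using p0 by (simp add: add_ac)
  finally have eq: "(a + b) ^ p = (a ^ p + b ^ p) + (\<Sum>k\<in>{1..<p}. of_nat (p choose k) * a ^ k * b ^ (p - k))" .
  have "[fps_nth (\<Sum>k\<in>{1..<p}. of_nat (p choose k) * a ^ k * b ^ (p - k)) n = 0] (mod int p)" for n
  proof -
    have "fps_nth (of_nat (p choose k) * a ^ k * b ^ (p - k)) n = int (p choose k) * fps_nth (a ^ k * b ^ (p - k)) n" for k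
      by (simp add: mult.assoc fps_of_nat[symmetric])
    moreover have "p dvd (p choose k)" if "k \<in> {1..<p}" for k
    proof -
      have "p dvd k * (p choose k)" using that by (simp add: times_binomial_minus1_eq)
      moreover have "\<not> p dvd k" using that by (auto dest: dvd_imp_le)
      ultimately show ?thesis using assms by (simp add: prime_dvd_mult_iff)
    qed
    ultimately have "int p dvd fps_nth (of_nat (p choose k) * a ^ k * b ^ (p - k)) n" if "k \<in> {1..<p}" for k
      using that by (metis dvd_mult2 int_dvd_int_iff)
    then show ?thesis unfolding cong_0_iff fps_sum_nth by (rule dvd_sum)
  qed
  then show ?thesis unfolding eq fps_cong_def
    by (metis (no_types, lifting) add.right_neutral cong_add cong_refl fps_add_nth)
qed

lemma fermat_int:
  assumes "prime p"
  shows "[(x::int) ^ p = x] (mod int p)"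
proof (cases "int p dvd x")
  case True
  then show ?thesis using assms prime_gt_0_nat[OF assms]
    by (metis cong_0_iff cong_sym cong_trans dvd_power dvd_trans)
next
  case False
  define a where "a = nat (x mod int p)"
  have p0: "p > 0" using assms by (simp add: prime_gt_0_nat)
  have a: "int a = x mod int p" using p0 by (simp add: a_def)
  have ax: "[int a = x] (mod int p)" by (simp add: a cong_def)
  then have "\<not> p dvd a" using False by (metis cong_dvd_iff int_dvd_int_iff)
  then have "[a ^ (p - 1) = 1] (mod p)" by (rule fermat_theorem[OF assms])
  then have "[int (a ^ (p - 1)) = int 1] (mod int p)" by (simp only: cong_int_iff)
  then have "[int a ^ (p - 1) * int a = 1 * int a] (mod int p)" by (intro cong_mult) auto
  then have "[int a ^ p = int a] (mod int p)" using p0 by (cases p) (simp_all add: mult.commute)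
  then show ?thesis using cong_pow[OF ax, of p] ax by (metis cong_sym cong_trans)
qed

text \<open>\<open>dilate p a\<close> is \<open>a(q^p)\<close>, so this is Frobenius: the freshman's
  dream together with Fermat's theorem for the coefficients. It is proved for polynomials and
  transferred by truncation, since the \<open>n\<close>-th coefficient of a power depends only on
  the first \<open>n + 1\<close> coefficients.\<close>

lemma fps_cong_dilate:
  assumes p: "prime p"
  shows "fps_cong p (a ^ p) (dilate p a)"
proof -
  have p0: "p > 0" using p by (simp add: prime_gt_0_nat)
  have poly: "fps_cong p ((\<Sum>i\<in>I. fps_const (fps_nth a i) * fps_X ^ i) ^ p) (\<Sum>i\<in>I. fps_const (fps_nth a i) * fps_X ^ (p * i))"
    if "finite I" for I
    using that
  proof (induction I rule: finite_induct)
    case empty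
    then show ?case using p0 by (simp add: zero_power)
  next
    case (insert i I)
    have "fps_cong p ((fps_const (fps_nth a i) * fps_X ^ i) ^ p) (fps_const (fps_nth a i) * fps_X ^ (p * i))"
    proof -
      have "fps_cong p (fps_const (fps_nth a i ^ p)) (fps_const (fps_nth a i))"
        using fermat_int[OF p] by (auto simp: fps_cong_def)
      then have "fps_cong p (fps_const (fps_nth a i ^ p) * fps_X ^ (p * i)) (fps_const (fps_nth a i) * fps_X ^ (p * i))"
        by (rule fps_cong_mult) simp
      then show ?thesis by (simp add: power_mult_distrib fps_const_power mult.commute flip: power_mult)
    qed
    then show ?case using insert
      by (auto intro: fps_cong_trans[OF freshman_dream[OF p]] fps_cong_add)
  qed
  show ?thesis unfolding fps_cong_def
  proof
    fix n
    define b where "b = (\<Sum>i\<in>{..n}. fps_const (fps_nth a i) * fps_X ^ i)"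
    have "fps_nth b m = fps_nth a m" if "m \<le> n" for m
      using that by (simp add: b_def fps_sum_nth fps_X_power_nth if_distrib cong: if_cong)
    then have "fps_nth (a ^ p) n = fps_nth (b ^ p) n" by (intro power_nth_prefix[where n = n]) auto
    also have "[fps_nth (b ^ p) n = fps_nth (\<Sum>i\<in>{..n}. fps_const (fps_nth a i) * fps_X ^ (p * i)) n] (mod int p)"
      using poly[of "{..n}"] by (simp add: fps_cong_def b_def)
    also have "fps_nth (\<Sum>i\<in>{..n}. fps_const (fps_nth a i) * fps_X ^ (p * i)) n = fps_nth (dilate p a) n"
    proof (cases "p dvd n")
      case True
      then obtain m where m: "n = p * m" by blast
      then have "(\<Sum>i\<in>{..n}. if n = p * i then fps_nth a i else 0) = (\<Sum>i\<in>{m}. if n = p * i then fps_nth a i else 0)"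
        using p0 by (intro sum.mono_neutral_right) auto
      then show ?thesis using m p0 by (simp add: fps_sum_nth fps_X_power_nth dilate_def if_distrib cong: if_cong)
    next
      case False
      then have "n \<noteq> p * i" for i by auto
      then show ?thesis using False by (simp add: fps_sum_nth fps_X_power_nth dilate_def)
    qed
    finally show "[fps_nth (a ^ p) n = fps_nth (dilate p a) n] (mod int p)" .
  qed
qed

text \<open>As \<open>t\<close> begins with the first power and coefficient 1, the coefficients of
  \<open>a oo t\<close> are obtained from those of \<open>a\<close> by a triangular matrix with ones
  on the diagonal.\<close>

lemma compose_cong_cancel:
  assumes t: "fps_nth t 0 = 0" "fps_nth t 1 = 1" and c: "fps_cong p (a oo t) (b oo t)"
  shows "fps_cong p a b"
  unfolding fps_cong_def
proof
  fix n
  show "[fps_nth a n = fps_nth b n] (mod int p)"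
  proof (induction n rule: less_induct)
    case (less n)
    have tn: "fps_nth (t ^ n) n = 1" using startsby_zero_power_nth_same[OF t(1), of n] t(2) by simp
    have split: "{0..n} = insert n {0..<n}" by auto
    have S: "[(\<Sum>i\<in>{0..<n}. fps_nth a i * fps_nth (t ^ i) n) = (\<Sum>i\<in>{0..<n}. fps_nth b i * fps_nth (t ^ i) n)] (mod int p)"
      by (intro cong_sum cong_mult less.IH) auto
    have "[fps_nth a n + (\<Sum>i\<in>{0..<n}. fps_nth a i * fps_nth (t ^ i) n) = fps_nth b n + (\<Sum>i\<in>{0..<n}. fps_nth b i * fps_nth (t ^ i) n)] (mod int p)"
    proof -
      have "fps_nth (x oo t) n = fps_nth x n + (\<Sum>i\<in>{0..<n}. fps_nth x i * fps_nth (t ^ i) n)" for x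
        unfolding fps_compose_nth split using tn by simp
      then show ?thesis using c by (metis fps_cong_def)
    qed
    from cong_diff[OF this S] show ?case by simp
  qed
qed

lemma lucas_congruencesI:
  assumes p: "p > 0" and T0: "T 0 = 1"
    and step: "\<And>m n. m < p \<Longrightarrow> [T (m + p * n) = T m * T n] (mod int p)"
  shows "lucas_congruences T p"
proof -
  have "[T (\<Sum>i\<le>s. d i * p ^ i) = (\<Prod>i\<le>s. T (d i))] (mod int p)" if "\<And>i. i \<le> s \<Longrightarrow> d i < p" for s d
    using that
  proof (induction s arbitrary: d)
    case (Suc s)
    have "(\<Sum>i\<le>Suc s. d i * p ^ i) = d 0 + p * (\<Sum>i\<le>s. d (Suc i) * p ^ i)"
      by (simp add: sum.atMost_Suc_shift sum_distrib_left mult_ac del: sum.atMost_Suc)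
    then have "[T (\<Sum>i\<le>Suc s. d i * p ^ i) = T (d 0) * T (\<Sum>i\<le>s. d (Suc i) * p ^ i)] (mod int p)"
      using step[of "d 0" "\<Sum>i\<le>s. d (Suc i) * p ^ i"] Suc.prems by simp
    also have "[T (d 0) * T (\<Sum>i\<le>s. d (Suc i) * p ^ i) = T (d 0) * (\<Prod>i\<le>s. T (d (Suc i)))] (mod int p)"
      using Suc.IH[of "\<lambda>i. d (Suc i)"] Suc.prems by (intro cong_mult) auto
    also have "T (d 0) * (\<Prod>i\<le>s. T (d (Suc i))) = (\<Prod>i\<le>Suc s. T (d i))"
      by (simp add: prod.atMost_Suc_shift del: prod.atMost_Suc)
    finally show ?case .
  qed simp
  then show ?thesis unfolding lucas_congruences_def using p
    by (metis Suc_pred' less_Suc_eq_le)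
qed

text \<open>If \<open>z = A(t) z\<^sup>p\<close> modulo \<open>p\<close> with \<open>deg A < p\<close>, then, because \<open>z\<^sup>p\<close> is \<open>z\<close> in the variable \<open>q\<^sup>p\<close>,
  comparing coefficients of powers of \<open>t\<close> gives the Lucas congruences.\<close>

lemma lucas_from_polynomial:
  fixes z t A :: "int fps" and T :: "nat \<Rightarrow> int"
  assumes p: "prime p" and t: "fps_nth t 0 = 0" "fps_nth t 1 = 1" and z0: "fps_nth z 0 = 1"
    and z: "z = Abs_fps T oo t"
    and deg: "\<And>i. i \<ge> p \<Longrightarrow> fps_nth A i = 0"
    and c: "fps_cong p z ((A oo t) * z ^ p)"
  shows "lucas_congruences T p"
proof -
  have p0: "p > 0" using p by (simp add: prime_gt_0_nat)
  have "(A oo t) * z ^ p = (A * Abs_fps T ^ p) oo t"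
    unfolding z using t by (simp add: fps_compose_mult_distrib fps_compose_power)
  with c z have "fps_cong p (Abs_fps T oo t) ((A * Abs_fps T ^ p) oo t)" by simp
  then have "fps_cong p (Abs_fps T) (A * Abs_fps T ^ p)" by (rule compose_cong_cancel[OF t])
  also have "fps_cong p (A * Abs_fps T ^ p) (A * dilate p (Abs_fps T))"
    by (intro fps_cong_mult fps_cong_refl fps_cong_dilate p)
  finally have TA: "fps_cong p (Abs_fps T) (A * dilate p (Abs_fps T))" .
  \<comment> \<open>\<open>A\<close> lives below degree \<open>p\<close> and the dilated series on
    multiples of \<open>p\<close>, so the convolution reduces to the single term
    \<open>i = m\<close>.\<close>
  have nth: "fps_nth (A * dilate p (Abs_fps T)) (m + p * n) = fps_nth A m * T n" if m: "m < p" for m n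
  proof -
    have "fps_nth (A * dilate p (Abs_fps T)) (m + p * n) = (\<Sum>i\<in>{0..m + p * n}. fps_nth A i * fps_nth (dilate p (Abs_fps T)) (m + p * n - i))"
      by (rule fps_mult_nth)
    also have "\<dots> = (\<Sum>i\<in>{m}. fps_nth A i * fps_nth (dilate p (Abs_fps T)) (m + p * n - i))"
    proof (intro sum.mono_neutral_right ballI)
      fix i assume i: "i \<in> {0..m + p * n} - {m}"
      show "fps_nth A i * fps_nth (dilate p (Abs_fps T)) (m + p * n - i) = 0"
      proof (cases "i < p")
        case True
        have "\<not> p dvd m + p * n - i"
        proof
          assume "p dvd m + p * n - i"
          then obtain k where "m + p * n - i = p * k" by blast
          then have "m + p * n = p * k + i" using i by auto
          then have "(m + p * n) mod p = (p * k + i) mod p" by simp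
          then show False using m True i by simp
        qed
        then show ?thesis by (simp add: dilate_def)
      qed (simp add: deg)
    qed auto
    finally show ?thesis using p0 by (simp add: dilate_def)
  qed
  have T0: "T 0 = 1" using z0 unfolding z by (simp add: fps_compose_nth)
  show ?thesis
  proof (rule lucas_congruencesI[where p = p])
    fix m n assume m: "m < p"
    have 1: "[T (m + p * n) = fps_nth A m * T n] (mod int p)" for n
      using TA nth[OF m, of n] by (metis fps_cong_def fps_nth_Abs_fps)
    from 1[of 0] have "[T m = fps_nth A m] (mod int p)" by (simp add: T0)
    then have "[fps_nth A m * T n = T m * T n] (mod int p)" by (intro cong_mult) (auto intro: cong_sym)
    with 1[of n] show "[T (m + p * n) = T m * T n] (mod int p)" by (rule cong_trans)
  qed (use p0 T0 in auto)
qed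

text \<open>With \<open>h = t z^w\<close>, multiplication by \<open>z\<close> turns the
  \<open>i\<close>-th term into \<open>b i * t^i * z^p\<close>: the \<open>b i\<close> are the
  coefficients of the required polynomial \<open>A\<close>. The bound on \<open>K\<close> keeps the
  exponents of \<open>z\<close> nonnegative and the degree below \<open>p\<close>.\<close>

lemma lucas_from_form:
  fixes z t h :: "int fps" and T :: "nat \<Rightarrow> int" and b :: "nat \<Rightarrow> int"
  assumes p: "prime p" and h: "fps_nth h 0 = 0" "fps_nth h 1 = 1" and z0: "fps_nth z 0 = 1"
    and t: "t * z ^ w = h" and z: "z = Abs_fps T oo t" and K: "w * K \<le> p - 1" and w: "w > 0"
    and c: "fps_cong p 1 (\<Sum>i\<le>K. fps_const (b i) * h ^ i * z ^ (p - 1 - w * i))"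
  shows "lucas_congruences T p"
proof -
  have p0: "p > 0" using p by (simp add: prime_gt_0_nat)
  define A where "A = (\<Sum>i\<le>K. fps_const (b i) * fps_X ^ i)"
  have zw: "fps_nth (z ^ w) 0 = 1" by (simp add: z0 fps_power_zeroth)
  have t0: "fps_nth t 0 = 0" using h(1) zw by (simp flip: t)
  have "fps_nth h 1 = fps_nth t 1" using zw t0 by (simp add: fps_mult_nth flip: t)
  then have t1: "fps_nth t 1 = 1" using h(2) by simp
  have deg: "fps_nth A i = 0" if "i \<ge> p" for i
  proof -
    have "K \<le> w * K" using w by simp
    then have "K < p" using K p0 by linarith
    then show ?thesis using that by (auto simp: A_def fps_sum_nth fps_X_power_nth intro!: sum.neutral)
  qed
  have At: "A oo t = (\<Sum>i\<le>K. fps_const (b i) * t ^ i)"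
    unfolding A_def using t0
    by (simp add: fps_compose_sum_distrib fps_compose_mult_distrib fps_compose_power[symmetric])
  have "z * (fps_const (b i) * h ^ i * z ^ (p - 1 - w * i)) = fps_const (b i) * t ^ i * z ^ p" if "i \<le> K" for i
  proof -
    have "w * i \<le> w * K" using that by simp
    then have "p = Suc (w * i + (p - 1 - w * i))" using K p0 by linarith
    then have "z ^ p = z * (z ^ w) ^ i * z ^ (p - 1 - w * i)"
      by (metis mult.assoc power_Suc power_add power_mult)
    then show ?thesis unfolding t[symmetric] power_mult_distrib by (simp add: mult_ac)
  qed
  then have "z * (\<Sum>i\<le>K. fps_const (b i) * h ^ i * z ^ (p - 1 - w * i)) = (A oo t) * z ^ p"
    unfolding At sum_distrib_left sum_distrib_right by (intro sum.cong) auto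
  then have "fps_cong p z ((A oo t) * z ^ p)"
    using fps_cong_mult[OF fps_cong_refl c, of z] by simp
  then show ?thesis by (intro lucas_from_polynomial[OF p t0 t1 z0 z, of A]) (auto simp: deg)
qed

subsection \<open>The space of modular forms is generated by two of them\<close>

lemma disc_inverse:
  assumes a: "disc_fps a" and nz: "\<And>z. norm z < 1 \<Longrightarrow> eval_fps a z \<noteq> 0"
  shows "disc_fps (inverse a)"
proof -
  have "fps_conv_radius a > 0" using disc_fpsD[OF a, of 0] by (simp add: zero_ereal_def)
  then have "eval_fps a has_fps_expansion a" by (rule eval_fps_has_fps_expansion)
  moreover have "fps_nth a 0 \<noteq> 0" using nz[of 0] by (simp add: eval_fps_at_0)
  ultimately have "(\<lambda>z. inverse (eval_fps a z)) has_fps_expansion inverse a"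
    by (rule has_fps_expansion_inverse)
  moreover have "(\<lambda>z. inverse (eval_fps a z)) holomorphic_on eball 0 1"
    using disc_fps_holomorphic[OF a] nz by (intro holomorphic_on_inverse) (auto simp: in_eball_iff one_ereal_def)
  ultimately show ?thesis
    unfolding disc_fps_def by (rule holomorphic_on_imp_fps_conv_radius_ge)
qed

lemma fps_factor_X_power:
  fixes f :: "'a::comm_ring_1 fps"
  assumes "\<And>i. i < n \<Longrightarrow> fps_nth f i = 0"
  shows "f = fps_X ^ n * fps_shift n f"
  by (rule fps_ext) (simp add: fps_X_power_mult_nth assms)

text \<open>The transformation law is only required up to absolute value: for the eta products the exact law
  is a consequence of \<open>quotient_const\<close> below.\<close>

locale cusp_form = level N for N +
  fixes w :: nat and h1 :: "complex fps"
  assumes w_pos: "w > 0" and disc_h1: "disc_fps h1" and h1_nonzero: "\<And>z. norm z < 1 \<Longrightarrow> eval_fps h1 z \<noteq> 0"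
    and abs_modular: "\<And>c d \<tau>. valid c d \<Longrightarrow> Im \<tau> > 0 \<Longrightarrow>
      norm (slash w (fps_X * h1) c d (- 1 / \<tau>)) = norm \<tau> ^ w * norm (slash w (fps_X * h1) d (- c) \<tau>)"
begin

abbreviation cusp where "cusp \<equiv> fps_X * h1"

lemma disc_cusp: "disc_fps cusp"
  by (intro disc_fps_mult disc_fps_X disc_h1)

lemma slash_cusp_nonzero: assumes "Im \<tau> > 0" "valid c d" shows "slash w cusp c d \<tau> \<noteq> 0"
proof -
  have nz: "evq cusp \<sigma> \<noteq> 0" if "Im \<sigma> > 0" for \<sigma>
    using norm_nome_less_1[OF that] h1_nonzero disc_h1 by (simp add: eval_disc_mult)
  have "Im ((\<tau> + of_int e) / of_nat N) > 0" for e using assms N_pos by simp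
  then show ?thesis using nz assms eps_eq_0_iff by (auto simp: slash_def valid_def)
qed

text \<open>The quotient of \<open>a\<close> by \<open>cusp ^ n\<close> has weight 0 and no poles:
  \<open>h1\<close> has no zeros in the disc, and the order of \<open>a\<close> compensates the
  factor \<open>X ^ n\<close>. Hence it is constant by \<open>invariant_imp_const\<close>, for which
  absolute values are enough.\<close>

lemma quotient_const:
  assumes a: "disc_fps a" and inv: "\<And>c d \<tau>. valid c d \<Longrightarrow> Im \<tau> > 0 \<Longrightarrow>
      norm (slash (w * n) a c d (- 1 / \<tau>)) = norm \<tau> ^ (w * n) * norm (slash (w * n) a d (- c) \<tau>)"
    and ord: "\<And>i. i < n \<Longrightarrow> fps_nth a i = 0"
  shows "a * fps_const (fps_nth h1 0 ^ n) = fps_const (fps_nth a n) * cusp ^ n"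
proof -
  have h10: "fps_nth h1 0 \<noteq> 0" using h1_nonzero[of 0] by (simp add: eval_fps_at_0)
  have aX: "a = fps_X ^ n * fps_shift n a" using ord by (rule fps_factor_X_power)
  have disc_shift: "disc_fps (fps_shift n a)" using a by (simp add: disc_fps_def)
  define g where "g = fps_shift n a * inverse h1 ^ n"
  have g: "disc_fps g" unfolding g_def
    by (intro disc_fps_mult disc_fps_power disc_inverse disc_shift disc_h1 h1_nonzero)
  have gh: "g * cusp ^ n = a"
  proof -
    have "inverse h1 * h1 = 1" using h10 by (rule inverse_mult_eq_1)
    then have "inverse h1 ^ n * h1 ^ n = 1" by (metis power_mult_distrib power_one)
    then have "g * cusp ^ n = fps_X ^ n * fps_shift n a"
      unfolding g_def power_mult_distrib by (simp add: mult_ac)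
    then show ?thesis using aX by simp
  qed
  have "g = fps_const (fps_nth g 0)"
  proof (rule invariant_imp_const[OF g])
    fix c d :: int and \<tau> :: complex
    assume v: "valid c d" and \<tau>: "Im \<tau> > 0"
    have v': "valid d (- c)" using v by (auto simp: valid_def)
    have sl: "slash (w * n) a c d \<tau> = slash 0 g c d \<tau> * slash w cusp c d \<tau> ^ n" if "Im \<tau> > 0" for c d \<tau>
      using slash_mult[OF g disc_fps_power[OF disc_cusp] that, of 0 "w * n" n c d] slash_power[OF disc_cusp that, of w n c d] gh
      by simp
    have "norm (slash 0 g c d (- 1 / \<tau>)) * (norm \<tau> ^ (w * n) * norm (slash w cusp d (- c) \<tau>) ^ n)
       = norm \<tau> ^ (w * n) * (norm (slash 0 g d (- c) \<tau>) * norm (slash w cusp d (- c) \<tau>) ^ n)"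
      using inv[OF v \<tau>] unfolding sl[OF \<tau>] sl[OF Im_minus_inverse_pos[OF \<tau>]] norm_mult norm_power abs_modular[OF v \<tau>]
        power_mult_distrib power_mult[symmetric] .
    moreover have "norm \<tau> ^ (w * n) \<noteq> 0" "norm (slash w cusp d (- c) \<tau>) ^ n \<noteq> 0"
      using \<tau> slash_cusp_nonzero[OF \<tau> v'] by auto
    moreover have "A = C" if "A * (X * B) = X * (C * B)" "X \<noteq> 0" "B \<noteq> 0" for A B C X :: real
      using that by (simp add: mult.left_commute)
    ultimately show "norm (slash 0 g c d (- 1 / \<tau>)) = norm (slash 0 g d (- c) \<tau>)" by blast
  qed
  moreover have "fps_nth g 0 * fps_nth h1 0 ^ n = fps_nth a n"
  proof -
    have "fps_nth (fps_X ^ n * (g * h1 ^ n)) n = fps_nth a n"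
      unfolding gh[symmetric] power_mult_distrib by (simp add: mult_ac)
    then show ?thesis by (simp add: fps_X_power_mult_nth fps_power_zeroth)
  qed
  ultimately have "g * fps_const (fps_nth h1 0 ^ n) = fps_const (fps_nth a n)"
    by (metis fps_const_mult)
  then show ?thesis unfolding gh[symmetric] by (metis mult.assoc mult.commute)
qed

lemma modular_norm:
  assumes "modular k a" "valid c d" "Im \<tau> > 0"
  shows "norm (slash k a c d (- 1 / \<tau>)) = norm \<tau> ^ k * norm (slash k a d (- c) \<tau>)"
  unfolding modularD[OF assms] by (simp add: norm_mult norm_power)

text \<open>The weight need not be a multiple of \<open>w\<close>, so the argument is applied to
  \<open>a ^ w\<close>, of weight \<open>w k\<close>. Its order is at least
  \<open>w (k div w + 1) > k\<close>, so its quotient by \<open>cusp ^ k\<close> is a constant with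
  value zero.\<close>

lemma modular_eq_0:
  assumes a: "modular k a" and ord: "\<And>i. i \<le> k div w \<Longrightarrow> fps_nth a i = 0"
  shows "a = 0"
proof -
  define m where "m = Suc (k div w)"
  have "w * (k div w) + k mod w = k" by (simp add: mult.commute)
  moreover have "k mod w < w" using w_pos by simp
  ultimately have m: "k < w * m" unfolding m_def mult_Suc_right by linarith
  have aX: "a = fps_X ^ m * fps_shift m a"
    by (rule fps_factor_X_power) (use ord in \<open>simp add: m_def less_Suc_eq_le\<close>)
  have aw: "a ^ w = fps_X ^ (m * w) * fps_shift m a ^ w"
    by (subst aX) (simp add: power_mult_distrib power_mult)
  have ordw: "fps_nth (a ^ w) i = 0" if "i \<le> k" for i
    using that m unfolding aw by (simp add: fps_X_power_mult_nth mult.commute)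
  have "modular (w * k) (a ^ w)" using modular_power[OF a, of w] by (simp add: mult.commute)
  from quotient_const[OF modular_disc[OF this] modular_norm[OF this]] ordw
  have "a ^ w * fps_const (fps_nth h1 0 ^ k) = 0" by simp
  moreover have "fps_nth h1 0 \<noteq> 0" using h1_nonzero[of 0] by (simp add: eval_fps_at_0)
  ultimately have "a ^ w = 0" by simp
  then show ?thesis by simp
qed

end

lemma power_product_nth:
  fixes z h :: "'a::comm_ring_1 fps"
  assumes z0: "fps_nth z 0 = 1" and h: "fps_nth h 0 = 0" "fps_nth h 1 = 1" and "i \<le> n"
  shows "fps_nth (h ^ n * z ^ m) i = (if i = n then 1 else 0)"
proof -
  have lo: "fps_nth (h ^ n) j = 0" if "j < n" for j
    using startsby_zero_power_prefix[OF h(1), of n] that by simp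
  have "fps_nth (h ^ n) n = 1" using startsby_zero_power_nth_same[OF h(1), of n] h(2) by simp
  moreover have "{0..i} = insert i {0..<i}" by auto
  moreover have "(\<Sum>j\<in>{0..<i}. fps_nth (h ^ n) j * fps_nth (z ^ m) (i - j)) = 0"
    using assms(4) by (intro sum.neutral) (simp add: lo)
  moreover have "fps_nth (z ^ m) 0 = 1" by (simp add: z0 fps_power_zeroth)
  ultimately show ?thesis using assms(4) lo[of i] by (simp add: fps_mult_nth)
qed
text \<open>Matching the first coefficients one after the other keeps them integral, since \<open>h\<close> and \<open>z\<close> have
  leading coefficient \<open>1\<close>.\<close>

lemma match_coefficients:
  fixes f z h :: "int fps"
  assumes z0: "fps_nth z 0 = 1" and h: "fps_nth h 0 = 0" "fps_nth h 1 = 1"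
  shows "\<exists>b. \<forall>i\<le>K. fps_nth (f - (\<Sum>i\<le>K. fps_const (b i) * h ^ i * z ^ (e i))) i = 0"
proof -
  note hz = power_product_nth[OF z0 h]
  show ?thesis
  proof (induction K)
    case 0
    have "fps_nth (h ^ 0 * z ^ e 0) 0 = 1" using hz[of 0 0 "e 0"] by simp
    then show ?case by (intro exI[of _ "\<lambda>_. fps_nth f 0"]) (simp add: mult.assoc)
  next
    case (Suc K)
    then obtain b where b: "\<And>i. i \<le> K \<Longrightarrow> fps_nth (f - (\<Sum>i\<le>K. fps_const (b i) * h ^ i * z ^ e i)) i = 0" by blast
    define F where "F = f - (\<Sum>i\<le>K. fps_const (b i) * h ^ i * z ^ e i)"
    define b' where "b' = b(Suc K := fps_nth F (Suc K))"
    have "(\<Sum>i\<le>K. fps_const (b' i) * h ^ i * z ^ e i) = (\<Sum>i\<le>K. fps_const (b i) * h ^ i * z ^ e i)"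
      by (intro sum.cong) (auto simp: b'_def)
    then have F': "f - (\<Sum>i\<le>Suc K. fps_const (b' i) * h ^ i * z ^ e i) = F - fps_const (fps_nth F (Suc K)) * (h ^ Suc K * z ^ e (Suc K))"
      by (simp add: F_def b'_def mult.assoc del: power_Suc)
    have "fps_nth (f - (\<Sum>i\<le>Suc K. fps_const (b' i) * h ^ i * z ^ e i)) i = 0" if "i \<le> Suc K" for i
    proof (cases "i = Suc K")
      case True
      then show ?thesis unfolding F' by (simp add: hz del: power_Suc)
    next
      case False
      then have "i \<le> K" using that by simp
      then show ?thesis unfolding F' using b[of i] hz[of i "Suc K" "e (Suc K)"] by (simp add: F_def del: power_Suc)
    qed
    then show ?case by blast
  qed
qed

lemma of_int_fps_sum: "of_int_fps (\<Sum>i\<in>A. f i) = (\<Sum>i\<in>A. of_int_fps (f i))"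
  by (induction A rule: infinite_finite_induct) (simp_all add: of_int_fps_def fps_eq_iff)

locale generators = cusp_form N w h1 for N w h1 +
  fixes z h :: "int fps"
  assumes z: "modular 1 (of_int_fps z)" and z0: "fps_nth z 0 = 1"
    and h: "of_int_fps h = fps_X * h1" and h_mod: "modular w (of_int_fps h)" and h_nth: "fps_nth h 1 = 1"
begin

lemma h_nth_0: "fps_nth h 0 = 0"
proof -
  have "fps_nth (of_int_fps h) 0 = 0" unfolding h by simp
  then show ?thesis by (simp add: of_int_fps_def)
qed

lemma modular_representation:
  assumes f: "modular k (of_int_fps f)"
  shows "\<exists>b. f = (\<Sum>i\<le>k div w. fps_const (b i) * h ^ i * z ^ (k - w * i))"
proof -
  obtain b where b: "\<And>i. i \<le> k div w \<Longrightarrow> fps_nth (f - (\<Sum>i\<le>k div w. fps_const (b i) * h ^ i * z ^ (k - w * i))) i = 0"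
    using match_coefficients[OF z0 h_nth_0 h_nth, of "k div w" f "\<lambda>i. k - w * i"] by blast
  have "modular k (of_int_fps (fps_const (b i) * h ^ i * z ^ (k - w * i)))" if "i \<le> k div w" for i
  proof -
    have "w * i \<le> w * (k div w)" using that by simp
    then have "w * i \<le> k" by (meson order_trans times_div_less_eq_dividend)
    moreover have "modular (w * i + 1 * (k - w * i)) (fps_const (of_int (b i)) * (of_int_fps h ^ i * of_int_fps z ^ (k - w * i)))"
      by (intro modular_cmult modular_mult modular_power h_mod z)
    ultimately show ?thesis by (simp add: mult.assoc)
  qed
  then have D: "modular k (of_int_fps (f - (\<Sum>i\<le>k div w. fps_const (b i) * h ^ i * z ^ (k - w * i))))"
    unfolding of_int_fps_diff of_int_fps_sum by (intro modular_diff f modular_sum) auto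
  have "of_int_fps (f - (\<Sum>i\<le>k div w. fps_const (b i) * h ^ i * z ^ (k - w * i))) = of_int_fps 0"
    by (subst modular_eq_0[OF D]) (simp_all only: of_int_fps_def fps_nth_Abs_fps b of_int_0 fps_zero_nth fps_eq_iff simp_thms)
  then have "f - (\<Sum>i\<le>k div w. fps_const (b i) * h ^ i * z ^ (k - w * i)) = 0"
    by (simp only: of_int_fps_eq_iff)
  then show ?thesis by auto
qed

end

section \<open>The substitution of q^p for q\<close>

lemma disc_dilate:
  assumes "prime p" "disc_fps a"
  shows "disc_fps (dilate p a)" and "norm z < 1 \<Longrightarrow> eval_fps (dilate p a) z = eval_fps a (z ^ p)"
proof -
  have nth: "fps_nth (dilate p a) n = (if p dvd n then fps_nth a (n div p) else 0)" for n
    by (simp add: dilate_def)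
  show disc: "disc_fps (dilate p a)"
    by (rule disc_fpsI) (use hecke_parts[OF assms] in \<open>auto simp only: nth sums_iff\<close>)
  show "eval_fps (dilate p a) z = eval_fps a (z ^ p)" if "norm z < 1"
    using disc_fps_sums[OF disc that] hecke_parts[OF assms that] unfolding nth by (rule sums_unique2)
qed

lemma of_int_fps_dilate [simp]: "of_int_fps (dilate p a) = dilate p (of_int_fps a)"
  by (simp add: of_int_fps_def dilate_def fps_eq_iff)

lemma of_int_fps_hecke [simp]: "of_int_fps (hecke p k a) = hecke p k (of_int_fps a)"
  by (simp add: of_int_fps_def hecke_def fps_eq_iff)

lemma fps_eq_disc:
  assumes "disc_fps a" "disc_fps b" "\<And>z. norm z < 1 \<Longrightarrow> eval_fps a z = eval_fps b z"
  shows "a = b"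
  by (rule disc_fps_eqI[OF assms(1,2)]) (simp add: assms(3) norm_nome_less_1)

lemma dilate_mult:
  assumes p: "prime p" and "disc_fps a" "disc_fps b"
  shows "dilate p (a * b) = dilate p a * dilate p b"
proof (rule fps_eq_disc)
  fix z :: complex assume z: "norm z < 1"
  have "norm (z ^ p) < 1" using z prime_gt_0_nat[OF p] by (simp add: norm_power power_less_one_iff)
  then show "eval_fps (dilate p (a * b)) z = eval_fps (dilate p a * dilate p b) z"
    using assms z by (simp add: disc_dilate eval_disc_mult disc_fps_mult)
qed (use assms in \<open>auto intro!: disc_dilate disc_fps_mult\<close>)

lemma dilate_X: "prime p \<Longrightarrow> dilate p fps_X = (fps_X :: complex fps) ^ p"
proof (rule fps_eq_disc)
  fix z :: complex assume "prime p" and z: "norm z < 1"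
  then show "eval_fps (dilate p fps_X) z = eval_fps (fps_X ^ p) z"
    by (simp add: disc_dilate eval_disc_power)
qed (auto intro!: disc_dilate disc_fps_power)

lemma dilate_1: "prime p \<Longrightarrow> dilate p 1 = (1 :: complex fps)"
  using prime_gt_0_nat[of p] by (auto simp: dilate_def fps_eq_iff dvd_div_eq_0_iff)

lemma dilate_power:
  assumes p: "prime p" and "disc_fps a"
  shows "dilate p (a ^ n) = dilate p a ^ n"
  by (induction n) (use assms in \<open>auto simp: dilate_1 dilate_mult disc_fps_power\<close>)

section \<open>Symmetric combinations of the discriminant and its Fricke image\<close>

context level
begin

text \<open>The Fricke image of \<open>delta\<close>: in weight 12 the factor \<open>N^6\<close>
  cancels \<open>kappa ^ 12\<close>, so that the involution exchanges the two series exactly. It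
  also makes \<open>delta_N\<close> vanish modulo \<open>N\<close>.\<close>

definition delta_N :: "int fps" where "delta_N = fps_const (int N ^ 6) * dilate N delta"

abbreviation Delta_N :: "complex fps" where "Delta_N \<equiv> of_int_fps delta_N"

lemma Delta_N_eq: "Delta_N = fps_const (of_nat N ^ 6) * dilate N Delta"
  by (simp add: delta_N_def)

lemma disc_Delta_N: "disc_fps Delta_N"
  unfolding Delta_N_eq by (intro disc_fps_mult disc_fps_const disc_dilate N_prime disc_Delta)

lemma evq_Delta_N:
  assumes "Im \<tau> > 0"
  shows "evq Delta_N \<tau> = of_nat N ^ 6 * evq Delta (of_nat N * \<tau>)"
  unfolding Delta_N_eq nome_power[symmetric]
  by (simp add: eval_disc_mult disc_dilate N_prime disc_Delta norm_nome_less_1 assms)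

lemma kappa_power_12: "kappa ^ 12 * of_nat N ^ 6 = 1"
proof -
  have "kappa ^ 12 * of_nat N ^ 6 = (kappa * kappa * of_nat N) ^ 6"
    by (simp add: power_mult_distrib flip: power_add)
  then show ?thesis by (simp add: kappa_square)
qed

lemma eps_power_12: "\<not> int N dvd a \<Longrightarrow> (of_int (eps a) :: complex) ^ 12 = 1"
  using eps_cases[of a] by auto

text \<open>\<open>Delta\<close> alone is not \<open>modular\<close>, as it is not a Fricke
  eigenfunction. Inversion exchanges \<open>Delta\<close> and \<open>Delta_N\<close> when it moves
  between the two cusps and preserves both otherwise, so symmetric expressions in the two are
  modular.\<close>

lemma Delta_pair:
  assumes v: "valid c d" and \<tau>: "Im \<tau> > 0"
  shows "slash 12 Delta c d (- 1 / \<tau>) = \<tau> ^ 12 * slash 12 Delta_N d (- c) \<tau> \<and>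
      slash 12 Delta_N c d (- 1 / \<tau>) = \<tau> ^ 12 * slash 12 Delta d (- c) \<tau> \<or>
      slash 12 Delta c d (- 1 / \<tau>) = \<tau> ^ 12 * slash 12 Delta d (- c) \<tau> \<and>
      slash 12 Delta_N c d (- 1 / \<tau>) = \<tau> ^ 12 * slash 12 Delta_N d (- c) \<tau>"
proof -
  have \<tau>0: "\<tau> \<noteq> 0" using \<tau> by auto
  have N0: "complex_of_nat N \<noteq> 0" using N_pos by simp
  have N\<tau>: "Im (of_nat N * \<tau>) > 0" "Im (\<tau> / of_nat N) > 0" using \<tau> N_pos by simp_all
  have m\<tau>: "Im (- 1 / \<tau>) > 0" by (rule Im_minus_inverse_pos[OF \<tau>])
  have k12: "kappa ^ 12 = 1 / of_nat N ^ 6" using kappa_power_12 N0 by (simp add: field_simps)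
  have fin: "slash 12 a x y \<sigma> = kappa ^ 12 * evq a ((\<sigma> + of_int e) / of_nat N)"
    if "\<not> int N dvd x" "[x * e = y] (mod int N)" for a x y e \<sigma>
    unfolding slash_fin[OF that] power_mult_distrib eps_power_12[OF that(1)] by simp
  have inf: "slash 12 a x y \<sigma> = evq a \<sigma>" if "int N dvd x" "\<not> int N dvd y" for a x y \<sigma>
    using eps_power_12[OF that(2)] by (simp add: slash_inf that(1))
  have fin_N: "slash 12 Delta_N x y \<sigma> = evq Delta \<sigma>" if x: "\<not> int N dvd x" and \<sigma>: "Im \<sigma> > 0" for x y \<sigma>
  proof -
    obtain e where e: "[x * e = y] (mod int N)" using cong_solve_N[OF x] .
    have "of_nat N * ((\<sigma> + of_int e) / of_nat N) = \<sigma> + of_int e" using N0 by simp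
    moreover have "Im ((\<sigma> + of_int e) / of_nat N) > 0" using \<sigma> N_pos by simp
    ultimately show ?thesis
      unfolding fin[OF x e] by (simp add: evq_Delta_N kappa_power_12 flip: mult.assoc del: times_divide_eq_right)
  qed
  consider "int N dvd c" "\<not> int N dvd d" | "\<not> int N dvd c" "int N dvd d" | "\<not> int N dvd c" "\<not> int N dvd d"
    using v by (auto simp: valid_def)
  then show ?thesis
  proof cases
    case 1
    have e: "[d * 0 = - c] (mod int N)" using 1 by (simp add: cong_iff_dvd_diff)
    have "of_nat N * (- 1 / \<tau>) = - 1 / (\<tau> / of_nat N)" using N0 by simp
    then have "evq Delta_N (- 1 / \<tau>) = of_nat N ^ 6 * ((\<tau> / of_nat N) ^ 12 * evq Delta (\<tau> / of_nat N))"
      unfolding evq_Delta_N[OF m\<tau>] by (simp only: Delta_inversion[OF N\<tau>(2)])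
    also have "\<dots> = \<tau> ^ 12 * (kappa ^ 12 * evq Delta (\<tau> / of_nat N))"
      unfolding k12 using N0 by (simp add: power_divide field_simps flip: power_add)
    finally show ?thesis
      using fin[OF 1(2) e, of Delta \<tau>] fin_N[of d \<tau> "- c"] 1 \<tau> inf[OF 1, of _ "- 1 / \<tau>"] Delta_inversion[OF \<tau>]
      by simp
  next
    case 2
    have e: "[c * 0 = d] (mod int N)" using 2 by (simp add: cong_iff_dvd_diff)
    have nc: "\<not> int N dvd - c" using 2 by simp
    have "(- 1 / \<tau> + of_int 0) / of_nat N = - 1 / (of_nat N * \<tau>)" by simp
    then have "slash 12 Delta c d (- 1 / \<tau>) = kappa ^ 12 * ((of_nat N * \<tau>) ^ 12 * evq Delta (of_nat N * \<tau>))"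
      unfolding fin[OF 2(1) e] by (simp only: Delta_inversion[OF N\<tau>(1)])
    also have "\<dots> = \<tau> ^ 12 * (of_nat N ^ 6 * evq Delta (of_nat N * \<tau>))"
      unfolding k12 using N0 by (simp add: power_mult_distrib field_simps flip: power_add)
    finally show ?thesis
      using fin_N[OF 2(1) m\<tau>, of d] inf[OF 2(2) nc, of _ \<tau>] evq_Delta_N[OF \<tau>] Delta_inversion[OF \<tau>] by simp
  next
    case 3
    obtain e where e: "[c * e = d] (mod int N)" using cong_solve_N[OF 3(1)] .
    obtain e' where e': "[d * e' = - c] (mod int N)" using cong_solve_N[OF 3(2)] .
    have "[c * (e * e') = d * e'] (mod int N)" using cong_mult[OF e cong_refl[of e']] by (simp add: mult_ac)
    then have "[c * (e * e') = c * (- 1)] (mod int N)" using e' by (auto intro: cong_trans)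
    then have "[e * e' = - 1] (mod int N)" using coprime_N[OF 3(1)] by (simp only: cong_mult_lcancel)
    then obtain B where "e * e' - (- 1) = int N * B" by (auto simp: cong_iff_dvd_diff dvd_def)
    then have B: "e * e' + 1 = int N * B" by simp
    define w where "w = (\<tau> + of_int e') / of_nat N"
    have w: "Im w > 0" using \<tau> N_pos by (simp add: w_def)
    have B': "of_int e * of_int e' + 1 = complex_of_nat N * of_int B"
      using arg_cong[OF B, of complex_of_int] by simp
    have den: "of_int (int N) * w + of_int (- e') = \<tau>" using N0 by (simp add: w_def)
    have num: "of_int e * w + of_int (- B) = (of_int e * \<tau> - 1) / of_nat N"
    proof -
      have "of_nat N * (of_int e * w + of_int (- B)) = of_int e * (\<tau> + of_int e') - of_nat N * of_int B"
        using N0 by (simp add: w_def field_simps)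
      also have "\<dots> = of_int e * \<tau> - 1" unfolding B'[symmetric] by (simp add: algebra_simps)
      finally show ?thesis using N0 by (simp add: field_simps)
    qed
    have arg: "(of_int e * w + of_int (- B)) / \<tau> = (- 1 / \<tau> + of_int e) / of_nat N"
      unfolding num using \<tau>0 N0 by (simp add: divide_simps)
    have "e * (- e') - (- B) * int N = 1" using B by (simp add: algebra_simps)
    from Delta_SL2[OF this w] have "evq Delta ((- 1 / \<tau> + of_int e) / of_nat N) = \<tau> ^ 12 * evq Delta w"
      unfolding den arg .
    then have "slash 12 Delta c d (- 1 / \<tau>) = \<tau> ^ 12 * slash 12 Delta d (- c) \<tau>"
      unfolding fin[OF 3(1) e, of Delta] fin[OF 3(2) e', of Delta] by (simp add: w_def)
    moreover have "slash 12 Delta_N c d (- 1 / \<tau>) = \<tau> ^ 12 * slash 12 Delta_N d (- c) \<tau>"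
      unfolding fin_N[OF 3(1) m\<tau>] fin_N[OF 3(2) \<tau>] by (rule Delta_inversion[OF \<tau>])
    ultimately show ?thesis by blast
  qed
qed

lemma modular_Delta_power_sum: "modular (12 * e) (Delta ^ e + Delta_N ^ e)"
proof (rule modularI)
  fix c d :: int and \<tau> :: complex
  assume v: "valid c d" and \<tau>: "Im \<tau> > 0"
  have sl: "slash (12 * e) (Delta ^ e + Delta_N ^ e) c d \<sigma> = slash 12 Delta c d \<sigma> ^ e + slash 12 Delta_N c d \<sigma> ^ e"
    if "Im \<sigma> > 0" for c d \<sigma>
    by (simp add: slash_add slash_power disc_fps_power disc_Delta disc_Delta_N that)
  show "slash (12 * e) (Delta ^ e + Delta_N ^ e) c d (- 1 / \<tau>) = \<tau> ^ (12 * e) * slash (12 * e) (Delta ^ e + Delta_N ^ e) d (- c) \<tau>"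
    unfolding sl[OF \<tau>] sl[OF Im_minus_inverse_pos[OF \<tau>]] power_mult
    using Delta_pair[OF v \<tau>] by (elim disjE conjE) (simp_all only: power_mult_distrib ring_distribs add.commute)
qed (intro disc_fps_add disc_fps_power disc_Delta disc_Delta_N)

lemma modular_Delta_product: "modular 24 (Delta * Delta_N)"
proof (rule modularI)
  fix c d :: int and \<tau> :: complex
  assume v: "valid c d" and \<tau>: "Im \<tau> > 0"
  have sl: "slash 24 (Delta * Delta_N) c d \<sigma> = slash 12 Delta c d \<sigma> * slash 12 Delta_N c d \<sigma>"
    if "Im \<sigma> > 0" for c d \<sigma>
    using slash_mult[OF disc_Delta disc_Delta_N that, of 12 12 c d] by simp
  have "\<tau> ^ 24 = \<tau> ^ 12 * \<tau> ^ 12" by (simp flip: power_add)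
  then show "slash 24 (Delta * Delta_N) c d (- 1 / \<tau>) = \<tau> ^ 24 * slash 24 (Delta * Delta_N) d (- c) \<tau>"
    unfolding sl[OF \<tau>] sl[OF Im_minus_inverse_pos[OF \<tau>]]
    using Delta_pair[OF v \<tau>] by (elim disjE conjE) (simp_all only: mult_ac)
qed (intro disc_fps_mult disc_Delta disc_Delta_N)

end

subsection \<open>The eta products\<close>

text \<open>The product \<open>(eta(\<tau>) eta(N \<tau>))^r\<close> has leading exponent
  \<open>r (N + 1) / 24 = 1\<close> and weight \<open>r\<close>. It thus has a simple zero at each
  cusp.\<close>

locale eta_level = level N for N +
  fixes r :: nat
  assumes r: "r * (N + 1) = 24"
begin

lemma r_pos: "r > 0" using r by (cases r) auto

definition eta_prod :: "int fps" where "eta_prod = fps_X * (pent * dilate N pent) ^ r"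

definition eta_unit :: "complex fps" where "eta_unit = (Pent * dilate N Pent) ^ r"

lemma of_int_eta_prod: "of_int_fps eta_prod = fps_X * eta_unit"
  by (simp add: eta_prod_def eta_unit_def)

lemma disc_eta_unit: "disc_fps eta_unit"
  unfolding eta_unit_def by (intro disc_fps_power disc_fps_mult disc_Pent disc_dilate N_prime)

lemma eval_eta_unit:
  assumes z: "norm z < 1"
  shows "eval_fps eta_unit z = (eval_fps Pent z * eval_fps Pent (z ^ N)) ^ r"
  unfolding eta_unit_def using z
  by (simp add: eval_disc_power eval_disc_mult disc_fps_mult disc_Pent disc_dilate N_prime)

lemma norm_power_N: "norm z < 1 \<Longrightarrow> norm (z ^ N) < (1::real)" for z :: complex
  using N_pos by (simp add: norm_power power_less_one_iff)

lemma eta_power: "(fps_X * eta_unit) ^ (N + 1) = Delta * dilate N Delta"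
proof -
  have "eta_unit ^ (N + 1) = (Pent * dilate N Pent) ^ 24"
    unfolding eta_unit_def power_mult[symmetric] r ..
  then have "(fps_X * eta_unit) ^ (N + 1) = (fps_X * Pent ^ 24) * (fps_X ^ N * dilate N Pent ^ 24)"
    by (simp add: power_mult_distrib mult_ac)
  also have "fps_X ^ N * dilate N Pent ^ 24 = dilate N Delta"
    unfolding Delta_eq by (simp add: dilate_mult dilate_power dilate_X N_prime disc_Pent disc_fps_power)
  finally show ?thesis by (simp only: Delta_eq)
qed

text \<open>The \<open>(N + 1)\<close>-st power is a constant multiple of
  \<open>Delta * Delta_N\<close>, whose law is exact; extracting the root leaves an undetermined
  root of unity, hence the absolute values.\<close>

lemma eta_abs_modular:
  assumes v: "valid c d" and \<tau>: "Im \<tau> > 0"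
  shows "norm (slash r (fps_X * eta_unit) c d (- 1 / \<tau>)) = norm \<tau> ^ r * norm (slash r (fps_X * eta_unit) d (- c) \<tau>)"
proof -
  have disc: "disc_fps (fps_X * eta_unit)" by (intro disc_fps_mult disc_fps_X disc_eta_unit)
  have N0: "complex_of_nat N \<noteq> 0" using N_pos by simp
  have "(fps_X * eta_unit) ^ (N + 1) = fps_const (1 / of_nat N ^ 6) * (Delta * Delta_N)"
  proof -
    have "fps_const (1 / of_nat N ^ 6) * (Delta * Delta_N) = fps_const (1 / of_nat N ^ 6 * of_nat N ^ 6) * (Delta * dilate N Delta)"
      unfolding Delta_N_eq fps_const_mult[symmetric] by (simp only: mult_ac)
    also have "1 / of_nat N ^ 6 * of_nat N ^ 6 = (1::complex)" using N0 by simp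
    finally show ?thesis by (simp only: eta_power fps_const_1_eq_1 mult_1)
  qed
  then have m: "modular 24 ((fps_X * eta_unit) ^ (N + 1))"
    by (simp only:) (intro modular_cmult modular_Delta_product)
  have sl: "slash 24 ((fps_X * eta_unit) ^ (N + 1)) c d \<sigma> = slash r (fps_X * eta_unit) c d \<sigma> ^ (N + 1)"
    if "Im \<sigma> > 0" for c d \<sigma>
    using slash_power[OF disc that, of r "N + 1" c d] by (simp only: r)
  have "norm (slash r (fps_X * eta_unit) c d (- 1 / \<tau>) ^ (N + 1)) = norm (\<tau> ^ 24 * slash r (fps_X * eta_unit) d (- c) \<tau> ^ (N + 1))"
    using modularD[OF m v \<tau>] unfolding sl[OF \<tau>] sl[OF Im_minus_inverse_pos[OF \<tau>]] by simp
  then have "norm (slash r (fps_X * eta_unit) c d (- 1 / \<tau>)) ^ (N + 1) = (norm \<tau> ^ r * norm (slash r (fps_X * eta_unit) d (- c) \<tau>)) ^ (N + 1)"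
    unfolding norm_mult norm_power power_mult_distrib power_mult[symmetric] r .
  then show ?thesis by (subst (asm) power_eq_iff_eq_base) auto
qed

sublocale cusp_form N r eta_unit
proof
  show "eval_fps eta_unit z \<noteq> 0" if "norm z < 1" for z
    using that by (simp add: eval_eta_unit pentagonal_number_theorem(2) norm_power_N)
qed (fact r_pos disc_eta_unit eta_abs_modular)+

lemma pent_nth_0: "fps_nth pent 0 = 1"
proof -
  have "eval_fps Pent 0 = 1" using pentagonal_number_theorem(1)[of 0] by simp
  then show ?thesis by (simp add: eval_fps_at_0 of_int_fps_def)
qed

lemma eta_unit_nth_0: "fps_nth eta_unit 0 = 1"
  by (simp add: eta_unit_def fps_power_zeroth dilate_def of_int_fps_def pent_nth_0)

lemma eta_prod_nth: "fps_nth eta_prod 0 = 0" "fps_nth eta_prod 1 = 1"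
  by (simp_all add: eta_prod_def fps_power_zeroth dilate_def pent_nth_0)

text \<open>An exact modular form of weight \<open>r\<close> vanishing at the cusps must be a multiple of the eta product,
  which so far is only known to be modular up to absolute value.\<close>

lemma modular_eta_prod:
  assumes x: "modular r x" and x0: "fps_nth x 0 = 0" and x1: "fps_nth x 1 \<noteq> 0"
  shows "modular r (of_int_fps eta_prod)"
proof -
  have x': "modular (r * 1) x" using x by simp
  have "x = fps_const (fps_nth x 1) * (fps_X * eta_unit)"
    using quotient_const[OF modular_disc[OF x'] modular_norm[OF x']] x0 by (simp add: eta_unit_nth_0)
  then have "fps_const (1 / fps_nth x 1) * x = fps_const (1 / fps_nth x 1 * fps_nth x 1) * (fps_X * eta_unit)"
    unfolding fps_const_mult[symmetric] by (metis mult.assoc)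
  then have "fps_X * eta_unit = fps_const (1 / fps_nth x 1) * x" using x1 by simp
  then show ?thesis unfolding of_int_eta_prod by (simp only:) (rule modular_cmult[OF x])
qed

text \<open>By Frobenius \<open>pent(q^N)\<close> is \<open>pent ^ N\<close> modulo
  \<open>N\<close>, so the eta product becomes \<open>q\<close> times
  \<open>pent ^ (r (N + 1))\<close>, and \<open>r (N + 1) = 24\<close>.\<close>

lemma delta_cong_eta_prod: "fps_cong N delta eta_prod"
proof -
  have "fps_cong N (fps_X * (pent * dilate N pent) ^ r) (fps_X * (pent * pent ^ N) ^ r)"
    by (intro fps_cong_mult fps_cong_power fps_cong_refl fps_cong_sym[OF fps_cong_dilate[OF N_prime]])
  also have "(pent * pent ^ N) ^ r = pent ^ (r * (N + 1))"
    by (simp add: mult.commute flip: power_Suc power_mult)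
  finally show ?thesis unfolding r by (simp add: delta_def eta_prod_def fps_cong_sym)
qed

end

subsection \<open>From modular forms to Lucas congruences\<close>

text \<open>After removing \<open>X ^ e\<close> the series \<open>u\<close> has constant term 1 and
  therefore an integral inverse.\<close>

lemma fps_cong_cancel:
  assumes lo: "\<And>j. j < e \<Longrightarrow> fps_nth u j = 0" and u: "fps_nth u e = 1" and c: "fps_cong p (u * a) (u * b)"
  shows "fps_cong p a b"
proof -
  define u' where "u' = fps_shift e u"
  have uX: "u = fps_X ^ e * u'" unfolding u'_def using lo by (rule fps_factor_X_power)
  have c': "fps_cong p (u' * x) (u' * y)" if "fps_cong p (u * x) (u * y)" for x y
    unfolding fps_cong_def
  proof
    fix n
    have "fps_nth (u * x) (n + e) = fps_nth (u' * x) n" for x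
      unfolding uX by (simp add: mult.assoc fps_X_power_mult_nth)
    then show "[fps_nth (u' * x) n = fps_nth (u' * y) n] (mod int p)"
      using that by (metis fps_cong_def)
  qed
  have inv: "fps_left_inverse u' 1 * u' = 1" by (rule fps_left_inverse) (simp add: u'_def u)
  have "fps_cong p (fps_left_inverse u' 1 * (u' * a)) (fps_left_inverse u' 1 * (u' * b))"
    by (intro fps_cong_mult fps_cong_refl c' c)
  then show ?thesis by (simp add: inv flip: mult.assoc)
qed

text \<open>In weight \<open>p\<close> the second summand of the operator carries
  \<open>p ^ (p - 1)\<close>, and by Frobenius the coefficient of \<open>g ^ p\<close> at
  \<open>p n\<close> is that of \<open>g\<close> at \<open>n\<close>.\<close>

lemma hecke_cong:
  assumes p: "prime p"
  shows "fps_cong p (hecke p p (g ^ p)) g"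
  unfolding fps_cong_def
proof
  fix n
  have p0: "p > 1" by (rule prime_gt_1_nat[OF p])
  have "int p dvd int p ^ (p - 1)" using p0 by (simp add: dvd_power)
  then have "[fps_nth (hecke p p (g ^ p)) n = fps_nth (g ^ p) (p * n) + 0] (mod int p)"
    unfolding hecke_def fps_nth_Abs_fps by (intro cong_add cong_refl) (simp add: cong_0_iff)
  also have "[fps_nth (g ^ p) (p * n) + 0 = fps_nth (dilate p g) (p * n)] (mod int p)"
    using fps_cong_dilate[OF p, of g] by (simp add: fps_cong_def)
  also have "fps_nth (dilate p g) (p * n) = fps_nth g n" using p0 by (simp add: dilate_def)
  finally show "[fps_nth (hecke p p (g ^ p)) n = fps_nth g n] (mod int p)" .
qed

context generators
begin

text \<open>A modular form congruent to \<open>z\<^sup>s h\<^sup>e\<close> yields, on writing it in terms of \<open>z\<close> and \<open>h\<close> and cancelling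
  \<open>z\<^sup>s h\<^sup>e\<close>, the polynomial needed for the Lucas congruences.\<close>

lemma lucas_congruences_of_form:
  assumes p: "prime p" and f: "modular k (of_int_fps f)" and c: "fps_cong p f (h ^ e * z ^ s)"
    and k: "k = p - 1 + s + w * e" and s: "s \<le> k mod w" and ord: "\<And>j. j < e \<Longrightarrow> fps_nth f j = 0"
    and t: "t * z ^ w = h" and T: "z = Abs_fps T oo t"
  shows "lucas_congruences T p"
proof -
  define K where "K = k div w"
  obtain b where b: "f = (\<Sum>i\<le>K. fps_const (b i) * h ^ i * z ^ (k - w * i))"
    using modular_representation[OF f] unfolding K_def by blast
  have kK: "w * K + k mod w = k" unfolding K_def by (simp add: mult.commute)
  \<comment> \<open>As \<open>f\<close> itself, not only its reduction, starts at
    \<open>q^e\<close>, the first \<open>e\<close> coefficients are exactly zero and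
    \<open>h ^ e\<close> divides \<open>f\<close> term by term.\<close>
  have b0: "b j = 0" if "j < e" for j
    using that
  proof (induction j rule: less_induct)
    case (less j)
    have wj: "w * e \<le> k" unfolding k by simp
    then have "e \<le> K" unfolding K_def using w_pos by (simp add: less_eq_div_iff_mult_less_eq mult.commute)
    then have jK: "j \<le> K" using less.prems by simp
    have summand: "fps_nth (fps_const (b i) * h ^ i * z ^ (k - w * i)) j = (if i = j then b j else 0)" for i
    proof (cases "i < j")
      case True
      then show ?thesis using less.IH[of i] less.prems by simp
    next
      case False
      then show ?thesis using power_product_nth[OF z0 h_nth_0 h_nth, of j i "k - w * i"] by (simp add: mult.assoc)
    qed
    have "0 = fps_nth f j" using ord less.prems by simp
    also have "\<dots> = (\<Sum>i\<le>K. if i = j then b j else 0)" unfolding b fps_sum_nth summand ..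
    also have "\<dots> = b j" using jK by simp
    finally show ?case by simp
  qed
  define u where "u = h ^ e * z ^ s"
  define S where "S = (\<Sum>i\<le>K - e. fps_const (b (i + e)) * h ^ i * z ^ (p - 1 - w * i))"
  have eK: "e \<le> K" unfolding K_def using w_pos k by (simp add: less_eq_div_iff_mult_less_eq mult.commute)
  \<comment> \<open>The exponent of \<open>z\<close> in every term is at least
    \<open>k mod w\<close>, hence at least \<open>s\<close>, so \<open>z ^ s\<close> can be split
    off as well.\<close>
  have le: "w * i \<le> p - 1" if "i \<le> K - e" for i
  proof -
    have "w * (i + e) \<le> w * K" using that eK by (intro mult_le_mono2) simp
    then have "w * i + w * e + s \<le> k" using kK s by (simp add: ring_distribs)
    then show ?thesis unfolding k by simp
  qed
  have "f = (\<Sum>i\<in>{e..K}. fps_const (b i) * h ^ i * z ^ (k - w * i))"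
    unfolding b using b0 by (intro sum.mono_neutral_right) auto
  also have "\<dots> = (\<Sum>i\<le>K - e. fps_const (b (i + e)) * h ^ (i + e) * z ^ (k - w * (i + e)))"
    by (rule sum.reindex_bij_witness[of _ "\<lambda>i. i + e" "\<lambda>i. i - e"]) (use eK in auto)
  also have "\<dots> = u * S"
    unfolding S_def sum_distrib_left
  proof (rule sum.cong)
    fix i assume "i \<in> {..K - e}"
    then have "w * i \<le> p - 1" using le by simp
    then have "k - w * (i + e) = s + (p - 1 - w * i)" unfolding k by (simp add: ring_distribs)
    then show "fps_const (b (i + e)) * h ^ (i + e) * z ^ (k - w * (i + e)) = u * (fps_const (b (i + e)) * h ^ i * z ^ (p - 1 - w * i))"
      unfolding u_def power_add by (simp add: mult_ac power_add)
  qed simp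
  finally have "fps_cong p (u * 1) (u * S)" using c by (simp add: u_def fps_cong_sym)
  moreover have "fps_nth u j = (if j = e then 1 else 0)" if "j \<le> e" for j
    unfolding u_def by (rule power_product_nth[OF z0 h_nth_0 h_nth that])
  ultimately have "fps_cong p 1 S" by (intro fps_cong_cancel[of e u p 1 S]) auto
  then show ?thesis
    unfolding S_def by (intro lucas_from_form[OF p h_nth_0 h_nth z0 t T le[OF order_refl] w_pos])
qed

lemma lucas_congruences_2:
  assumes even: "fps_cong 2 1 z" and t: "t * z ^ w = h" and T: "z = Abs_fps T oo t"
  shows "lucas_congruences T 2"
  by (rule lucas_from_form[OF two_is_prime_nat h_nth_0 h_nth z0 t T _ w_pos, of 0 "\<lambda>_. 1"]) (use even in auto)

end

locale theta_level = form N a c + eta_level N r for N a c r +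
  assumes eta_mod: "modular r (of_int_fps eta_prod)"
begin

sublocale generators N r eta_unit theta eta_prod
  by unfold_locales (use modular_Theta theta_nth_0 of_int_eta_prod eta_mod eta_prod_nth(2) in simp_all)

text \<open>For \<open>n > 0\<close> the representations of \<open>n\<close> pair off under
  \<open>(j, k)\<close> to \<open>(- j, - k)\<close>, which fixes only the origin; \<open>B\<close>
  is a half plane choosing one of each pair.\<close>

lemma theta_even: "fps_cong 2 1 theta"
  unfolding fps_cong_def
proof
  fix n
  show "[fps_nth 1 n = fps_nth theta n] (mod int 2)"
  proof (cases "n = 0")
    case False
    define A where "A = {x. nat (case x of (j, k) \<Rightarrow> Q j k) = n}"
    define B where "B = {x \<in> A. fst x > 0 \<or> fst x = 0 \<and> snd x > 0}"
    define f where "f = (\<lambda>(j, k). (- j, - k) :: int \<times> int)"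
    have finA: "finite A" unfolding A_def by (rule finite_Q_le)
    have Qf: "Q (- j) (- k) = Q j k" for j k by (simp add: Q_def)
    have "Q 0 0 = 0" by (simp add: Q_def)
    then have nz: "(j, k) \<noteq> (0, 0)" if "(j, k) \<in> A" for j k
      using that False by (auto simp: A_def)
    have "f x \<in> A" if "x \<in> A" for x using that by (cases x) (simp add: A_def f_def Qf)
    then have "f ` B \<subseteq> A" by (auto simp: B_def)
    moreover have "x \<in> B \<union> f ` B" if x: "x \<in> A" for x
    proof (cases "x \<in> B")
      case False
      obtain j k where jk: "x = (j, k)" by (cases x)
      have "(- j, - k) \<in> B" using x nz[of j k] False unfolding jk by (auto simp: B_def A_def Qf)
      then have "f (- j, - k) \<in> f ` B" by (rule imageI)
      then show ?thesis by (simp add: f_def jk)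
    qed simp
    ultimately have AB: "A = B \<union> f ` B" by (auto simp: B_def)
    have "B \<inter> f ` B = {}" by (auto simp: B_def f_def)
    moreover have "finite B" using finA by (simp add: B_def)
    moreover have "card (f ` B) = card B" by (rule card_image) (auto simp: f_def inj_on_def)
    ultimately have "card A = 2 * card B" unfolding AB by (simp add: card_Un_disjoint)
    moreover have "A = {i. (case i of (j, k) \<Rightarrow> nat (Q j k)) = n}" by (auto simp: A_def)
    ultimately show ?thesis using False by (simp add: theta_def fibre_fps_def cong_iff_dvd_diff)
  qed (simp add: theta_nth_0)
qed

context
  fixes t :: "int fps" and T :: "nat \<Rightarrow> int"
  assumes t: "t * theta ^ r = eta_prod" and T: "theta = Abs_fps T oo t"
begin

lemma lucas_2: "lucas_congruences T 2"
  by (rule lucas_congruences_2[OF theta_even t T])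

lemma lucas_level:
  assumes r2: "r dvd 2"
  shows "lucas_congruences T N"
proof -
  \<comment> \<open>With \<open>r e = 2\<close> the weight \<open>12 e\<close> equals
    \<open>N + 1 = (N - 1) + r e\<close>, so cancelling \<open>eta_prod ^ e\<close> leaves precisely
    weight \<open>N - 1\<close>.\<close>
  obtain e where e: "2 = r * e" using r2 by blast
  have e0: "e > 0" using e by (cases e) auto
  have "24 * e = r * e * (N + 1)" using r by (metis mult.assoc mult.commute)
  then have k: "12 * e = N - 1 + 0 + r * e" using e N_pos by simp
  have dN: "fps_cong N delta_N 0"
    using N_pos by (simp add: fps_cong_def delta_N_def cong_0_iff)
  show ?thesis
  proof (rule lucas_congruences_of_form[OF N_prime _ _ k _ _ t T])
    show "modular (12 * e) (of_int_fps (delta ^ e + delta_N ^ e))"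
      using modular_Delta_power_sum[of e] by simp
    have "fps_cong N (delta ^ e + delta_N ^ e) (eta_prod ^ e + 0 ^ e)"
      by (intro fps_cong_add fps_cong_power delta_cong_eta_prod dN)
    then show "fps_cong N (delta ^ e + delta_N ^ e) (eta_prod ^ e * theta ^ 0)" using e0 by (simp add: zero_power)
    have "fps_nth delta 0 = 0" by (simp add: delta_def)
    moreover have "fps_nth delta_N 0 = 0" by (simp add: delta_N_def dilate_def delta_def)
    ultimately show "fps_nth (delta ^ e + delta_N ^ e) j = 0" if "j < e" for j
      using startsby_zero_power_prefix[of delta e] startsby_zero_power_prefix[of delta_N e] that by simp
  qed simp
qed

lemma lucas_split:
  assumes p: "prime p" "p \<noteq> N" "odd p" and ep: "eps (int p) = 1" and r2: "r dvd 2"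
  shows "lucas_congruences T p"
proof -
  have p0: "p > 0" using p by (simp add: prime_gt_0_nat)
  have "r = 1 \<or> r = 2" using r2 r_pos dvd_imp_le[OF r2] by auto
  then show ?thesis
  proof
    assume r1: "r = 1"
    \<comment> \<open>In weight 1 the power \<open>theta ^ p\<close> would lead to a polynomial of
      degree up to \<open>p\<close>, one too many. With \<open>eta_prod ^ p\<close> a factor
      \<open>eta_prod\<close> can be cancelled, which lowers the degree to
      \<open>p - 1\<close>.\<close>
    have m: "modular p (of_int_fps (eta_prod ^ p))"
      using modular_power[OF eta_mod, of p] r1 by simp
    show ?thesis
    proof (rule lucas_congruences_of_form[where e = 1 and s = 0, OF p(1) _ _ _ _ _ t T])
      show "modular p (of_int_fps (hecke p p (eta_prod ^ p)))"
        using modular_hecke[OF p(1,2) m p0] ep by simp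
      show "fps_cong p (hecke p p (eta_prod ^ p)) (eta_prod ^ 1 * theta ^ 0)"
        using hecke_cong[OF p(1), of eta_prod] by simp
      show "fps_nth (hecke p p (eta_prod ^ p)) j = 0" if "j < 1" for j
        using that p0 eta_prod_nth(1) by (simp add: hecke_def fps_power_zeroth zero_power)
    qed (use r1 p0 in auto)
  next
    assume r2: "r = 2"
    \<comment> \<open>Here \<open>eta_prod ^ p\<close> would have weight \<open>2 p\<close>. The
      image of \<open>theta ^ p\<close> has odd weight \<open>p\<close>, so each of its terms
      contains a factor \<open>theta\<close>, which is the one cancelled.\<close>
    have m: "modular p (of_int_fps (theta ^ p))"
      using modular_power[OF modular_Theta, of p] by simp
    show ?thesis
    proof (rule lucas_congruences_of_form[where e = 0 and s = 1, OF p(1) _ _ _ _ _ t T])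
      show "modular p (of_int_fps (hecke p p (theta ^ p)))"
        using modular_hecke[OF p(1,2) m p0] ep by simp
      show "fps_cong p (hecke p p (theta ^ p)) (eta_prod ^ 0 * theta ^ 1)"
        using hecke_cong[OF p(1), of theta] by simp
      show "1 \<le> p mod r" using r2 p(3) by (simp add: odd_iff_mod_2_eq_one)
    qed (use p0 in auto)
  qed
qed

end

text \<open>As \<open>N\<close> is 3 modulo 4, the sign in quadratic reciprocity is
  \<open>(- 1) ^ ((p - 1) div 2)\<close>, the Legendre symbol of \<open>- 1\<close>, and the two
  signs cancel.\<close>

lemma Legendre_minus_N:
  assumes p: "prime p" "p \<noteq> N" "odd p"
  shows "Legendre (- int N) (int p) = eps (int p)"
proof -
  have p2: "p > 2" using p prime_ge_2_nat[of p] by (cases "p = 2") auto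
  have m1: "(- 1 :: int) ^ ((p - 1) div 2 * ((N - 1) div 2)) = (- 1) ^ ((p - 1) div 2)"
    using half_N_odd by (simp add: uminus_power_if)
  have "Legendre (int p) (int N) * Legendre (int N) (int p) = (- 1) ^ ((p - 1) div 2 * ((N - 1) div 2))"
    using Quadratic_Reciprocity[OF p(1) p2 N_prime N_gt_2 p(2)] by simp
  then have QR: "eps (int p) * Legendre (int N) (int p) = (- 1) ^ ((p - 1) div 2)"
    unfolding m1 eps_def .
  have "\<not> int N dvd int p" using primes_dvd_imp_eq[OF N_prime p(1)] p(2) by auto
  then have sq: "eps (int p) * eps (int p) = 1" by (rule eps_square)
  have "Legendre (- int N) (int p) = Legendre (- 1) (int p) * Legendre (int N) (int p)"
    using Legendre_mult[OF p(1) p2, of "- 1" "int N"] by simp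
  also have "\<dots> = eps (int p) * (Legendre (int N) (int p) * Legendre (int N) (int p))"
    unfolding Legendre_minus_1[OF p(1) p2] QR[symmetric] by simp
  also have "Legendre (int N) (int p) * Legendre (int N) (int p) = 1"
  proof -
    have "Legendre (int N) (int p) \<noteq> 0" using QR by auto
    then show ?thesis by (auto simp: Legendre_def split: if_splits)
  qed
  finally show ?thesis by simp
qed

end

subsection \<open>Expansions at the cusp\<close>

text \<open>Large imaginary part means a punctured disc around \<open>0\<close> for the nome; the
  value at \<open>0\<close> itself is settled by continuity.\<close>

lemma q_expansion_unique:
  assumes F: "has_q_expansion f F" and G: "has_q_expansion f G"
  shows "F = G"
proof -
  obtain g where g: "g has_fps_expansion F" "\<forall>\<^sub>F \<tau> in filtercomap Im at_top. f \<tau> = g (nome \<tau>)"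
    using F unfolding has_q_expansion_def by blast
  obtain g' where g': "g' has_fps_expansion G" "\<forall>\<^sub>F \<tau> in filtercomap Im at_top. f \<tau> = g' (nome \<tau>)"
    using G unfolding has_q_expansion_def by blast
  have "\<forall>\<^sub>F \<tau> in filtercomap Im at_top. g (nome \<tau>) = g' (nome \<tau>)"
    using g(2) g'(2) by eventually_elim simp
  then obtain B where B: "\<And>\<tau>. Im \<tau> > B \<Longrightarrow> g (nome \<tau>) = g' (nome \<tau>)"
    unfolding eventually_filtercomap eventually_at_top_dense by blast
  define \<rho> where "\<rho> = min 1 (exp (- 2 * pi * B))"
  have \<rho>: "\<rho> > 0" by (simp add: \<rho>_def)
  have eq: "g z = g' z" if "z \<in> ball 0 \<rho> - {0}" for z
  proof -
    have z: "z \<noteq> 0" "norm z < 1" "norm z < exp (- 2 * pi * B)" using that by (auto simp: \<rho>_def)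
    obtain \<tau> where \<tau>: "Im \<tau> > 0" "nome \<tau> = z" using nome_surj[OF z(1,2)] .
    have "Im \<tau> > B" using z(3) unfolding \<tau>(2)[symmetric] norm_nome by simp
    then show ?thesis using B[of \<tau>] \<tau> by simp
  qed
  have "eventually (\<lambda>z. z \<in> ball 0 \<rho> - {0}) (at (0::complex))"
    by (rule eventually_at_in_open) (use \<rho> in auto)
  then have ev: "eventually (\<lambda>z. g' z = g z) (at 0)" by eventually_elim (simp add: eq)
  have "(g \<longlongrightarrow> g 0) (at 0)" "(g' \<longlongrightarrow> g' 0) (at 0)"
    using has_fps_expansion_imp_continuous[OF g(1), of UNIV] has_fps_expansion_imp_continuous[OF g'(1), of UNIV]
    by (simp_all add: isCont_def)
  then have "g 0 = g' 0" using Lim_transform_eventually[OF _ ev] LIM_unique by metis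
  with ev have "eventually (\<lambda>z. g' z = g z) (nhds 0)"
    by (simp add: eventually_nhds_conv_at)
  then have "g has_fps_expansion G" using g'(1) has_fps_expansion_cong[of g' g G G] by simp
  then show ?thesis by (rule fps_expansion_unique_complex[OF g(1)])
qed

lemma q_expansion_cong:
  assumes "\<And>\<tau>. Im \<tau> > B \<Longrightarrow> f \<tau> = g \<tau>" "has_q_expansion f F"
  shows "has_q_expansion g F"
proof -
  obtain u where u: "u has_fps_expansion F" "\<forall>\<^sub>F \<tau> in filtercomap Im at_top. f \<tau> = u (nome \<tau>)"
    using assms(2) unfolding has_q_expansion_def by blast
  have "\<forall>\<^sub>F \<tau> in filtercomap Im at_top. Im \<tau> > B"
    unfolding eventually_filtercomap using eventually_gt_at_top[of B] by blast
  with u(2) have "\<forall>\<^sub>F \<tau> in filtercomap Im at_top. g \<tau> = u (nome \<tau>)"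
    by eventually_elim (simp add: assms(1))
  with u(1) show ?thesis unfolding has_q_expansion_def by blast
qed

lemma q_expansion_disc: "disc_fps a \<Longrightarrow> has_q_expansion (\<lambda>\<tau>. evq a \<tau>) a"
  unfolding has_q_expansion_def
  using disc_fpsD[of a 0] by (intro exI[of _ "eval_fps a"] conjI eval_fps_has_fps_expansion) (auto simp: zero_ereal_def)

lemma q_expansion_mult: "has_q_expansion f F \<Longrightarrow> has_q_expansion g G \<Longrightarrow> has_q_expansion (\<lambda>\<tau>. f \<tau> * g \<tau>) (F * G)"
  unfolding has_q_expansion_def
proof (elim exE conjE)
  fix u v assume u: "u has_fps_expansion F" "\<forall>\<^sub>F \<tau> in filtercomap Im at_top. f \<tau> = u (nome \<tau>)"
    and v: "v has_fps_expansion G" "\<forall>\<^sub>F \<tau> in filtercomap Im at_top. g \<tau> = v (nome \<tau>)"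
  have "\<forall>\<^sub>F \<tau> in filtercomap Im at_top. f \<tau> * g \<tau> = u (nome \<tau>) * v (nome \<tau>)"
    using u(2) v(2) by eventually_elim simp
  then show "\<exists>k. k has_fps_expansion F * G \<and> (\<forall>\<^sub>F \<tau> in filtercomap Im at_top. f \<tau> * g \<tau> = k (nome \<tau>))"
    using has_fps_expansion_mult[OF u(1) v(1)] by blast
qed

lemma evq_nonzero_near_cusp:
  assumes a: "disc_fps a" and a0: "fps_nth a 0 \<noteq> 0"
  obtains B where "B \<ge> 0" "\<And>\<tau>. Im \<tau> > B \<Longrightarrow> evq a \<tau> \<noteq> 0"
proof -
  have "isCont (eval_fps a) 0"
    using holomorphic_on_imp_continuous_on[OF disc_fps_holomorphic[OF a]] by (simp add: continuous_on_eq_continuous_at)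
  moreover have "eval_fps a 0 \<noteq> 0" using a0 by (simp add: eval_fps_at_0)
  ultimately obtain \<rho> where \<rho>: "\<rho> > 0" "\<And>z. dist 0 z < \<rho> \<Longrightarrow> eval_fps a z \<noteq> 0"
    using continuous_at_avoid[of 0 "eval_fps a" 0] by auto
  show ?thesis
  proof (rule that)
    fix \<tau> assume \<tau>: "Im \<tau> > max 0 (- ln \<rho> / (2 * pi))"
    then have "- 2 * pi * Im \<tau> < ln \<rho>" by (simp add: field_simps)
    then have "norm (nome \<tau>) < \<rho>" using \<rho>(1) unfolding norm_nome by (metis exp_less_mono exp_ln)
    then show "evq a \<tau> \<noteq> 0" by (intro \<rho>(2)) simp
  qed simp
qed

text \<open>Convergence in the \<open>q\<close>-adic metric makes each coefficient of the partial
  sums eventually constant, and by \<open>t0\<close> only the powers up to \<open>m\<close> reach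
  the \<open>m\<close>-th coefficient.\<close>

lemma expansion_imp_compose:
  fixes t z :: "int fps"
  assumes s: "(\<lambda>n. of_int (T n) * of_int_fps t ^ n) sums of_int_fps z" and t0: "fps_nth t 0 = 0"
  shows "z = Abs_fps T oo t"
proof (rule fps_ext)
  fix m
  have "eventually (\<lambda>n. fps_nth (\<Sum>i<n. of_int (T i) * of_int_fps t ^ i) m = fps_nth (of_int_fps z) m) sequentially"
    using s unfolding sums_def tendsto_fps_iff by blast
  then obtain n0 where n0: "\<And>n. n \<ge> n0 \<Longrightarrow> fps_nth (\<Sum>i<n. of_int (T i) * of_int_fps t ^ i) m = fps_nth (of_int_fps z) m"
    by (auto simp: eventually_sequentially)
  define n where "n = max n0 (Suc m)"
  have "of_int_fps (\<Sum>i<n. fps_const (T i) * t ^ i) = (\<Sum>i<n. of_int (T i) * of_int_fps t ^ i)"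
    by (simp add: of_int_fps_sum fps_of_int)
  then have "fps_nth (of_int_fps z) m = fps_nth (of_int_fps (\<Sum>i<n. fps_const (T i) * t ^ i)) m"
    using n0[of n] by (simp add: n_def)
  then have "fps_nth z m = fps_nth (\<Sum>i<n. fps_const (T i) * t ^ i) m"
    by (simp add: of_int_fps_def)
  also have "\<dots> = (\<Sum>i<n. T i * fps_nth (t ^ i) m)" by (simp add: fps_sum_nth)
  also have "\<dots> = (\<Sum>i\<in>{0..m}. T i * fps_nth (t ^ i) m)"
    using startsby_zero_power_prefix[OF t0] by (intro sum.mono_neutral_right) (auto simp: n_def)
  finally show "fps_nth z m = fps_nth (Abs_fps T oo t) m" by (simp add: fps_compose_nth)
qed

section \<open>From the analytic definitions to integral power series\<close>

lemma dedekind_eta_Pent: "Im \<tau> > 0 \<Longrightarrow> dedekind_eta \<tau> = exp (2 * of_real pi * \<i> * \<tau> / 24) * evq Pent \<tau>"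
  unfolding dedekind_eta_def by (simp add: pentagonal_number_theorem(1) norm_nome_less_1)

context theta_level
begin

lemma evq_eta_prod:
  assumes "Im \<tau> > 0"
  shows "evq (of_int_fps eta_prod) \<tau> = (dedekind_eta \<tau> * dedekind_eta (of_nat N * \<tau>)) ^ r"
proof -
  have N\<tau>: "Im (of_nat N * \<tau>) > 0" using assms N_pos by simp
  define x where "x = 2 * of_real pi * \<i> * \<tau> / 24"
  have x: "2 * of_real pi * \<i> * (of_nat N * \<tau>) / 24 = of_nat N * x" by (simp add: x_def)
  have "(exp x * exp (of_nat N * x)) ^ r = exp (of_nat (r * (N + 1)) * x)"
    by (simp add: exp_of_nat_mult[symmetric] ring_distribs mult_ac flip: exp_add)
  also have "of_nat (r * (N + 1)) * x = 2 * of_real pi * \<i> * \<tau>" unfolding r by (simp add: x_def)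
  finally have E: "(exp x * exp (of_nat N * x)) ^ r = nome \<tau>" by (simp add: nome_def)
  have "evq (of_int_fps eta_prod) \<tau> = nome \<tau> * (evq Pent \<tau> * evq Pent (of_nat N * \<tau>)) ^ r"
    unfolding of_int_eta_prod using assms
    by (simp add: eval_disc_mult disc_eta_unit norm_nome_less_1 eval_eta_unit nome_power)
  also have "\<dots> = (dedekind_eta \<tau> * dedekind_eta (of_nat N * \<tau>)) ^ r"
    unfolding dedekind_eta_Pent[OF assms] dedekind_eta_Pent[OF N\<tau>] x x_def[symmetric] E[symmetric]
    by (simp add: power_mult_distrib mult_ac)
  finally show ?thesis .
qed

lemma evq_Theta_powi:
  assumes "Im \<tau> > 0"
  shows "evq Theta \<tau> = (\<Sum>\<^sub>\<infinity>(j, k)\<in>UNIV. nome \<tau> powi (a * j\<^sup>2 + j * k + c * k\<^sup>2))"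
  unfolding eval_Theta[OF norm_nome_less_1[OF assms]]
  using Q_nonneg by (intro infsum_cong) (auto simp: Q_def power_int_def)

text \<open>The quotient is cleared of its denominator near the cusp, where \<open>Theta\<close> has
  no zeros, and uniqueness of expansions gives \<open>F * Theta ^ r\<close>. Integrality of
  \<open>F\<close> follows because \<open>theta ^ r\<close> has constant term 1 and hence an
  integral inverse.\<close>

lemma expansion_coeffs_compose:
  assumes T: "expansion_coeffs f g T"
    and f: "\<And>\<tau>. Im \<tau> > 0 \<Longrightarrow> f \<tau> = (dedekind_eta \<tau> * dedekind_eta (of_nat N * \<tau>)) ^ r / g \<tau> ^ r"
    and g: "\<And>\<tau>. Im \<tau> > 0 \<Longrightarrow> g \<tau> = evq Theta \<tau>"
  obtains t where "t * theta ^ r = eta_prod" "theta = Abs_fps T oo t"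
proof -
  obtain F G where F: "has_q_expansion f F" and G: "has_q_expansion g G" and s: "(\<lambda>n. of_int (T n) * F ^ n) sums G"
    using T unfolding expansion_coeffs_def by blast
  have G': "G = Theta"
    by (rule q_expansion_unique[OF G q_expansion_cong[where B = 0, OF _ q_expansion_disc[OF disc_Theta]]]) (simp add: g)
  have Th0: "fps_nth Theta 0 \<noteq> 0" by (simp add: of_int_fps_def theta_nth_0)
  obtain B where B: "B \<ge> 0" "\<And>\<tau>. Im \<tau> > B \<Longrightarrow> evq Theta \<tau> \<noteq> 0"
    using evq_nonzero_near_cusp[OF disc_Theta Th0] by blast
  have "has_q_expansion (\<lambda>\<tau>. f \<tau> * evq (Theta ^ r) \<tau>) (F * Theta ^ r)"
    by (intro q_expansion_mult F q_expansion_disc disc_fps_power disc_Theta)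
  moreover have "has_q_expansion (\<lambda>\<tau>. f \<tau> * evq (Theta ^ r) \<tau>) (of_int_fps eta_prod)"
  proof (rule q_expansion_cong[OF _ q_expansion_disc])
    show "disc_fps (of_int_fps eta_prod)" using modular_disc[OF eta_mod] .
    fix \<tau> assume \<tau>: "Im \<tau> > B"
    then have \<tau>0: "Im \<tau> > 0" using B(1) by simp
    show "evq (of_int_fps eta_prod) \<tau> = f \<tau> * evq (Theta ^ r) \<tau>"
      using B(2)[OF \<tau>] unfolding evq_eta_prod[OF \<tau>0] f[OF \<tau>0] g[OF \<tau>0]
      by (simp add: eval_disc_power disc_Theta norm_nome_less_1 \<tau>0)
  qed
  ultimately have FT: "F * Theta ^ r = of_int_fps eta_prod" by (rule q_expansion_unique)
  define t where "t = eta_prod * fps_left_inverse (theta ^ r) 1"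
  have "fps_left_inverse (theta ^ r) 1 * theta ^ r = 1"
    by (rule fps_left_inverse) (simp add: fps_power_zeroth theta_nth_0)
  then have t: "t * theta ^ r = eta_prod" by (simp add: t_def mult.assoc)
  have "Theta ^ r \<noteq> 0" using Th0 by auto
  moreover have "F * Theta ^ r = of_int_fps t * Theta ^ r" using FT t by (simp flip: of_int_fps_mult of_int_fps_power)
  moreover have "x = y" if "x * u = y * u" "u \<noteq> 0" for x y u :: "complex fps" using that by simp
  ultimately have Ft: "F = of_int_fps t" by blast
  have "fps_nth t 0 = 0" by (simp add: t_def eta_prod_nth)
  then have "theta = Abs_fps T oo t" by (intro expansion_imp_compose) (use s Ft G' in simp_all)
  with t show ?thesis by (rule that)
qed

theorem lucas_congruences_level:
  assumes T: "expansion_coeffs f g T"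
    and f: "\<And>\<tau>. Im \<tau> > 0 \<Longrightarrow> f \<tau> = (dedekind_eta \<tau> * dedekind_eta (of_nat N * \<tau>)) ^ r / g \<tau> ^ r"
    and g: "\<And>\<tau>. g \<tau> = (\<Sum>\<^sub>\<infinity>(j, k)\<in>UNIV. nome \<tau> powi (a * j\<^sup>2 + j * k + c * k\<^sup>2))"
    and r2: "r dvd 2" and p: "prime p" "p = 2 \<or> p = N \<or> Legendre (- int N) (int p) = 1"
  shows "lucas_congruences T p"
proof -
  obtain t where t: "t * theta ^ r = eta_prod" and z: "theta = Abs_fps T oo t"
    using expansion_coeffs_compose[OF T f] g evq_Theta_powi by metis
  consider "p = 2" | "p = N" | "p \<noteq> N" "odd p" "Legendre (- int N) (int p) = 1"
    using p prime_odd_nat[of p] prime_ge_2_nat[of p] by (cases "p = 2") auto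
  then show ?thesis
  proof cases
    case 1
    then show ?thesis using lucas_2[OF t z] by simp
  next
    case 2
    then show ?thesis using lucas_level[OF t z r2] by simp
  next
    case 3
    then show ?thesis using lucas_split[OF t z p(1) 3(1,2) _ r2] Legendre_minus_N[OF p(1) 3(1,2)] by simp
  qed
qed

end

subsection \<open>Levels 11 and 23\<close>

context form
begin

text \<open>Replaces the fibre by a finite box, so that the first coefficients can be computed by
  simplification.\<close>

lemma theta_nth:
  "fps_nth theta n = (\<Sum>j\<in>{- int n..int n}. \<Sum>k\<in>{- int n..int n}. if Q j k = int n then 1 else 0)"
proof -
  define D where "D = {- int n..int n} \<times> {- int n..int n}"
  have sq: "\<bar>i\<bar> \<le> int n" if "i\<^sup>2 \<le> 2 * int n" for i
  proof (rule ccontr)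
    assume "\<not> \<bar>i\<bar> \<le> int n"
    then have "(int n + 1)\<^sup>2 \<le> \<bar>i\<bar>\<^sup>2" by (intro power_mono) auto
    then have "(int n)\<^sup>2 + 1 + 2 * int n \<le> 2 * int n" using that by (simp add: power2_eq_square algebra_simps)
    then show False using zero_le_power2[of "int n"] by linarith
  qed
  have "\<bar>j\<bar> \<le> int n \<and> \<bar>k\<bar> \<le> int n" if "Q j k = int n" for j k
  proof -
    have "j\<^sup>2 + k\<^sup>2 \<le> 2 * int n" using Q_ge[of j k] that by simp
    then show ?thesis using zero_le_power2[of j] zero_le_power2[of k] by (intro conjI sq) linarith+
  qed
  then have "(j, k) \<in> D" if "nat (Q j k) = n" for j k
    using that Q_nonneg[of j k] by (force simp: D_def abs_le_iff)
  moreover have "nat (Q j k) = n \<longleftrightarrow> Q j k = int n" for j k using Q_nonneg[of j k] by auto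
  ultimately have "{x. (case x of (j, k) \<Rightarrow> nat (Q j k)) = n} = {x \<in> D. case x of (j, k) \<Rightarrow> Q j k = int n}"
    by auto
  moreover have "finite D" by (simp add: D_def)
  ultimately have "fps_nth theta n = (\<Sum>x\<in>D. if (case x of (j, k) \<Rightarrow> Q j k = int n) then 1 else 0)"
    unfolding theta_def fibre_fps_def fps_nth_Abs_fps by (simp add: sum.inter_filter del: sum_constant)
  then show ?thesis by (simp add: D_def sum.cartesian_product case_prod_unfold)
qed

end

lemma int_intervals: "{- 1..1::int} = {- 1, 0, 1}" "{- 2..2::int} = {- 2, - 1, 0, 1, 2}"
  by auto

interpretation f11: form 11 1 3 by unfold_locales simp_all

interpretation f23: form 23 1 6 by unfold_locales simp_all

interpretation f23': form 23 2 3 by unfold_locales simp_all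

interpretation e11: eta_level 11 2 by unfold_locales simp

interpretation e23: eta_level 23 1 by unfold_locales simp

lemma theta_coeffs:
  "fps_nth f11.theta 1 = 2" "fps_nth f11.theta 2 = 0" "fps_nth f23.theta 1 = 2" "fps_nth f23'.theta 1 = 0"
  by (simp_all add: f11.theta_nth f11.Q_def f23.theta_nth f23.Q_def f23'.theta_nth f23'.Q_def int_intervals)

text \<open>A cusp form of weight 2 is found with the Hecke operator at 2: it multiplies constant
  terms by \<open>1 + 2 = 3\<close>, so 3 times \<open>theta ^ 2\<close> minus its image has
  constant term zero. Its coefficient of \<open>q\<close> is \<open>3 * 4 - 4 = 8\<close>.\<close>

lemma modular_eta_prod_11: "f11.modular 2 (of_int_fps e11.eta_prod)"
proof (rule e11.modular_eta_prod)
  define x where "x = f11.theta ^ 2"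
  define y where "y = fps_const 3 * x - hecke 2 2 x"
  have m: "f11.modular 2 (of_int_fps x)"
    using f11.modular_power[OF f11.modular_Theta, of 2] by (simp add: x_def)
  have nat_intervals: "{0..1::nat} = {0, 1}" "{0..2::nat} = {0, 1, 2}" by auto
  have x0: "fps_nth x 0 = 1" "fps_nth x 1 = 4" "fps_nth x 2 = 4"
    by (simp_all add: x_def power2_eq_square fps_mult_nth f11.theta_nth_0 nat_intervals
        theta_coeffs theta_coeffs[unfolded One_nat_def])
  have "(f11.eps 2)\<^sup>2 = 1" using f11.eps_square[of 2] by (simp add: power2_eq_square)
  then have "f11.modular 2 (fps_const 3 * of_int_fps x - hecke 2 2 (of_int_fps x))"
    by (intro f11.modular_diff f11.modular_cmult m) (use f11.modular_hecke[OF two_is_prime_nat _ m] in \<open>simp flip: of_int_power\<close>)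
  then show "f11.modular 2 (of_int_fps y)" by (simp add: y_def)
  show "fps_nth (of_int_fps y) 0 = (0::complex)"
    by (simp add: y_def of_int_fps_def hecke_def x0)
  show "fps_nth (of_int_fps y) 1 \<noteq> (0::complex)"
    by (simp add: y_def of_int_fps_def hecke_def x0 x0[unfolded One_nat_def])
qed

text \<open>In weight 1 the two theta series of discriminant \<open>-23\<close> have the same
  constant term, and their difference begins with \<open>2 q\<close>.\<close>

lemma modular_eta_prod_23: "f23.modular 1 (of_int_fps e23.eta_prod)"
proof (rule e23.modular_eta_prod)
  show "f23.modular 1 (f23.Theta - f23'.Theta)"
    by (intro f23.modular_diff f23.modular_Theta f23'.modular_Theta)
  show "fps_nth (f23.Theta - f23'.Theta) 0 = 0"
    by (simp add: of_int_fps_def f23.theta_nth_0 f23'.theta_nth_0)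
  show "fps_nth (f23.Theta - f23'.Theta) 1 \<noteq> 0"
    using theta_coeffs by (simp add: of_int_fps_def)
qed

interpretation l11: theta_level 11 1 3 2
  by unfold_locales (rule modular_eta_prod_11)

interpretation l23: theta_level 23 1 6 1
  by unfold_locales (rule modular_eta_prod_23)

interpretation l23': theta_level 23 2 3 1
  by unfold_locales (rule modular_eta_prod_23)

theorem corollary1p1:
  fixes T1 T2 T3 :: "nat \<Rightarrow> int"
  assumes "expansion_coeffs t1 Z1 T1"
    and "expansion_coeffs t2 Z2 T2"
    and "expansion_coeffs t3 Z3 T3"
  shows "(\<forall>p::nat. prime p \<and> (p = 2 \<or> p = 11 \<or> Legendre (-11) (int p) = 1) \<longrightarrow>
            lucas_congruences T1 p) \<and>
         (\<forall>p::nat. prime p \<and> (p = 2 \<or> p = 23 \<or> Legendre (-23) (int p) = 1) \<longrightarrow>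
            lucas_congruences T2 p \<and> lucas_congruences T3 p)"
proof (intro conjI allI impI; elim conjE)
  fix p :: nat
  assume "prime p" "p = 2 \<or> p = 11 \<or> Legendre (-11) (int p) = 1"
  then show "lucas_congruences T1 p"
    by (intro l11.lucas_congruences_level[OF assms(1)]) (simp_all add: t1_def Z1_def power_mult_distrib)
next
  fix p :: nat
  assume "prime p" "p = 2 \<or> p = 23 \<or> Legendre (-23) (int p) = 1"
  then show "lucas_congruences T2 p"
    by (intro l23.lucas_congruences_level[OF assms(2)]) (simp_all add: t2_def Z2_def)
next
  fix p :: nat
  assume "prime p" "p = 2 \<or> p = 23 \<or> Legendre (-23) (int p) = 1"
  then show "lucas_congruences T3 p"
    by (intro l23'.lucas_congruences_level[OF assms(3)]) (simp_all add: t3_def Z3_def)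
qed

end
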